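(* Let $d\ge1$ be an integer, $\delta>0$ and $1\le p<\infty$. Then (i) $\sigma_p(B_\delta)=[0,1]$ if the Bochner-Riesz mean $B_\delta$ is bounded on $L^p(\mathbb{R}^d)$; and (ii) $\sigma_p(B_\delta)=\mathbb{C}$ if $B_\delta$ is unbounded on $L^p(\mathbb{R}^d)$.
   Context: Fourier transform: $\hat f(\xi)=\int_{\mathbb{R}^d} f(x)e^{-ix\cdot\xi}\,dx$ for integrable $f$, extended to tempered distributions as usual. For $t\in\mathbb{R}$, $t_+=\max(t,0)$. The Bochner-Riesz mean $B_\delta$ is the Fourier multiplier operator defined by $\widehat{B_\delta f}(\xi)=(1-|\xi|^2)_+^\delta\,\hat f(\xi)$. A multiplier operator $T$ with bounded symbol is bounded on $L^p(\mathbb{R}^d)$ if there is a constant $C$ with $\|Tf\|_p\le C\|f\|_p$ for all Schwartz functions $f$ (so $T$ extends uniquely to a bounded operator on $L^p$); otherwise it is unbounded on $L^p$. The spectrum of $B_\delta$ on $L^p$ is $$\sigma_p(B_\delta)=\mathbb{C}\setminus\{z\in\mathbb{C}:\ zI-B_\delta \text{ has bounded inverse on } L^p(\mathbb{R}^d)\},$$ where $I$ is the identity operator. If $B_\delta$ is bounded on $L^p$, "$zI-B_\delta$ has bounded inverse on $L^p$" has the usual meaning for bounded operators (there is a bounded two-sided inverse on $L^p$), so $\sigma_p(B_\delta)$ is the usual spectrum. If $B_\delta$ is unbounded on $L^p$, it means that the inverse exists as a Fourier multiplier operator bounded on $L^p$, i.e. there is $n\in L^\infty(\mathbb{R}^d)$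 with $n(\xi)\,\big(z-(1-|\xi|^2)_+^\delta\big)=1$ for almost every $\xi$ such that the multiplier operator with symbol $n$ is bounded on $L^p$. *)

theory Defs
  imports "HOL-Analysis.Analysis"
begin

text \<open>
  Functions on \<open>\<real>\<^sup>d\<close> are functions on a type of class \<open>euclidean_space\<close> with values in the
  complex numbers. Elements of \<open>L\<^sup>p\<close> are represented by Borel functions, with equality meaning
  equality almost everywhere; this loses nothing, since every Lebesgue measurable function agrees
  almost everywhere with a Borel one.
\<close>

definition Lp_space :: "real \<Rightarrow> ('a::euclidean_space \<Rightarrow> complex) set" where
  "Lp_space p =
     {f. f \<in> borel_measurable lborel \<and> integrable lborel (\<lambda>x. norm (f x) powr p)}"

definition Lp_norm :: "real \<Rightarrow> ('a::euclidean_space \<Rightarrow> complex) \<Rightarrow> real" where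
  "Lp_norm p f = (LINT x|lborel. norm (f x) powr p) powr (1 / p)"

definition Linf_space :: "('a::euclidean_space \<Rightarrow> complex) set" where
  "Linf_space =
     {f. f \<in> borel_measurable lborel \<and> (\<exists>K. AE x in lborel. norm (f x) \<le> K)}"

text \<open>
  \<open>iterated_partial [b\<^sub>1, \<dots>, b\<^sub>k] f\<close> is the partial derivative of order \<open>k\<close> of \<open>f\<close> along the vectors
  \<open>b\<^sub>1, \<dots>, b\<^sub>k\<close>. It is only meaningful when the intermediate derivatives are differentiable, which
  \<open>schwartz\<close> demands.
\<close>

definition iterated_partial ::
    "'a list \<Rightarrow> ('a::euclidean_space \<Rightarrow> complex) \<Rightarrow> 'a \<Rightarrow> complex" where
  "iterated_partial bs f = foldr (\<lambda>b g x. frechet_derivative g (at x) b) bs f"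

definition schwartz :: "('a::euclidean_space \<Rightarrow> complex) \<Rightarrow> bool" where
  "schwartz f \<longleftrightarrow>
     (\<forall>bs \<in> lists Basis.
        (\<forall>x. iterated_partial bs f differentiable (at x)) \<and>
        (\<forall>k::nat. bounded (range (\<lambda>x. norm x ^ k * norm (iterated_partial bs f x)))))"

definition fourier :: "('a::euclidean_space \<Rightarrow> complex) \<Rightarrow> 'a \<Rightarrow> complex" where
  "fourier f \<xi> = (LINT x|lborel. f x * exp (- (\<i> * of_real (x \<bullet> \<xi>))))"

text \<open>
  The Fourier transform of a tempered distribution \<open>u\<close> is \<open>\<phi> \<mapsto> u (fourier \<phi>)\<close>, and a function \<open>g\<close>
  is the distribution \<open>\<phi> \<mapsto> \<integral> g \<phi>\<close>. So the following says that the Fourier transform of \<open>g\<close>, in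
  the sense of tempered distributions, is the function \<open>h\<close>. It is only used with \<open>g\<close> in some
  \<open>L\<^sup>p\<close> and \<open>h\<close> the product of an essentially bounded symbol and the Fourier transform of a
  Schwartz function.
\<close>

definition has_fourier_transform ::
    "('a::euclidean_space \<Rightarrow> complex) \<Rightarrow> ('a \<Rightarrow> complex) \<Rightarrow> bool" where
  "has_fourier_transform g h \<longleftrightarrow>
     (\<forall>\<phi>. schwartz \<phi> \<longrightarrow>
        integrable lborel (\<lambda>x. g x * fourier \<phi> x) \<and>
        integrable lborel (\<lambda>\<xi>. h \<xi> * \<phi> \<xi>) \<and>
        (LINT x|lborel. g x * fourier \<phi> x) = (LINT \<xi>|lborel. h \<xi> * \<phi> \<xi>))"

text \<open>
  \<open>multiplier_image m f g\<close>: \<open>g\<close> is the image of \<open>f\<close> under the Fourier multiplier operator with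
  symbol \<open>m\<close>. This determines \<open>g\<close> up to equality almost everywhere.
\<close>

definition multiplier_image ::
    "('a::euclidean_space \<Rightarrow> complex) \<Rightarrow> ('a \<Rightarrow> complex) \<Rightarrow> ('a \<Rightarrow> complex) \<Rightarrow> bool" where
  "multiplier_image m f g \<longleftrightarrow> has_fourier_transform g (\<lambda>\<xi>. m \<xi> * fourier f \<xi>)"

definition multiplier_bounded :: "real \<Rightarrow> ('a::euclidean_space \<Rightarrow> complex) \<Rightarrow> bool" where
  "multiplier_bounded p m \<longleftrightarrow>
     (\<exists>C. \<forall>f. schwartz f \<longrightarrow>
        (\<exists>g \<in> Lp_space p. multiplier_image m f g \<and> Lp_norm p g \<le> C * Lp_norm p f))"

text \<open>
  Bounded linear operators on \<open>L\<^sup>p\<close>, acting on representatives. Additivity and boundedness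
  imply that such an operator respects equality almost everywhere.
\<close>

definition bounded_Lp_operator ::
    "real \<Rightarrow> (('a::euclidean_space \<Rightarrow> complex) \<Rightarrow> ('a \<Rightarrow> complex)) \<Rightarrow> bool" where
  "bounded_Lp_operator p T \<longleftrightarrow>
     (\<forall>f \<in> Lp_space p. T f \<in> Lp_space p) \<and>
     (\<forall>f \<in> Lp_space p. \<forall>g \<in> Lp_space p.
        AE x in lborel. T (\<lambda>y. f y + g y) x = T f x + T g x) \<and>
     (\<forall>c. \<forall>f \<in> Lp_space p. AE x in lborel. T (\<lambda>y. c * f y) x = c * T f x) \<and>
     (\<exists>C. \<forall>f \<in> Lp_space p. Lp_norm p (T f) \<le> C * Lp_norm p f)"

text \<open>
  \<open>T\<close> is the extension to \<open>L\<^sup>p\<close> of the multiplier operator with symbol \<open>m\<close>. For \<open>1 \<le> p < \<infinity>\<close> and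
  essentially bounded \<open>m\<close> it exists precisely when \<open>multiplier_bounded p m\<close>, and it is then unique
  up to equality almost everywhere of the images.
\<close>

definition multiplier_extension ::
    "real \<Rightarrow> ('a::euclidean_space \<Rightarrow> complex) \<Rightarrow> (('a \<Rightarrow> complex) \<Rightarrow> ('a \<Rightarrow> complex)) \<Rightarrow> bool" where
  "multiplier_extension p m T \<longleftrightarrow>
     bounded_Lp_operator p T \<and> (\<forall>f. schwartz f \<longrightarrow> multiplier_image m f (T f))"

definition shifted_has_bounded_inverse ::
    "real \<Rightarrow> ('a::euclidean_space \<Rightarrow> complex) \<Rightarrow> complex \<Rightarrow> bool" where
  "shifted_has_bounded_inverse p m z \<longleftrightarrow>
     (if multiplier_bounded p m
      then \<exists>T S. multiplier_extension p m T \<and> bounded_Lp_operator p S \<and>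
             (\<forall>f \<in> Lp_space p.
                (AE x in lborel. S (\<lambda>y. z * f y - T f y) x = f x) \<and>
                (AE x in lborel. z * S f x - T (S f) x = f x))
      else \<exists>n \<in> Linf_space.
             (AE \<xi> in lborel. n \<xi> * (z - m \<xi>) = 1) \<and> multiplier_bounded p n)"

definition multiplier_spectrum ::
    "real \<Rightarrow> ('a::euclidean_space \<Rightarrow> complex) \<Rightarrow> complex set" where
  "multiplier_spectrum p m = - {z. shifted_has_bounded_inverse p m z}"

definition bochner_riesz_symbol :: "real \<Rightarrow> 'a::euclidean_space \<Rightarrow> complex" where
  "bochner_riesz_symbol \<delta> \<xi> = of_real (max (1 - (norm \<xi>)\<^sup>2) 0 powr \<delta>)"

end

theory Submission
  imports Defs "HOL-Probability.Probability"
begin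

text \<open>
  Let \<open>m\<close> be the symbol of the Bochner--Riesz mean \<open>B\<^sub>\<delta>\<close>. A high power of \<open>m\<close>, also when multiplied by a power
  of \<open>1 / (z - m)\<close> with \<open>z \<notin> [0, 1]\<close>, is compactly supported and has \<open>2 d\<close> continuous derivatives, so it is the
  Fourier transform of an integrable kernel and is a multiplier on every \<open>L\<^sup>p\<close>. Expanding \<open>1 / (z - m)\<close> in
  powers of \<open>m\<close> up to such a remainder shows that \<open>z I - B\<^sub>\<delta>\<close> is invertible if \<open>B\<^sub>\<delta>\<close> is bounded;
  expanding \<open>m\<close> in powers of \<open>q = 1 / (z - m) - 1 / z\<close> shows that \<open>B\<^sub>\<delta>\<close> is bounded if
  \<open>1 / (z - m)\<close> is a multiplier. For \<open>z \<in> [0, 1]\<close> a bounded inverse would bound the resolvents at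
  \<open>z + i \<eta>\<close> uniformly as \<open>\<eta> \<rightarrow> 0\<close>, but the symbol of such a resolvent, which the operator norm
  dominates, takes the value \<open>1 / (i \<eta>)\<close>. The unbounded case with \<open>z \<in> [0, 1]\<close> is immediate, as
  \<open>1 / (z - m)\<close> is not essentially bounded.

  Products of multiplier operators are handled on the functions in \<open>L\<^sup>p\<close> that are inverse Fourier
  transforms of integrable functions; a multiplier operator preserves this class, unlike the
  Schwartz class.
\<close>

section \<open>Product integrals and Gaussians\<close>

text \<open>For z in [0, 1] the given inverse is only a bounded operator, not known to be a
  multiplier, so it has no symbol to compare with 1 / (z - m). The nearby resolvents do have
  symbols, by the expansion in powers of m, and the inverse enters only through its norm.

  The opposite expansion uses q rather than 1 / (z - m) because q is supported in the unit ball.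
  Integrability of a symbol makes its product with the transform of a merely integrable function
  integrable, so L^1 convergence of inputs gives pointwise convergence of outputs. This is how
  distributional images and abstract operators are identified with concrete integrals.

  The number 2 d of derivatives comes from the decay weight, a product of d factors 1 / (1 + t^2):
  each factor costs two derivatives on the Fourier side, and integrability of the product reduces to
  one dimension.

  Most estimates concern \<open>Lp_int\<close>, the p-th power of the norm. Its triangle inequality
  holds up to the factor 2^p, which is harmless because the arguments tolerate constants.\<close>

lemma
  fixes f :: "'a::euclidean_space \<Rightarrow> real \<Rightarrow> 'b::{real_normed_field,banach,second_countable_topology}"
  assumes f: "\<And>b. b \<in> Basis \<Longrightarrow> integrable lborel (f b)"
  shows integrable_prod_Basis: "integrable lborel (\<lambda>x. \<Prod>b\<in>Basis. f b (x \<bullet> b))"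
    and integral_prod_Basis:
      "(LINT x|lborel. (\<Prod>b\<in>Basis. f b (x \<bullet> b))) = (\<Prod>b\<in>Basis. (LINT t|lborel. f b t))"
proof -
  interpret product_sigma_finite "\<lambda>_::'a. lborel :: real measure"
    by unfold_locales
  let ?P = "\<Pi>\<^sub>M b\<in>(Basis::'a set). (lborel :: real measure)"
  let ?h = "\<lambda>y. \<Sum>b\<in>(Basis::'a set). y b *\<^sub>R b"
  have lb: "lborel = distr ?P borel ?h"
    by (simp add: lborel_def[where 'a='a] lborel_eq_real)
  have [measurable]: "f b \<in> borel_measurable borel" if "b \<in> Basis" for b
    using borel_measurable_integrable[OF f[OF that]] by simp
  have m: "(\<lambda>x. \<Prod>b\<in>Basis. f b (x \<bullet> b)) \<in> borel_measurable borel"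
    by measurable
  have h: "?h \<in> measurable ?P borel"
    by measurable
  have eq: "(\<Prod>b\<in>Basis. f b (?h y \<bullet> b)) = (\<Prod>b\<in>Basis. f b (y b))" for y
    by (intro prod.cong refl) (simp add: inner_sum_left inner_Basis if_distrib cong: if_cong)
  show "integrable lborel (\<lambda>x. \<Prod>b\<in>Basis. f b (x \<bullet> b))"
    unfolding lb by (subst integrable_distr_eq[OF h m]) (simp add: eq product_integrable_prod f)
  show "(LINT x|lborel. (\<Prod>b\<in>Basis. f b (x \<bullet> b))) = (\<Prod>b\<in>Basis. (LINT t|lborel. f b t))"
    unfolding lb by (subst integral_distr[OF h m]) (simp add: eq product_integral_prod f)
qed

text \<open>A product over coordinates rather than a power of 1 + |x|^2: integrability follows from
  the one-dimensional case, and on the Fourier side the factor belonging to \<open>b\<close> is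
  gained by the operator 1 - (d/db)^2.\<close>

definition decay_weight :: "'a::euclidean_space \<Rightarrow> real" where
  "decay_weight x = (\<Prod>b\<in>Basis. 1 / (1 + (x \<bullet> b)\<^sup>2))"

lemma integrable_lborel_inverse_1_plus_square: "integrable lborel (\<lambda>t::real. 1 / (1 + t\<^sup>2))"
  using integrable_inverse_1_plus_square by (simp add: set_integrable_def einterval_def inverse_eq_divide)

lemma decay_weight_pos: "decay_weight x > 0"
  unfolding decay_weight_def by (intro prod_pos) (auto intro: add_pos_nonneg)

lemma decay_weight_le_1: "decay_weight x \<le> 1"
  unfolding decay_weight_def by (intro prod_le_1) (auto simp: add_pos_nonneg)

lemma decay_weight_uminus [simp]: "decay_weight (- x) = decay_weight x"
  by (simp add: decay_weight_def)

lemma integrable_decay_weight: "integrable lborel (decay_weight :: 'a::euclidean_space \<Rightarrow> real)"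
  unfolding decay_weight_def[abs_def]
  by (rule integrable_prod_Basis) (rule integrable_lborel_inverse_1_plus_square)

lemma continuous_on_decay_weight: "continuous_on S decay_weight"
proof -
  have "1 + (x \<bullet> b)\<^sup>2 \<noteq> 0" for x b :: 'a
    using zero_le_power2[of "x \<bullet> b"] by linarith
  then show ?thesis
    unfolding decay_weight_def by (intro continuous_intros) auto
qed

lemma measurable_decay_weight [measurable]: "decay_weight \<in> borel_measurable borel"
  by (intro borel_measurable_continuous_onI continuous_on_decay_weight)

text \<open>No coordinate exceeds the norm, so each factor is at least 1 / (1 + |x|^2). This
  converts radial decay estimates into estimates by the weight.\<close>

lemma decay_weight_ge: "1 / (1 + (norm x)\<^sup>2) ^ DIM('a) \<le> decay_weight (x::'a::euclidean_space)"
proof -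
  have "(\<Prod>b\<in>(Basis::'a set). 1 / (1 + (norm x)\<^sup>2)) \<le> decay_weight x"
    unfolding decay_weight_def
  proof (intro prod_mono conjI)
    fix b :: 'a assume "b \<in> Basis"
    then have "\<bar>x \<bullet> b\<bar> \<le> norm x" by (rule Basis_le_norm)
    then have "(x \<bullet> b)\<^sup>2 \<le> (norm x)\<^sup>2" by (metis abs_le_square_iff abs_norm_cancel)
    then show "1 / (1 + (norm x)\<^sup>2) \<le> 1 / (1 + (x \<bullet> b)\<^sup>2)"
      by (intro divide_left_mono) (auto simp: add_pos_nonneg intro: mult_pos_pos)
  qed (auto simp: add_pos_nonneg)
  then show ?thesis by (simp add: power_divide)
qed

section \<open>Gaussians and their Fourier transforms\<close>

definition gauss :: "'a::euclidean_space \<Rightarrow> real" where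
  "gauss x = exp (- (norm x)\<^sup>2 / 2)"

lemma gauss_pos [simp]: "gauss x > 0" by (simp add: gauss_def)
lemma gauss_nonneg [simp]: "0 \<le> gauss x" by (simp add: gauss_def)
lemma gauss_le_1 [simp]: "gauss x \<le> 1" by (simp add: gauss_def)
lemma gauss_uminus [simp]: "gauss (- x) = gauss x" by (simp add: gauss_def)

lemma gauss_0 [simp]: "gauss 0 = 1" by (simp add: gauss_def)

lemma continuous_on_gauss [continuous_intros]:
  "continuous_on S f \<Longrightarrow> continuous_on S (\<lambda>x. gauss (f x))"
  unfolding gauss_def by (intro continuous_intros) auto

lemma measurable_gauss [measurable]: "gauss \<in> borel_measurable borel"
  by (intro borel_measurable_continuous_onI continuous_on_gauss continuous_intros)

lemma gauss_eq_prod: "gauss x = (\<Prod>b\<in>Basis. exp (- (x \<bullet> b)\<^sup>2 / 2))"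
proof -
  have "- (norm x)\<^sup>2 / 2 = (\<Sum>b\<in>Basis. - (x \<bullet> b)\<^sup>2 / 2)"
    unfolding power2_norm_eq_inner euclidean_inner[of x x]
    by (simp add: sum_divide_distrib sum_negf power2_eq_square)
  then show ?thesis by (simp add: gauss_def exp_sum)
qed

lemma integrable_gauss: "integrable lborel (gauss :: 'a::euclidean_space \<Rightarrow> real)"
proof -
  have "integrable lborel (\<lambda>t::real. exp (- t\<^sup>2 / 2))"
    using integrable_normal_moment[of 1 0 0]
      integrable_mult_right[of "sqrt (2 * pi)" lborel "\<lambda>t. normal_density 0 1 t"]
    by (simp add: normal_density_def)
  then show ?thesis
    unfolding gauss_eq_prod[abs_def] by (rule integrable_prod_Basis)
qed

text \<open>Up to normalisation this is the characteristic function of the standard normal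
  distribution, taken at \<open>-s\<close> because of the sign in the exponent.\<close>

lemma fourier_gauss_real:
  "(LINT t|lborel. complex_of_real (exp (- t\<^sup>2 / 2)) * exp (- (\<i> * of_real (t * s))))
    = of_real (sqrt (2 * pi) * exp (- s\<^sup>2 / 2))"
proof -
  have "of_real (exp (- (s\<^sup>2) / 2)) = char std_normal_distribution (-s)"
    by (simp add: char_std_normal_distribution)
  also have "\<dots> = (LINT t|lborel. normal_density 0 1 t *\<^sub>R iexp (- s * t))"
    unfolding char_def by (subst integral_density) auto
  also have "\<dots> = (LINT t|lborel. of_real (1 / sqrt (2 * pi)) *
      (complex_of_real (exp (- t\<^sup>2 / 2)) * exp (- (\<i> * of_real (t * s)))))"
    by (intro Bochner_Integration.integral_cong refl)
       (simp add: normal_density_def scaleR_conv_of_real mult_ac exp_of_real)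
  also have "\<dots> = of_real (1 / sqrt (2 * pi)) * (LINT t|lborel.
      (complex_of_real (exp (- t\<^sup>2 / 2)) * exp (- (\<i> * of_real (t * s)))))"
    by simp
  finally show ?thesis by (simp add: field_simps)
qed

lemma fourier_gauss:
  "fourier (\<lambda>x. of_real (gauss x)) (\<xi>::'a::euclidean_space)
     = of_real (sqrt (2 * pi) ^ DIM('a) * gauss \<xi>)"
proof -
  let ?f = "\<lambda>b t. complex_of_real (exp (- t\<^sup>2 / 2)) * exp (- (\<i> * of_real (t * (\<xi> \<bullet> b))))"
  have "integrable lborel (\<lambda>t::real. exp (- t\<^sup>2 / 2))"
    using integrable_gauss[where 'a=real] by (simp add: gauss_def[abs_def])
  then have "integrable lborel (?f b)" for b
    by (rule Bochner_Integration.integrable_bound) (auto simp: norm_mult)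
  then have int: "integrable lborel (?f b)" if "b \<in> Basis" for b .
  have e: "exp (- (\<i> * of_real (x \<bullet> \<xi>)))
      = (\<Prod>b\<in>Basis. exp (- (\<i> * of_real ((x \<bullet> b) * (\<xi> \<bullet> b)))))" for x
    unfolding euclidean_inner[of x \<xi>]
    by (subst exp_sum[symmetric]) (auto simp: sum_negf sum_distrib_left)
  have "complex_of_real (gauss x) * exp (- (\<i> * of_real (x \<bullet> \<xi>))) = (\<Prod>b\<in>Basis. ?f b (x \<bullet> b))" for x
    unfolding e prod.distrib gauss_eq_prod of_real_prod ..
  then have "fourier (\<lambda>x. of_real (gauss x)) \<xi> = (LINT x|lborel. (\<Prod>b\<in>Basis. ?f b (x \<bullet> b)))"
    unfolding fourier_def by simp
  also have "\<dots> = (\<Prod>b\<in>Basis. (LINT t|lborel. ?f b t))"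
    by (rule integral_prod_Basis[OF int])
  also have "\<dots> = (\<Prod>b\<in>(Basis::'a set). of_real (sqrt (2 * pi) * exp (- (\<xi> \<bullet> b)\<^sup>2 / 2)))"
    by (simp only: fourier_gauss_real)
  also have "\<dots> = of_real (sqrt (2 * pi) ^ DIM('a) * gauss \<xi>)"
    by (simp add: gauss_eq_prod prod.distrib)
  finally show ?thesis .
qed

lemma integral_gauss: "(LINT x|lborel. gauss (x::'a::euclidean_space)) = sqrt (2 * pi) ^ DIM('a)"
proof -
  have "fourier (\<lambda>x. of_real (gauss (x::'a))) 0 = of_real (LINT x|lborel. gauss (x::'a))"
    unfolding fourier_def by simp
  then show ?thesis unfolding fourier_gauss by (simp flip: of_real_power of_real_mult)
qed

section \<open>Affine changes of variables in Lebesgue integrals\<close>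

lemma integrable_scale_shift:
  fixes f :: "'a::euclidean_space \<Rightarrow> 'b::{banach,second_countable_topology}"
  assumes f: "integrable lborel f" and c: "c \<noteq> 0"
  shows "integrable lborel (\<lambda>x. f (t + c *\<^sub>R x))"
proof -
  have [measurable]: "f \<in> borel_measurable borel"
    using f by auto
  have "integrable (density (distr lborel borel (\<lambda>x. t + c *\<^sub>R x)) (\<lambda>_. ennreal (\<bar>c\<bar> ^ DIM('a)))) f"
    using f by (subst (asm) lborel_affine[OF c, of t])
  then have "integrable lborel (\<lambda>x. \<bar>c\<bar> ^ DIM('a) *\<^sub>R f (t + c *\<^sub>R x))"
    by (simp add: integrable_density integrable_distr_eq)
  then have "integrable lborel (\<lambda>x. (1 / \<bar>c\<bar> ^ DIM('a)) *\<^sub>R (\<bar>c\<bar> ^ DIM('a) *\<^sub>R f (t + c *\<^sub>R x)))"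
    by (rule integrable_scaleR_right)
  then show ?thesis
    using c by simp
qed

lemma integral_scale_shift:
  fixes f :: "'a::euclidean_space \<Rightarrow> 'b::{banach,second_countable_topology}"
  assumes [measurable]: "f \<in> borel_measurable borel" and c: "c \<noteq> 0"
  shows "(LINT x|lborel. f x) = \<bar>c\<bar> ^ DIM('a) *\<^sub>R (LINT x|lborel. f (t + c *\<^sub>R x))"
proof -
  have "(LINT x|lborel. f x)
      = integral\<^sup>L (density (distr lborel borel (\<lambda>x. t + c *\<^sub>R x)) (\<lambda>_. ennreal (\<bar>c\<bar> ^ DIM('a)))) f"
    by (rule arg_cong[where f="\<lambda>M. integral\<^sup>L M f", OF lborel_affine[OF c]])
  also have "\<dots> = \<bar>c\<bar> ^ DIM('a) *\<^sub>R (LINT x|lborel. f (t + c *\<^sub>R x))"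
    by (simp add: integral_density integral_distr)
  finally show ?thesis .
qed

lemma integrable_shift:
  fixes f :: "'a::euclidean_space \<Rightarrow> 'b::{banach,second_countable_topology}"
  shows "integrable lborel f \<Longrightarrow> integrable lborel (\<lambda>x. f (t + x))"
  using integrable_scale_shift[of f 1 t] by simp

lemma integral_shift:
  fixes f :: "'a::euclidean_space \<Rightarrow> 'b::{banach,second_countable_topology}"
  shows "f \<in> borel_measurable borel \<Longrightarrow> (LINT x|lborel. f (t + x)) = (LINT x|lborel. f x)"
  using integral_scale_shift[of f 1 t] by simp

lemma integral_reflect:
  fixes f :: "'a::euclidean_space \<Rightarrow> 'b::{banach,second_countable_topology}"
  shows "f \<in> borel_measurable borel \<Longrightarrow> (LINT x|lborel. f (t - x)) = (LINT x|lborel. f x)"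
  using integral_scale_shift[of f "-1" t] by simp

section \<open>Fourier inversion\<close>

lemma integrable_mult_bounded:
  fixes f g :: "'a \<Rightarrow> complex"
  assumes f: "integrable M f" and [measurable]: "g \<in> borel_measurable M"
    and g: "\<And>x. norm (g x) \<le> B"
  shows "integrable M (\<lambda>x. f x * g x)"
proof (rule Bochner_Integration.integrable_bound)
  show "integrable M (\<lambda>x. B * norm (f x))" using f by simp
  have "0 \<le> B" using norm_ge_zero g order_trans by blast
  then show "AE x in M. norm (f x * g x) \<le> norm (B * norm (f x))"
    using g by (auto simp: norm_mult mult.commute[of B] intro!: AE_I2 mult_left_mono)
  show "(\<lambda>x. f x * g x) \<in> borel_measurable M"
    using f by measurable
qed

lemma measurable_cis [measurable]: "cis \<in> borel_measurable borel"
  by (intro borel_measurable_continuous_onI continuous_intros continuous_on_cis)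

lemma integrable_mult_cis:
  assumes "integrable lborel f"
  shows "integrable lborel (\<lambda>x::'a::euclidean_space. f x * cis (x \<bullet> y))"
  by (rule integrable_mult_bounded[OF assms, of _ 1]) auto

lemma fourier_cis: "fourier f \<xi> = (LINT x|lborel. f x * cis (- (x \<bullet> \<xi>)))"
  by (simp add: fourier_def cis_conv_exp)

text \<open>A pointwise integral, with all of the normalising factor placed here. For integrable
  \<open>h\<close> the result is bounded and continuous, but it need not be integrable.\<close>

definition inverse_fourier :: "('a::euclidean_space \<Rightarrow> complex) \<Rightarrow> 'a \<Rightarrow> complex" where
  "inverse_fourier h x =
     inverse ((2 * pi) ^ DIM('a)) *\<^sub>R (LINT \<xi>|lborel. h \<xi> * cis (\<xi> \<bullet> x))"

lemma inverse_fourier_eq_fourier: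
  "inverse_fourier h (x::'a::euclidean_space) = inverse ((2 * pi) ^ DIM('a)) *\<^sub>R fourier h (- x)"
  by (simp add: inverse_fourier_def fourier_cis)

lemma norm_fourier_le: "norm (fourier f \<xi>) \<le> (LINT x|lborel. norm (f x))"
  unfolding fourier_cis by (rule order_trans[OF integral_norm_bound]) (simp add: norm_mult)

lemma norm_inverse_fourier_le:
  fixes h :: "'a::euclidean_space \<Rightarrow> complex"
  shows "norm (inverse_fourier h x) \<le> inverse ((2 * pi) ^ DIM('a)) * (LINT x|lborel. norm (h x))"
  unfolding inverse_fourier_eq_fourier norm_scaleR
  by (intro mult_mono norm_fourier_le) auto

lemma isCont_fourier:
  assumes f: "integrable lborel f"
  shows "continuous_on UNIV (fourier f)"
proof (rule continuous_on_sequentiallyI)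
  have [measurable]: "f \<in> borel_measurable borel" using f by auto
  fix u :: "nat \<Rightarrow> 'a" and a assume u: "u \<longlonglongrightarrow> a"
  show "(\<lambda>n. fourier f (u n)) \<longlonglongrightarrow> fourier f a"
    unfolding fourier_cis
  proof (rule integral_dominated_convergence[where w="\<lambda>x. norm (f x)"])
    show "AE x in lborel. (\<lambda>n. f x * cis (- (x \<bullet> u n))) \<longlonglongrightarrow> f x * cis (- (x \<bullet> a))"
      using u by (intro AE_I2 tendsto_intros tendsto_cis)
  qed (use f in \<open>auto simp: norm_mult\<close>)
qed

lemma measurable_fourier: "integrable lborel f \<Longrightarrow> fourier f \<in> borel_measurable borel"
  by (intro borel_measurable_continuous_onI isCont_fourier)

lemma continuous_on_inverse_fourier:
  assumes "integrable lborel h"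
  shows "continuous_on S (inverse_fourier h)"
proof -
  have "continuous_on S (\<lambda>x. fourier h (- x))"
    by (rule continuous_on_compose2[OF isCont_fourier[OF assms]]) (auto intro: continuous_intros)
  then show ?thesis
    unfolding inverse_fourier_eq_fourier[abs_def] by (intro continuous_intros)
qed

lemma measurable_inverse_fourier: "integrable lborel h \<Longrightarrow> inverse_fourier h \<in> borel_measurable borel"
  by (intro borel_measurable_continuous_onI continuous_on_inverse_fourier)

lemma fourier_add:
  "integrable lborel f \<Longrightarrow> integrable lborel g \<Longrightarrow> fourier (\<lambda>x. f x + g x) \<xi> = fourier f \<xi> + fourier g \<xi>"
  using integrable_mult_cis[of f "-\<xi>"] integrable_mult_cis[of g "-\<xi>"]
  by (simp add: fourier_cis distrib_right)

lemma fourier_diff: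
  "integrable lborel f \<Longrightarrow> integrable lborel g \<Longrightarrow> fourier (\<lambda>x. f x - g x) \<xi> = fourier f \<xi> - fourier g \<xi>"
  using integrable_mult_cis[of f "-\<xi>"] integrable_mult_cis[of g "-\<xi>"]
  by (simp add: fourier_cis left_diff_distrib)

lemma fourier_cmult: "fourier (\<lambda>x. c * f x) \<xi> = c * fourier f \<xi>"
  by (simp add: fourier_cis mult.assoc)

lemma inverse_fourier_add:
  "integrable lborel f \<Longrightarrow> integrable lborel g \<Longrightarrow>
    inverse_fourier (\<lambda>x. f x + g x) \<xi> = inverse_fourier f \<xi> + inverse_fourier g \<xi>"
  by (simp add: inverse_fourier_eq_fourier fourier_add scaleR_add_right)

lemma inverse_fourier_diff:
  "integrable lborel f \<Longrightarrow> integrable lborel g \<Longrightarrow>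
    inverse_fourier (\<lambda>x. f x - g x) \<xi> = inverse_fourier f \<xi> - inverse_fourier g \<xi>"
  by (simp add: inverse_fourier_eq_fourier fourier_diff scaleR_diff_right)

lemma inverse_fourier_cmult: "inverse_fourier (\<lambda>x. c * f x) \<xi> = c * inverse_fourier f \<xi>"
  by (simp add: inverse_fourier_eq_fourier fourier_cmult)

lemma integral_gauss_scaled:
  fixes v :: "'a::euclidean_space"
  assumes "\<epsilon> > 0"
  shows "(LINT \<xi>|lborel. complex_of_real (gauss (\<epsilon> *\<^sub>R \<xi>)) * cis (\<xi> \<bullet> v))
    = of_real ((sqrt (2 * pi) / \<epsilon>) ^ DIM('a) * gauss ((1 / \<epsilon>) *\<^sub>R v))"
proof -
  have "of_real (sqrt (2 * pi) ^ DIM('a) * gauss ((1 / \<epsilon>) *\<^sub>R v))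
      = fourier (\<lambda>x. of_real (gauss x)) (- (1 / \<epsilon>) *\<^sub>R v)"
    using fourier_gauss[of "- (1 / \<epsilon>) *\<^sub>R v"] gauss_uminus[of "(1 / \<epsilon>) *\<^sub>R v"] by simp
  also have "\<dots> = (LINT x|lborel. complex_of_real (gauss x) * cis (x \<bullet> ((1 / \<epsilon>) *\<^sub>R v)))"
    by (simp add: fourier_cis)
  also have "\<dots> = \<epsilon> ^ DIM('a) *\<^sub>R (LINT \<xi>|lborel. complex_of_real (gauss (\<epsilon> *\<^sub>R \<xi>)) * cis (\<xi> \<bullet> v))"
    using integral_scale_shift[of "\<lambda>x. complex_of_real (gauss x) * cis (x \<bullet> ((1 / \<epsilon>) *\<^sub>R v))" \<epsilon> 0] assms
    by simp
  finally show ?thesis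
    using assms by (simp add: scaleR_conv_of_real field_simps)
qed

text \<open>Convolution with the normalised Gaussian of width \<open>\<epsilon>\<close>, written
  after rescaling the variable. The Gaussian in the integrand is then fixed, and limits as
  \<epsilon> tends to 0 are dominated.\<close>

definition mollify :: "real \<Rightarrow> ('a::euclidean_space \<Rightarrow> complex) \<Rightarrow> 'a \<Rightarrow> complex" where
  "mollify \<epsilon> f x =
     of_real (inverse (sqrt (2 * pi) ^ DIM('a))) * (LINT v|lborel. of_real (gauss v) * f (x + \<epsilon> *\<^sub>R v))"

lemma integrable_gauss_complex: "integrable lborel (\<lambda>v. complex_of_real (gauss v))"
  by (intro integrable_of_real integrable_gauss)

lemma norm_mollify_le:
  fixes f :: "'a::euclidean_space \<Rightarrow> complex"
  assumes f: "\<And>x. norm (f x) \<le> B"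
  shows "norm (mollify \<epsilon> f x) \<le> B"
proof -
  let ?d = "sqrt (2 * pi) ^ DIM('a)"
  have B: "0 \<le> B" using norm_ge_zero f order_trans by blast
  have "norm (LINT v|lborel. complex_of_real (gauss v) * f (x + \<epsilon> *\<^sub>R v)) \<le> (LINT v|lborel. gauss (v::'a) * B)"
    by (rule order_trans[OF integral_norm_bound], rule integral_mono')
       (use B f integrable_gauss in \<open>auto simp: norm_mult intro: mult_left_mono\<close>)
  also have "\<dots> = ?d * B"
    by (simp add: integral_gauss)
  finally have "norm (mollify \<epsilon> f x) \<le> inverse ?d * (?d * B)"
    unfolding mollify_def norm_mult by (intro mult_mono) (auto simp: norm_inverse norm_power)
  also have "\<dots> = (inverse ?d * ?d) * B" by (simp only: mult.assoc)
  also have "inverse ?d * ?d = 1" by (rule left_inverse) simp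
  finally show ?thesis by simp
qed

lemma mollify_tendsto:
  fixes f :: "'a::euclidean_space \<Rightarrow> complex"
  assumes [measurable]: "f \<in> borel_measurable borel" and f: "\<And>x. norm (f x) \<le> B"
    and cont: "isCont f x" and e: "\<epsilon> \<longlonglongrightarrow> 0"
  shows "(\<lambda>n. mollify (\<epsilon> n) f x) \<longlonglongrightarrow> f x"
proof -
  let ?d = "sqrt (2 * pi) ^ DIM('a)"
  have "(\<lambda>n. LINT v|lborel. complex_of_real (gauss v) * f (x + \<epsilon> n *\<^sub>R v))
      \<longlonglongrightarrow> (LINT v|lborel. complex_of_real (gauss (v::'a)) * f x)"
  proof (rule integral_dominated_convergence[where w="\<lambda>v::'a. gauss v * B"])
    have "(\<lambda>n. f (x + \<epsilon> n *\<^sub>R v)) \<longlonglongrightarrow> f (x + 0 *\<^sub>R v)" for v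
      using cont by (intro isCont_tendsto_compose[where g=f] tendsto_intros e) auto
    then show "AE v in lborel. (\<lambda>n. complex_of_real (gauss v) * f (x + \<epsilon> n *\<^sub>R v))
        \<longlonglongrightarrow> complex_of_real (gauss v) * f x"
      by (auto intro!: tendsto_intros)
  qed (use integrable_gauss f in \<open>auto simp: norm_mult intro!: AE_I2 mult_left_mono\<close>)
  also have "(LINT v|lborel. complex_of_real (gauss (v::'a)) * f x) = of_real ?d * f x"
    using integral_gauss[where 'a='a] by simp
  finally have "(\<lambda>n. mollify (\<epsilon> n) f x) \<longlonglongrightarrow> of_real (inverse ?d) * (of_real ?d * f x)"
    unfolding mollify_def by (intro tendsto_intros)
  then show ?thesis by (simp flip: of_real_mult mult.assoc)
qed

lemma integrable_pair_mult:
  fixes f g :: "'a::euclidean_space \<Rightarrow> complex"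
  assumes f: "integrable lborel f" and g: "integrable lborel g"
    and [measurable]: "k \<in> borel_measurable (lborel \<Otimes>\<^sub>M lborel)"
    and k: "\<And>z. norm (k z) \<le> B"
  shows "integrable (lborel \<Otimes>\<^sub>M lborel) (\<lambda>(x, y). f x * g y * k (x, y))"
proof -
  have [measurable]: "f \<in> borel_measurable borel" "g \<in> borel_measurable borel"
    using f g by auto
  have "integrable (lborel \<Otimes>\<^sub>M lborel) (\<lambda>z. f (fst z) * g (snd z))"
    by (rule lborel_pair.Fubini_integrable) (use f g in \<open>auto simp: norm_mult\<close>)
  then have "integrable (lborel \<Otimes>\<^sub>M lborel) (\<lambda>z. (f (fst z) * g (snd z)) * k z)"
    by (rule integrable_mult_bounded) (auto intro: k)
  then show ?thesis by (simp add: case_prod_beta')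
qed

text \<open>The Gaussian factor makes the double integral absolutely convergent, so Fubini applies,
  and the inner integral over \<xi> is the transform of a Gaussian. This is Fourier inversion in the
  sense of Gaussian summability.\<close>

lemma inverse_fourier_gauss_fourier:
  fixes f :: "'a::euclidean_space \<Rightarrow> complex"
  assumes f: "integrable lborel f" and e: "\<epsilon> > 0"
  shows "inverse_fourier (\<lambda>\<xi>. fourier f \<xi> * of_real (gauss (\<epsilon> *\<^sub>R \<xi>))) x = mollify \<epsilon> f x"
proof -
  let ?d = "sqrt (2 * pi) ^ DIM('a)"
  have [measurable]: "f \<in> borel_measurable borel" using f by auto
  have ge: "integrable lborel (\<lambda>\<xi>::'a. complex_of_real (gauss (\<epsilon> *\<^sub>R \<xi>)))"
    using integrable_scale_shift[OF integrable_gauss_complex, of \<epsilon> 0] e by simp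
  have "(LINT \<xi>|lborel. fourier f \<xi> * of_real (gauss (\<epsilon> *\<^sub>R \<xi>)) * cis (\<xi> \<bullet> x))
      = (LINT \<xi>|lborel. LINT y|lborel. f y * complex_of_real (gauss (\<epsilon> *\<^sub>R \<xi>)) * cis (\<xi> \<bullet> (x - y)))"
  proof (intro Bochner_Integration.integral_cong refl)
    fix \<xi> :: 'a
    have "fourier f \<xi> * (of_real (gauss (\<epsilon> *\<^sub>R \<xi>)) * cis (\<xi> \<bullet> x))
        = (LINT y|lborel. f y * cis (- (y \<bullet> \<xi>)) * (of_real (gauss (\<epsilon> *\<^sub>R \<xi>)) * cis (\<xi> \<bullet> x)))"
      by (simp add: fourier_cis)
    also have "\<dots> = (LINT y|lborel. f y * complex_of_real (gauss (\<epsilon> *\<^sub>R \<xi>)) * cis (\<xi> \<bullet> (x - y)))"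
    proof (intro Bochner_Integration.integral_cong refl)
      fix y :: 'a
      have "cis (\<xi> \<bullet> (x - y)) = cis (- (y \<bullet> \<xi>)) * cis (\<xi> \<bullet> x)"
        by (simp add: cis_mult inner_diff_right inner_commute)
      then show "f y * cis (- (y \<bullet> \<xi>)) * (of_real (gauss (\<epsilon> *\<^sub>R \<xi>)) * cis (\<xi> \<bullet> x))
          = f y * complex_of_real (gauss (\<epsilon> *\<^sub>R \<xi>)) * cis (\<xi> \<bullet> (x - y))"
        by simp
    qed
    finally show "fourier f \<xi> * of_real (gauss (\<epsilon> *\<^sub>R \<xi>)) * cis (\<xi> \<bullet> x)
        = (LINT y|lborel. f y * complex_of_real (gauss (\<epsilon> *\<^sub>R \<xi>)) * cis (\<xi> \<bullet> (x - y)))"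
      by (simp add: mult.assoc)
  qed
  also have "\<dots> = (LINT y|lborel. LINT \<xi>|lborel. f y * complex_of_real (gauss (\<epsilon> *\<^sub>R \<xi>)) * cis (\<xi> \<bullet> (x - y)))"
    using integrable_pair_mult[OF f ge, of "\<lambda>(y, \<xi>). cis (\<xi> \<bullet> (x - y))" 1]
    by (intro lborel_pair.Fubini_integral) auto
  also have "\<dots> = (LINT y|lborel. f y * of_real ((sqrt (2 * pi) / \<epsilon>) ^ DIM('a) * gauss ((1 / \<epsilon>) *\<^sub>R (x - y))))"
    by (simp add: mult.assoc integral_gauss_scaled[OF e])
  \<comment> \<open>The substitution y = x + \<epsilon> v; its Jacobian cancels the power of
    \<epsilon> in the transformed Gaussian.\<close>
  also have "\<dots> = \<epsilon> ^ DIM('a) *\<^sub>R (LINT v|lborel. f (x + \<epsilon> *\<^sub>R v) *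
      of_real ((sqrt (2 * pi) / \<epsilon>) ^ DIM('a) * gauss ((1 / \<epsilon>) *\<^sub>R (x - (x + \<epsilon> *\<^sub>R v)))))"
    using e by (subst integral_scale_shift[of _ \<epsilon> x]) auto
  also have "\<dots> = of_real ?d * (LINT v|lborel. of_real (gauss v) * f (x + \<epsilon> *\<^sub>R v))"
  proof -
    have "f (x + \<epsilon> *\<^sub>R v) *
        of_real ((sqrt (2 * pi) / \<epsilon>) ^ DIM('a) * gauss ((1 / \<epsilon>) *\<^sub>R (x - (x + \<epsilon> *\<^sub>R v))))
      = of_real (?d / \<epsilon> ^ DIM('a)) * (of_real (gauss v) * f (x + \<epsilon> *\<^sub>R v))" for v
      using e by (simp add: power_divide)
    then show ?thesis
      using e by (simp add: scaleR_conv_of_real)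
  qed
  finally have inv: "inverse_fourier (\<lambda>\<xi>. fourier f \<xi> * of_real (gauss (\<epsilon> *\<^sub>R \<xi>))) x
      = of_real (inverse ((2 * pi) ^ DIM('a)) * ?d) * (LINT v|lborel. of_real (gauss v) * f (x + \<epsilon> *\<^sub>R v))"
    unfolding inverse_fourier_def by (simp add: scaleR_conv_of_real)
  \<comment> \<open>One of the two factors \<open>?d\<close> cancels against the Gaussian transform;
    the other one is the normalisation in \<open>mollify\<close>.\<close>
  have "(2 * pi) ^ DIM('a) = ?d * ?d"
    by (subst power_mult_distrib[symmetric]) simp
  then have "inverse ((2 * pi) ^ DIM('a)) * ?d = inverse (?d * ?d) * ?d"
    by (simp only:)
  then have "inverse ((2 * pi) ^ DIM('a)) * ?d = inverse ?d"
    by (simp only: inverse_mult_distrib mult.assoc) simp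
  then show ?thesis
    unfolding mollify_def by (simp only: inv)
qed

text \<open>Reflecting x exchanges the two transforms and reduces this to the preceding identity. It
  describes the spectral side of multiplying by a wide Gaussian.\<close>

lemma fourier_gauss_inverse_fourier:
  fixes h :: "'a::euclidean_space \<Rightarrow> complex"
  assumes h: "integrable lborel h" and e: "\<epsilon> > 0"
  shows "fourier (\<lambda>x. inverse_fourier h x * of_real (gauss (\<epsilon> *\<^sub>R x))) \<xi> = mollify \<epsilon> h \<xi>"
proof -
  have [measurable]: "fourier h \<in> borel_measurable borel" by (rule measurable_fourier[OF h])
  have "fourier (\<lambda>x. inverse_fourier h x * of_real (gauss (\<epsilon> *\<^sub>R x))) \<xi>
     = inverse ((2 * pi) ^ DIM('a)) *\<^sub>R
       (LINT x|lborel. fourier h (- x) * of_real (gauss (\<epsilon> *\<^sub>R (- x))) * cis ((- x) \<bullet> \<xi>))"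
    unfolding inverse_fourier_eq_fourier mult_scaleR_left fourier_cis[of "\<lambda>x. _ *\<^sub>R _ x"]
    by simp
  also have "(LINT x|lborel. fourier h (- x) * of_real (gauss (\<epsilon> *\<^sub>R (- x))) * cis ((- x) \<bullet> \<xi>))
     = (LINT x|lborel. fourier h x * of_real (gauss (\<epsilon> *\<^sub>R x)) * cis (x \<bullet> \<xi>))"
    using integral_reflect[of "\<lambda>x. fourier h x * of_real (gauss (\<epsilon> *\<^sub>R x)) * cis (x \<bullet> \<xi>)" 0] by simp
  finally show ?thesis
    by (simp flip: inverse_fourier_gauss_fourier[OF h e] add: inverse_fourier_def)
qed

text \<open>Mollification is symmetric because the Gaussian is even. It can therefore be moved from
  an integrable function, where nothing is known pointwise, to a bounded continuous one, where it
  converges pointwise.\<close>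

lemma integral_mult_mollify:
  fixes h M :: "'a::euclidean_space \<Rightarrow> complex"
  assumes h: "integrable lborel h" and [measurable]: "M \<in> borel_measurable borel"
    and M: "\<And>x. norm (M x) \<le> B"
  shows "(LINT \<xi>|lborel. M \<xi> * mollify \<epsilon> h \<xi>) = (LINT \<xi>|lborel. h \<xi> * mollify \<epsilon> M \<xi>)"
proof -
  have [measurable]: "h \<in> borel_measurable borel" using h by auto
  let ?c = "complex_of_real (inverse (sqrt (2 * pi) ^ DIM('a)))"
  have i1: "integrable (lborel \<Otimes>\<^sub>M lborel) (\<lambda>(v, \<xi>). of_real (gauss v) * h (\<xi> + \<epsilon> *\<^sub>R v) * M \<xi>)"
  proof -
    have hs: "integrable lborel (\<lambda>\<xi>. h (\<xi> + \<epsilon> *\<^sub>R v))" for v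
      using integrable_shift[OF h, of "\<epsilon> *\<^sub>R v"] by (simp add: add.commute)
    have hn: "(LINT \<xi>|lborel. norm (h (\<xi> + \<epsilon> *\<^sub>R v))) = (LINT \<xi>|lborel. norm (h \<xi>))" for v
      using integral_shift[of "\<lambda>x. norm (h x)" "\<epsilon> *\<^sub>R v"] by (simp add: add.commute)
    have "integrable (lborel \<Otimes>\<^sub>M lborel) (\<lambda>z. complex_of_real (gauss (fst z)) * h (snd z + \<epsilon> *\<^sub>R fst z))"
      by (rule lborel_pair.Fubini_integrable) (use hs integrable_gauss in \<open>auto simp: norm_mult hn\<close>)
    then have "integrable (lborel \<Otimes>\<^sub>M lborel)
        (\<lambda>z. complex_of_real (gauss (fst z)) * h (snd z + \<epsilon> *\<^sub>R fst z) * M (snd z))"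
      by (rule integrable_mult_bounded) (auto intro: M)
    then show ?thesis by (simp add: case_prod_beta')
  qed
  have i2: "integrable (lborel \<Otimes>\<^sub>M lborel) (\<lambda>(v, \<xi>). of_real (gauss v) * h \<xi> * M (\<xi> + \<epsilon> *\<^sub>R v))"
    using integrable_pair_mult[OF integrable_gauss_complex h, of "\<lambda>(v, \<xi>). M (\<xi> + \<epsilon> *\<^sub>R v)" B] M
    by (auto simp: case_prod_beta')
  have "(LINT \<xi>|lborel. M \<xi> * mollify \<epsilon> h \<xi>)
      = ?c * (LINT \<xi>|lborel. LINT v|lborel. of_real (gauss v) * h (\<xi> + \<epsilon> *\<^sub>R v) * M \<xi>)"
    unfolding mollify_def
    by (simp add: ac_simps flip: Bochner_Integration.integral_mult_right_zero)
  also have "\<dots> = ?c * (LINT v|lborel. LINT \<xi>|lborel. of_real (gauss v) * h (\<xi> + \<epsilon> *\<^sub>R v) * M \<xi>)"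
    by (subst lborel_pair.Fubini_integral[OF i1]) simp
  also have "\<dots> = ?c * (LINT v|lborel. LINT \<xi>|lborel. of_real (gauss v) * h \<xi> * M (\<xi> - \<epsilon> *\<^sub>R v))"
  proof -
    have "(LINT \<xi>|lborel. of_real (gauss v) * h (\<xi> + \<epsilon> *\<^sub>R v) * M \<xi>)
        = (LINT \<xi>|lborel. of_real (gauss v) * h \<xi> * M (\<xi> - \<epsilon> *\<^sub>R v))" for v
      using integral_shift[of "\<lambda>\<xi>. of_real (gauss v) * h \<xi> * M (\<xi> - \<epsilon> *\<^sub>R v)" "\<epsilon> *\<^sub>R v"]
      by (simp add: add.commute)
    then show ?thesis by simp
  qed
  \<comment> \<open>Here the evenness of the Gaussian is used, through the reflection of
    \<open>v\<close>.\<close>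
  also have "\<dots> = ?c * (LINT v|lborel. LINT \<xi>|lborel. of_real (gauss v) * h \<xi> * M (\<xi> + \<epsilon> *\<^sub>R v))"
    using integral_reflect[of "\<lambda>v. LINT \<xi>|lborel. of_real (gauss v) * h \<xi> * M (\<xi> + \<epsilon> *\<^sub>R v)" 0]
    by simp
  also have "\<dots> = ?c * (LINT \<xi>|lborel. LINT v|lborel. of_real (gauss v) * h \<xi> * M (\<xi> + \<epsilon> *\<^sub>R v))"
    by (subst lborel_pair.Fubini_integral[OF i2]) simp
  also have "\<dots> = (LINT \<xi>|lborel. h \<xi> * mollify \<epsilon> M \<xi>)"
    unfolding mollify_def
    by (simp add: ac_simps flip: Bochner_Integration.integral_mult_right_zero)
  finally show ?thesis .
qed

text \<open>The Gaussian means of the inversion integral have two limits as the width tends to 0: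
  continuity of \<open>f\<close> gives \<open>f x\<close>, and dominated convergence with majorant
  |\<open>fourier f\<close>| gives the full integral.\<close>

theorem fourier_inversion:
  fixes f :: "'a::euclidean_space \<Rightarrow> complex"
  assumes f: "integrable lborel f" and ff: "integrable lborel (fourier f)"
    and cont: "continuous_on UNIV f" and B: "\<And>x. norm (f x) \<le> B"
  shows "inverse_fourier (fourier f) x = f x"
proof (rule LIMSEQ_unique)
  let ?e = "\<lambda>n. 1 / real (Suc n)"
  have [measurable]: "f \<in> borel_measurable borel" "fourier f \<in> borel_measurable borel" using f ff by auto
  have e: "?e \<longlonglongrightarrow> 0" by (rule LIMSEQ_Suc[OF lim_const_over_n[of 1]])
  show "(\<lambda>n. mollify (?e n) f x) \<longlonglongrightarrow> f x"
    using cont by (intro mollify_tendsto[OF _ B _ e]) (auto simp: continuous_on_eq_continuous_at)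
  have "(\<lambda>n. LINT \<xi>|lborel. fourier f \<xi> * of_real (gauss (?e n *\<^sub>R \<xi>)) * cis (\<xi> \<bullet> x))
      \<longlonglongrightarrow> (LINT \<xi>|lborel. fourier f \<xi> * cis (\<xi> \<bullet> x))"
  proof (rule integral_dominated_convergence[where w="\<lambda>\<xi>. norm (fourier f \<xi>)"])
    have "(\<lambda>n. gauss (?e n *\<^sub>R \<xi>)) \<longlonglongrightarrow> gauss (0 *\<^sub>R \<xi>)" for \<xi> :: 'a
      using e continuous_on_gauss[OF continuous_on_id, of UNIV]
      by (intro isCont_tendsto_compose[where g=gauss] tendsto_intros)
         (auto simp: continuous_on_eq_continuous_at)
    then have "(\<lambda>n. fourier f \<xi> * of_real (gauss (?e n *\<^sub>R \<xi>)) * cis (\<xi> \<bullet> x))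
        \<longlonglongrightarrow> fourier f \<xi> * of_real (gauss (0 *\<^sub>R \<xi>)) * cis (\<xi> \<bullet> x)" for \<xi>
      by (intro tendsto_intros)
    then show "AE \<xi> in lborel. (\<lambda>n. fourier f \<xi> * of_real (gauss (?e n *\<^sub>R \<xi>)) * cis (\<xi> \<bullet> x))
        \<longlonglongrightarrow> fourier f \<xi> * cis (\<xi> \<bullet> x)"
      by simp
  qed (use ff in \<open>auto simp: norm_mult intro!: AE_I2 mult_left_le\<close>)
  then have "(\<lambda>n. inverse_fourier (\<lambda>\<xi>. fourier f \<xi> * of_real (gauss (?e n *\<^sub>R \<xi>))) x)
      \<longlonglongrightarrow> inverse_fourier (fourier f) x"
    unfolding inverse_fourier_def by (intro tendsto_intros)
  then show "(\<lambda>n. mollify (?e n) f x) \<longlonglongrightarrow> inverse_fourier (fourier f) x"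
    by (simp add: inverse_fourier_gauss_fourier[OF f])
qed

theorem fourier_inverse_inversion:
  fixes f :: "'a::euclidean_space \<Rightarrow> complex"
  assumes f: "integrable lborel f" and ff: "integrable lborel (fourier f)"
    and cont: "continuous_on UNIV f" and B: "\<And>x. norm (f x) \<le> B"
  shows "fourier (inverse_fourier f) \<xi> = f \<xi>"
proof -
  have [measurable]: "fourier f \<in> borel_measurable borel" using ff by auto
  have "fourier (inverse_fourier f) \<xi>
     = inverse ((2 * pi) ^ DIM('a)) *\<^sub>R (LINT x|lborel. fourier f (- x) * cis ((- x) \<bullet> \<xi>))"
    by (simp add: fourier_cis[of "inverse_fourier f"] inverse_fourier_eq_fourier mult.assoc)
  also have "(LINT x|lborel. fourier f (- x) * cis ((- x) \<bullet> \<xi>)) = (LINT x|lborel. fourier f x * cis (x \<bullet> \<xi>))"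
    using integral_reflect[of "\<lambda>x. fourier f x * cis (x \<bullet> \<xi>)" 0] by simp
  finally show ?thesis
    using fourier_inversion[OF assms, of \<xi>] unfolding inverse_fourier_def[of "fourier f"] by simp
qed

text \<open>Measurability supplies continuous functions converging off a negligible set. The
  retraction \<open>r\<close> of the plane onto the disc of radius \<open>B\<close> makes them
  uniformly bounded and leaves the limit alone, since \<open>f\<close> already takes values in the
  disc.\<close>

lemma continuous_approx_bounded:
  fixes f :: "'a::euclidean_space \<Rightarrow> complex"
  assumes f: "f \<in> borel_measurable borel" and B: "\<And>x. norm (f x) \<le> B" and "B > 0"
  obtains g where "\<And>n::nat. continuous_on UNIV (g n)" "\<And>n x. norm (g n x) \<le> B"
    "AE x in lborel. (\<lambda>n. g n x) \<longlonglongrightarrow> f x"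
proof -
  have "f \<in> borel_measurable lebesgue" using f by (simp add: measurable_completion)
  then have "f measurable_on UNIV"
    by (simp add: measurable_on_iff_borel_measurable)
  then obtain N g where N: "negligible N" and g: "\<And>n::nat. continuous_on UNIV (g n)"
    and lim: "\<And>x. x \<notin> N \<Longrightarrow> (\<lambda>n. g n x) \<longlonglongrightarrow> f x"
    unfolding measurable_on_def by auto
  define r where "r z = of_real (B / max B (norm z)) * z" for z :: complex
  have r1: "norm (r z) \<le> B" for z
  proof (cases "norm z \<le> B")
    case False
    then have "norm (r z) = B / norm z * norm z"
      using \<open>B > 0\<close> by (simp add: r_def norm_mult norm_divide max_def)
    then show ?thesis using False \<open>B > 0\<close> by auto
  qed (use \<open>B > 0\<close> in \<open>simp add: r_def norm_mult max_def\<close>)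
  have r2: "r z = z" if "norm z \<le> B" for z
    using that \<open>B > 0\<close> by (simp add: r_def max_def)
  have r3: "continuous_on S r" for S
    unfolding r_def using \<open>B > 0\<close> by (intro continuous_intros) auto
  have "AE x in lebesgue. x \<notin> N"
    using N negligible_iff_null_sets AE_not_in by blast
  then have "AE x in lborel. x \<notin> N" by (simp add: AE_completion_iff)
  moreover have "(\<lambda>n. r (g n x)) \<longlonglongrightarrow> f x" if "x \<notin> N" for x
  proof -
    have "(\<lambda>n. r (g n x)) \<longlonglongrightarrow> r (f x)"
      using r3[of UNIV] by (intro isCont_tendsto_compose[where g=r] lim that)
        (auto simp: continuous_on_eq_continuous_at)
    then show ?thesis using r2[OF B] by simp
  qed
  ultimately have "AE x in lborel. (\<lambda>n. r (g n x)) \<longlonglongrightarrow> f x" by auto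
  then show ?thesis
    by (intro that[of "\<lambda>n x. r (g n x)"] r1 continuous_on_compose2[OF r3 g]) auto
qed

text \<open>Testing with the conjugate sign \<open>s\<close> of \<open>u\<close> would give the L^1
  norm of \<open>u\<close>. As \<open>s\<close> is only measurable, it is replaced by bounded
  continuous approximations.\<close>

lemma AE_zero_if_orthogonal_continuous:
  fixes u :: "'a::euclidean_space \<Rightarrow> complex"
  assumes u: "integrable lborel u"
    and 0: "\<And>k B. continuous_on UNIV k \<Longrightarrow> (\<And>x. norm (k x) \<le> B) \<Longrightarrow> (LINT x|lborel. u x * k x) = 0"
  shows "AE x in lborel. u x = 0"
proof -
  have [measurable]: "u \<in> borel_measurable borel" using u by auto
  define s where "s x = cnj (sgn (u x))" for x
  have s: "norm (s x) \<le> 1" for x by (simp add: s_def norm_sgn)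
  have us: "u x * s x = of_real (norm (u x))" for x
    by (simp add: s_def sgn_eq power2_eq_square flip: complex_norm_square)
  have [measurable]: "s \<in> borel_measurable borel"
    unfolding s_def sgn_eq
    by (intro measurable_compose[OF _ borel_measurable_continuous_onI[OF continuous_on_cnj[OF continuous_on_id]]]) measurable
  obtain g where g: "\<And>n::nat. continuous_on UNIV (g n)" "\<And>n x. norm (g n x) \<le> 1"
    and lim: "AE x in lborel. (\<lambda>n. g n x) \<longlonglongrightarrow> s x"
    by (rule continuous_approx_bounded[of s 1]) (auto intro: s)
  have [measurable]: "g n \<in> borel_measurable borel" for n
    by (intro borel_measurable_continuous_onI g)
  have "(\<lambda>n. LINT x|lborel. u x * g n x) \<longlonglongrightarrow> (LINT x|lborel. u x * s x)"
  proof (rule integral_dominated_convergence[where w="\<lambda>x. norm (u x)"])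
    show "AE x in lborel. (\<lambda>n. u x * g n x) \<longlonglongrightarrow> u x * s x"
      using lim by eventually_elim (intro tendsto_intros)
  qed (use u g(2) in \<open>auto simp: norm_mult intro!: AE_I2 mult_left_le\<close>)
  moreover have "(LINT x|lborel. u x * g n x) = 0" for n
    by (rule 0[OF g])
  ultimately have "(LINT x|lborel. u x * s x) = 0"
    by (simp add: LIMSEQ_const_iff)
  then have "(LINT x|lborel. norm (u x)) = 0" by (simp add: us)
  then show ?thesis
    using integral_nonneg_eq_0_iff_AE[of lborel "\<lambda>x. norm (u x)"] u by simp
qed

text \<open>If the transform vanishes, so does every mollification of \<open>u\<close>. By symmetry
  \<open>u\<close> is then orthogonal to every mollified bounded continuous \<open>k\<close>, hence
  in the limit to \<open>k\<close> itself.\<close>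

theorem fourier_eq_0_imp_AE_0:
  fixes u :: "'a::euclidean_space \<Rightarrow> complex"
  assumes u: "integrable lborel u" and 0: "\<And>\<xi>. fourier u \<xi> = 0"
  shows "AE x in lborel. u x = 0"
proof (rule AE_zero_if_orthogonal_continuous[OF u])
  fix k :: "'a \<Rightarrow> complex" and B assume cont: "continuous_on UNIV k" and k: "\<And>x. norm (k x) \<le> B"
  let ?e = "\<lambda>n. 1 / real (Suc n)"
  have e: "?e \<longlonglongrightarrow> 0" by (rule LIMSEQ_Suc[OF lim_const_over_n[of 1]])
  have [measurable]: "u \<in> borel_measurable borel" using u by auto
  have [measurable]: "k \<in> borel_measurable borel" using cont by (rule borel_measurable_continuous_onI)
  have [measurable]: "mollify \<epsilon> k \<in> borel_measurable borel" for \<epsilon>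
    unfolding mollify_def[abs_def] by measurable
  have "(\<lambda>n. LINT x|lborel. u x * mollify (?e n) k x) \<longlonglongrightarrow> (LINT x|lborel. u x * k x)"
  proof (rule integral_dominated_convergence[where w="\<lambda>x. norm (u x) * B"])
    have "(\<lambda>n. mollify (?e n) k x) \<longlonglongrightarrow> k x" for x
      using cont by (intro mollify_tendsto[OF _ k _ e]) (auto simp: continuous_on_eq_continuous_at)
    then show "AE x in lborel. (\<lambda>n. u x * mollify (?e n) k x) \<longlonglongrightarrow> u x * k x"
      by (auto intro!: tendsto_intros)
  qed (use u norm_mollify_le[OF k] in \<open>auto simp: norm_mult intro!: AE_I2 mult_left_mono\<close>)
  moreover have "(LINT x|lborel. u x * mollify (?e n) k x) = 0" for n
  proof -
    have "mollify (?e n) u x = 0" for x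
      by (simp add: 0 inverse_fourier_def flip: inverse_fourier_gauss_fourier[OF u])
    then show ?thesis
      by (subst integral_mult_mollify[symmetric, OF u _ k]) auto
  qed
  ultimately show "(LINT x|lborel. u x * k x) = 0"
    by (simp add: LIMSEQ_const_iff)
qed

section \<open>Decay of Fourier transforms\<close>

text \<open>Integrating \<open>u'\<close> over the segment from x to x + b gives u (x + b) - u x,
  whose integral over x vanishes by translation invariance; Fubini exchanges the two integrations.
  Integrability thus takes the place of boundary terms at infinity.\<close>

lemma integral_directional_derivative_eq_0:
  fixes u u' :: "'a::euclidean_space \<Rightarrow> complex"
  assumes deriv: "\<And>x t. ((\<lambda>t. u (x + t *\<^sub>R b)) has_vector_derivative u' (x + t *\<^sub>R b)) (at t)"
    and u: "integrable lborel u" and u': "integrable lborel u'" and cont: "continuous_on UNIV u'"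
  shows "(LINT x|lborel. u' x) = 0"
proof -
  have [measurable]: "u \<in> borel_measurable borel" "u' \<in> borel_measurable borel" using u u' by auto
  let ?f = "\<lambda>x t. indicator {0..1::real} t *\<^sub>R u' (x + t *\<^sub>R b)"
  have shift: "integrable lborel (\<lambda>x. k (x + t *\<^sub>R b))" "(LINT x|lborel. k (x + t *\<^sub>R b)) = (LINT x|lborel. k x)"
    if "integrable lborel k" for t and k :: "'a \<Rightarrow> 'c::{banach,second_countable_topology}"
    using integrable_shift[OF that, of "t *\<^sub>R b"] integral_shift[of k "t *\<^sub>R b"] that
    by (auto simp: add.commute)
  have ftc: "(LINT t|lborel. ?f x t) = u (x + b) - u x" for x
    using integral_FTC_Icc[of 0 1 "\<lambda>t. u (x + t *\<^sub>R b)" "\<lambda>t. u' (x + t *\<^sub>R b)"]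
    by (simp add: has_vector_derivative_at_within[OF deriv]
        continuous_on_compose2[OF cont] continuous_intros)
  have int: "integrable (lborel \<Otimes>\<^sub>M lborel) (\<lambda>z. ?f (snd z) (fst z))"
  proof (rule lborel_pair.Fubini_integrable)
    show "AE t in lborel. integrable lborel (\<lambda>x. ?f (snd (t, x)) (fst (t, x)))"
      using shift(1)[OF u'] by (auto intro!: AE_I2 integrable_scaleR_right)
  qed (use u' in \<open>auto simp: shift(2)[of "\<lambda>x. norm (u' x)"]\<close>)
  have "(LINT x|lborel. u' x) = (LINT t|lborel. indicator {0..1::real} t *\<^sub>R (LINT x|lborel. u' x))"
    by simp
  also have "\<dots> = (LINT t|lborel. LINT x|lborel. ?f x t)"
    by (simp add: shift u')
  also have "\<dots> = (LINT x|lborel. LINT t|lborel. ?f x t)"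
    using int by (intro lborel_pair.Fubini_integral[symmetric]) (simp add: case_prod_beta')
  also have "\<dots> = 0"
    using shift[OF u, of 1] u by (simp add: ftc)
  finally show ?thesis .
qed

text \<open>Integration by parts: \<open>?v\<close> is the derivative along \<open>b\<close> of
  \<open>?u\<close>, the function \<open>f\<close> times the exponential, so its integral is
  0.\<close>

lemma fourier_derivative:
  fixes f :: "'a::euclidean_space \<Rightarrow> complex"
  assumes deriv: "\<And>x. (f has_derivative D x) (at x)"
    and f: "integrable lborel f" and g: "integrable lborel (\<lambda>x. D x b)"
    and cont: "continuous_on UNIV (\<lambda>x. D x b)"
  shows "fourier (\<lambda>x. D x b) \<xi> = \<i> * of_real (\<xi> \<bullet> b) * fourier f \<xi>"
proof -
  let ?u = "\<lambda>x. f x * cis (- (x \<bullet> \<xi>))"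
  let ?v = "\<lambda>x. D x b * cis (- (x \<bullet> \<xi>)) - \<i> * of_real (\<xi> \<bullet> b) * (f x * cis (- (x \<bullet> \<xi>)))"
  have contf: "continuous_on UNIV f"
    using deriv by (auto simp: continuous_on_eq_continuous_at intro: has_derivative_continuous)
  have iu: "integrable lborel ?u" "integrable lborel (\<lambda>x. D x b * cis (- (x \<bullet> \<xi>)))"
    using integrable_mult_cis[OF f, of "- \<xi>"] integrable_mult_cis[OF g, of "- \<xi>"] by simp_all
  have "(LINT x|lborel. ?v x) = 0"
  proof (rule integral_directional_derivative_eq_0[where u = ?u and b = b])
    fix x t
    have "((\<lambda>t. f (x + t *\<^sub>R b)) has_derivative (\<lambda>h. D (x + t *\<^sub>R b) (h *\<^sub>R b))) (at t)"
      by (rule has_derivative_compose[OF _ deriv]) (auto intro!: derivative_eq_intros)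
    moreover have "D (x + t *\<^sub>R b) (h *\<^sub>R b) = h *\<^sub>R D (x + t *\<^sub>R b) b" for h
      using deriv linear_cmul[OF has_derivative_linear] by blast
    ultimately have 1: "((\<lambda>t. f (x + t *\<^sub>R b)) has_vector_derivative D (x + t *\<^sub>R b) b) (at t)"
      by (simp add: has_vector_derivative_def)
    have "((\<lambda>t. cis (- ((x + t *\<^sub>R b) \<bullet> \<xi>))) has_vector_derivative
        (- (b \<bullet> \<xi>)) *\<^sub>R (\<i> * cis (- ((x + t *\<^sub>R b) \<bullet> \<xi>)))) (at t)"
      unfolding cis_conv_exp
      by (rule derivative_eq_intros has_vector_derivative_real_field refl | simp add: inner_left_distrib algebra_simps scaleR_conv_of_real)+
    from has_vector_derivative_mult[OF 1 this]
    show "((\<lambda>t. ?u (x + t *\<^sub>R b)) has_vector_derivative ?v (x + t *\<^sub>R b)) (at t)"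
      by (simp add: algebra_simps inner_commute scaleR_conv_of_real)
  qed (use iu cont contf in \<open>auto intro!: continuous_intros\<close>)
  then show ?thesis using iu by (simp add: fourier_cis)
qed

section \<open>Finitely many derivatives with weighted decay\<close>

definition decay_bounded :: "('a::euclidean_space \<Rightarrow> complex) \<Rightarrow> bool" where
  "decay_bounded f \<longleftrightarrow> continuous_on UNIV f \<and> (\<exists>C. \<forall>x. norm (f x) \<le> C * decay_weight x)"

text \<open>Finite smoothness is measured because the powers of the symbol are differentiable only
  to finite order across the unit sphere. Schwartz functions satisfy the condition for every
  \<open>k\<close>, so a single inversion result serves both.\<close>

primrec decaying :: "nat \<Rightarrow> ('a::euclidean_space \<Rightarrow> complex) \<Rightarrow> bool" where
  "decaying 0 f \<longleftrightarrow> decay_bounded f"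
| "decaying (Suc k) f \<longleftrightarrow> decay_bounded f \<and> (\<forall>x. f differentiable (at x)) \<and>
     (\<forall>b\<in>Basis. decaying k (\<lambda>x. frechet_derivative f (at x) b))"

lemma decay_boundedE:
  fixes f :: "'a::euclidean_space \<Rightarrow> complex"
  assumes "decay_bounded f"
  obtains C where "C \<ge> 0" "\<And>x. norm (f x) \<le> C * decay_weight x"
proof -
  obtain C where C: "\<And>x. norm (f x) \<le> C * decay_weight x"
    using assms by (auto simp: decay_bounded_def)
  have "0 \<le> C * decay_weight (0::'a)" by (rule order_trans[OF norm_ge_zero C])
  then have "0 \<le> C" by (simp add: decay_weight_def)
  then show ?thesis using C by (rule that)
qed

lemma decay_bounded_integrable:
  fixes f :: "'a::euclidean_space \<Rightarrow> complex"
  assumes "decay_bounded f"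
  shows "integrable lborel f"
proof -
  obtain C where C: "\<And>x. norm (f x) \<le> C * decay_weight x" "C \<ge> 0"
    using decay_boundedE[OF assms] by metis
  show ?thesis
  proof (rule Bochner_Integration.integrable_bound)
    show "integrable lborel (\<lambda>x::'a. C * decay_weight x)"
      by (intro integrable_mult_right integrable_decay_weight)
    show "f \<in> borel_measurable lborel"
      using assms by (simp add: decay_bounded_def borel_measurable_continuous_onI)
    show "AE x in lborel. norm (f x) \<le> norm (C * decay_weight x)"
      using C(1) by (auto intro!: AE_I2 order_trans[OF C(1)])
  qed
qed

lemma decay_bounded_bounded:
  assumes "decay_bounded f"
  obtains B where "\<And>x. norm (f x) \<le> B" "B > 0"
proof -
  obtain C where C: "\<And>x. norm (f x) \<le> C * decay_weight x" "C \<ge> 0"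
    using decay_boundedE[OF assms] by metis
  have "norm (f x) \<le> C + 1" for x
    using C(1)[of x] mult_left_mono[OF decay_weight_le_1[of x] C(2)] by simp
  then show ?thesis using that C(2) by (meson add_nonneg_pos zero_less_one)
qed

lemma decaying_imp_decay_bounded: "decaying k f \<Longrightarrow> decay_bounded f"
  by (cases k) auto

lemma decaying_Suc_imp: "decaying (Suc k) f \<Longrightarrow> decaying k f"
proof (induction k arbitrary: f)
  case (Suc k)
  then show ?case by (metis decaying.simps(2))
qed auto

lemma decaying_SucI:
  assumes "decay_bounded f" and D: "\<And>x. (f has_derivative D x) (at x)"
    and "\<And>b. b \<in> Basis \<Longrightarrow> decaying k (\<lambda>x. D x b)"
  shows "decaying (Suc k) f"
proof -
  have "frechet_derivative f (at x) = D x" for x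
    using frechet_derivative_at[OF D] by simp
  then show ?thesis using assms by (auto simp: differentiable_def)
qed

lemma decaying_Suc_derivative:
  "decaying (Suc k) f \<Longrightarrow> (f has_derivative frechet_derivative f (at x)) (at x)"
  using frechet_derivative_works by auto

lemma decay_bounded_diff:
  assumes f: "decay_bounded f" and g: "decay_bounded g"
  shows "decay_bounded (\<lambda>x. f x - g x)"
proof -
  obtain C where C: "\<And>x. norm (f x) \<le> C * decay_weight x" using decay_boundedE[OF f] by metis
  obtain D where D: "\<And>x. norm (g x) \<le> D * decay_weight x" using decay_boundedE[OF g] by metis
  have "norm (f x - g x) \<le> (C + D) * decay_weight x" for x
    using norm_triangle_ineq4[of "f x" "g x"] C[of x] D[of x] by (simp add: distrib_right)
  then show ?thesis using f g by (auto simp: decay_bounded_def intro!: continuous_intros)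
qed

lemma decaying_diff: "decaying k f \<Longrightarrow> decaying k g \<Longrightarrow> decaying k (\<lambda>x. f x - g x)"
proof (induction k arbitrary: f g)
  case 0 then show ?case by (simp add: decay_bounded_diff)
next
  case (Suc k)
  show ?case
  proof (rule decaying_SucI)
    show "decay_bounded (\<lambda>x. f x - g x)"
      using Suc.prems by (auto intro: decay_bounded_diff)
    show "((\<lambda>x. f x - g x) has_derivative
        (\<lambda>h. frechet_derivative f (at x) h - frechet_derivative g (at x) h)) (at x)" for x
      by (intro has_derivative_diff decaying_Suc_derivative[OF Suc.prems(1)] decaying_Suc_derivative[OF Suc.prems(2)])
    show "decaying k (\<lambda>x. frechet_derivative f (at x) b - frechet_derivative g (at x) b)" if "b \<in> Basis" for b
      using Suc.prems that by (intro Suc.IH) auto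
  qed
qed

lemma fourier_frechet_derivative:
  assumes f: "decaying (Suc k) f" and b: "b \<in> Basis"
  shows "fourier (\<lambda>x. frechet_derivative f (at x) b) \<xi> = \<i> * of_real (\<xi> \<bullet> b) * fourier f \<xi>"
proof -
  have "decay_bounded f" "decay_bounded (\<lambda>x. frechet_derivative f (at x) b)"
    using f b decaying_imp_decay_bounded by auto
  then show ?thesis
    by (intro fourier_derivative decaying_Suc_derivative[OF f] decay_bounded_integrable)
       (auto simp: decay_bounded_def)
qed

text \<open>Along each \<open>b\<close> the operator 1 - (d/db)^2 uses up two derivatives and
  multiplies the transform by 1 + (\<xi> . b)^2. Applying it for one coordinate at a time leaves a
  bounded transform at the end.\<close>

lemma fourier_decay_on:
  fixes f :: "'a::euclidean_space \<Rightarrow> complex"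
  assumes "finite B" "B \<subseteq> Basis" "decaying (2 * card B) f"
  shows "\<exists>C. \<forall>\<xi>. (\<Prod>b\<in>B. 1 + (\<xi> \<bullet> b)\<^sup>2) * norm (fourier f \<xi>) \<le> C"
  using assms
proof (induction B arbitrary: f rule: finite_induct)
  case empty
  then show ?case using norm_fourier_le[of f] by auto
next
  case (insert b B)
  let ?D = "\<lambda>f x. frechet_derivative f (at x) b"
  let ?g = "\<lambda>x. f x - ?D (?D f) x"
  have b: "b \<in> Basis" and f: "decaying (Suc (Suc (2 * card B))) f"
    using insert by auto
  have f': "decaying (Suc (2 * card B)) (?D f)"
    using f b by simp
  then have f'': "decaying (2 * card B) (?D (?D f))"
    using b by simp
  have g: "decaying (2 * card B) ?g"
    by (rule decaying_diff[OF decaying_Suc_imp[OF decaying_Suc_imp[OF f]] f''])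
  then obtain C where C: "\<And>\<xi>. (\<Prod>b\<in>B. 1 + (\<xi> \<bullet> b)\<^sup>2) * norm (fourier ?g \<xi>) \<le> C"
    using insert.IH[OF _ g] insert.prems by blast
  have "fourier ?g \<xi> = of_real (1 + (\<xi> \<bullet> b)\<^sup>2) * fourier f \<xi>" for \<xi>
  proof -
    have "fourier ?g \<xi> = fourier f \<xi> - fourier (?D (?D f)) \<xi>"
      using f f'' by (intro fourier_diff decay_bounded_integrable) (auto dest: decaying_imp_decay_bounded)
    also have "fourier (?D (?D f)) \<xi> = \<i> * of_real (\<xi> \<bullet> b) * (\<i> * of_real (\<xi> \<bullet> b) * fourier f \<xi>)"
      by (simp only: fourier_frechet_derivative[OF f b] fourier_frechet_derivative[OF f' b])
    finally show ?thesis by (simp add: algebra_simps power2_eq_square)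
  qed
  then have "norm (fourier ?g \<xi>) = (1 + (\<xi> \<bullet> b)\<^sup>2) * norm (fourier f \<xi>)" for \<xi>
    by (simp add: norm_mult del: of_real_add)
  then have "(\<Prod>b\<in>insert b B. 1 + (\<xi> \<bullet> b)\<^sup>2) * norm (fourier f \<xi>) \<le> C" for \<xi>
    using C[of \<xi>] insert.hyps by (simp add: ac_simps)
  then show ?case by blast
qed

text \<open>Over all of \<open>Basis\<close> the product in the preceding estimate is the reciprocal
  of the weight. This fixes the number of derivatives at 2 d.\<close>

theorem fourier_decay_bounded:
  fixes f :: "'a::euclidean_space \<Rightarrow> complex"
  assumes f: "decaying (2 * DIM('a)) f"
  shows "decay_bounded (fourier f)"
proof -
  obtain C where C: "\<And>\<xi>. (\<Prod>b\<in>(Basis::'a set). 1 + (\<xi> \<bullet> b)\<^sup>2) * norm (fourier f \<xi>) \<le> C"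
    using fourier_decay_on[of Basis f] f by auto
  have "norm (fourier f \<xi>) \<le> C * decay_weight \<xi>" for \<xi>
  proof -
    have "(\<Prod>b\<in>(Basis::'a set). 1 + (\<xi> \<bullet> b)\<^sup>2) > 0"
      by (intro prod_pos) (auto intro: add_pos_nonneg)
    moreover have "decay_weight \<xi> = 1 / (\<Prod>b\<in>(Basis::'a set). 1 + (\<xi> \<bullet> b)\<^sup>2)"
      by (simp add: decay_weight_def prod_dividef)
    ultimately show ?thesis
      using C[of \<xi>] by (simp add: field_simps)
  qed
  moreover have "integrable lborel f"
    using f decay_bounded_integrable decaying_imp_decay_bounded by blast
  ultimately show ?thesis
    by (auto simp: decay_bounded_def intro: isCont_fourier)
qed

lemma decay_bounded_inverse_fourier:
  fixes f :: "'a::euclidean_space \<Rightarrow> complex"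
  assumes f: "decaying (2 * DIM('a)) f"
  shows "decay_bounded (inverse_fourier f)"
proof -
  obtain C where C: "\<And>x. norm (fourier f x) \<le> C * decay_weight x"
    using decay_boundedE[OF fourier_decay_bounded[OF f]] by metis
  have "norm (inverse_fourier f x) \<le> inverse ((2 * pi) ^ DIM('a)) * (C * decay_weight x)" for x
    unfolding inverse_fourier_eq_fourier norm_scaleR
    using C[of "-x"] by (intro mult_mono) auto
  moreover have "integrable lborel f"
    using f decay_bounded_integrable decaying_imp_decay_bounded by blast
  ultimately show ?thesis
    unfolding decay_bounded_def mult.assoc[symmetric]
    using continuous_on_inverse_fourier[of f UNIV] by blast
qed

lemma decaying_inversion:
  fixes f :: "'a::euclidean_space \<Rightarrow> complex"
  assumes f: "decaying (2 * DIM('a)) f"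
  shows "inverse_fourier (fourier f) x = f x" "fourier (inverse_fourier f) x = f x"
proof -
  have d: "decay_bounded f" using f decaying_imp_decay_bounded by blast
  obtain B where B: "\<And>x. norm (f x) \<le> B" using decay_bounded_bounded[OF d] by metis
  have c: "continuous_on UNIV f" using d by (simp add: decay_bounded_def)
  note int = decay_bounded_integrable[OF d] decay_bounded_integrable[OF fourier_decay_bounded[OF f]]
  show "inverse_fourier (fourier f) x = f x" "fourier (inverse_fourier f) x = f x"
    by (rule fourier_inversion[OF int c B] fourier_inverse_inversion[OF int c B])+
qed

section \<open>Schwartz functions as \<open>decaying\<close> functions\<close>

lemma iterated_partial_snoc:
  "iterated_partial (bs @ [b]) f = iterated_partial bs (\<lambda>x. frechet_derivative f (at x) b)"
  by (simp add: iterated_partial_def)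

lemma iterated_partial_Nil [simp]: "iterated_partial [] f = f"
  by (simp add: iterated_partial_def)

text \<open>The last entry of the list is differentiated first, so the derivatives of a partial
  derivative of \<open>f\<close> are those of \<open>f\<close> along the list with \<open>b\<close>
  appended.\<close>

lemma schwartz_frechet_derivative:
  assumes "schwartz f" "b \<in> Basis"
  shows "schwartz (\<lambda>x. frechet_derivative f (at x) b)"
  using assms unfolding schwartz_def iterated_partial_snoc[symmetric] by auto

text \<open>The seminorms with |x|^0 and |x|^(2 d) are enough, because (1 + |x|^2)^d is at most 2^d
  (1 + |x|^(2 d)).\<close>

lemma schwartz_decay_bounded:
  fixes f :: "'a::euclidean_space \<Rightarrow> complex"
  assumes f: "schwartz f"
  shows "decay_bounded f"
proof -
  have f0: "f differentiable (at x)" "bounded (range (\<lambda>x. norm x ^ k * norm (f x)))" for x k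
    using f unfolding schwartz_def by (force dest: bspec[of _ _ "[]"])+
  let ?d = "DIM('a)"
  obtain A where A: "\<And>x. norm x ^ 0 * norm (f x) \<le> A"
    using f0(2)[of 0] by (auto simp: bounded_iff)
  obtain B where B: "\<And>x. norm x ^ (2 * ?d) * norm (f x) \<le> B"
    using f0(2)[of "2 * ?d"] by (auto simp: bounded_iff)
  have "norm (f x) \<le> (2 ^ ?d * (A + B)) * decay_weight x" for x
  proof -
    have "(1 + (norm x)\<^sup>2) ^ ?d \<le> (2 * max 1 ((norm x)\<^sup>2)) ^ ?d"
      by (intro power_mono) auto
    also have "\<dots> \<le> 2 ^ ?d * (1 + norm x ^ (2 * ?d))"
      by (cases "1 \<le> (norm x)\<^sup>2") (auto simp: max_def power_mult_distrib power_mult)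
    finally have "(1 + (norm x)\<^sup>2) ^ ?d * norm (f x) \<le> 2 ^ ?d * (1 + norm x ^ (2 * ?d)) * norm (f x)"
      by (intro mult_right_mono) auto
    also have "\<dots> = 2 ^ ?d * (norm x ^ 0 * norm (f x) + norm x ^ (2 * ?d) * norm (f x))"
      by (simp add: algebra_simps)
    also have "\<dots> \<le> 2 ^ ?d * (A + B)"
      by (intro mult_left_mono add_mono A B) auto
    finally have *: "(1 + (norm x)\<^sup>2) ^ ?d * norm (f x) \<le> 2 ^ ?d * (A + B)" .
    have p: "0 < (1 + (norm x)\<^sup>2) ^ ?d" by (intro zero_less_power add_pos_nonneg) auto
    then have "norm (f x) \<le> 2 ^ ?d * (A + B) * (1 / (1 + (norm x)\<^sup>2) ^ ?d)"
      using * by (simp add: field_simps)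
    also have "\<dots> \<le> 2 ^ ?d * (A + B) * decay_weight x"
    proof (rule mult_left_mono[OF decay_weight_ge])
      show "0 \<le> 2 ^ ?d * (A + B)"
        using order_trans[OF _ *] p by (meson less_imp_le mult_nonneg_nonneg norm_ge_zero)
    qed
    finally show ?thesis .
  qed
  moreover have "continuous_on UNIV f"
    using f0(1) by (simp add: continuous_on_eq_continuous_at differentiable_imp_continuous_within)
  ultimately show ?thesis by (auto simp: decay_bounded_def)
qed

lemma schwartz_decaying: "schwartz f \<Longrightarrow> decaying k f"
proof (induction k arbitrary: f)
  case (Suc k)
  moreover have "f differentiable (at x)" for x
    using Suc.prems unfolding schwartz_def by (force dest: bspec[of _ _ "[]"])
  ultimately show ?case
    by (simp add: schwartz_decay_bounded schwartz_frechet_derivative)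
qed (simp add: schwartz_decay_bounded)

section \<open>Schwartz functions and \<open>L\<^sup>p\<close>\<close>

text \<open>This class is closed under partial derivatives, so its products with the Gaussian are Schwartz
  functions.\<close>

inductive gauss_poly :: "'a::euclidean_space \<Rightarrow> ('a \<Rightarrow> complex) \<Rightarrow> bool" for y where
  gauss_poly_const: "gauss_poly y (\<lambda>x. c)"
| gauss_poly_inner: "gauss_poly y (\<lambda>x. of_real (x \<bullet> v))"
| gauss_poly_gauss: "gauss_poly y (\<lambda>x. of_real (gauss (x - y)))"
| gauss_poly_add: "gauss_poly y f \<Longrightarrow> gauss_poly y g \<Longrightarrow> gauss_poly y (\<lambda>x. f x + g x)"
| gauss_poly_mult: "gauss_poly y f \<Longrightarrow> gauss_poly y g \<Longrightarrow> gauss_poly y (\<lambda>x. f x * g x)"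

lemma gauss_poly_growth:
  assumes "gauss_poly y f"
  shows "\<exists>C n. 0 \<le> C \<and> (\<forall>x. norm (f x) \<le> C * (1 + norm x) ^ n)"
  using assms
proof induction
  case (gauss_poly_const c)
  show ?case by (rule exI[of _ "norm c"], rule exI[of _ 0]) auto
next
  case (gauss_poly_inner v)
  have "\<bar>x \<bullet> v\<bar> \<le> norm v * (1 + norm x) ^ 1" for x
    using Cauchy_Schwarz_ineq2[of x v] by (simp add: algebra_simps add_increasing)
  then show ?case by (intro exI[of _ "norm v"] exI[of _ 1]) auto
next
  case gauss_poly_gauss
  show ?case by (rule exI[of _ 1], rule exI[of _ 0]) auto
next
  case (gauss_poly_add f g)
  then obtain C m D n where *: "0 \<le> C" "0 \<le> D" "\<And>x. norm (f x) \<le> C * (1 + norm x) ^ m"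
    "\<And>x. norm (g x) \<le> D * (1 + norm x) ^ n" by blast
  have "norm (f x + g x) \<le> (C + D) * (1 + norm x) ^ (m + n)" for x
  proof -
    have "(1 + norm x) ^ m \<le> (1 + norm x) ^ (m + n)" "(1 + norm x) ^ n \<le> (1 + norm x) ^ (m + n)"
      by (auto intro!: power_increasing)
    then have "C * (1 + norm x) ^ m \<le> C * (1 + norm x) ^ (m + n)" "D * (1 + norm x) ^ n \<le> D * (1 + norm x) ^ (m + n)"
      using *(1,2) by (auto intro: mult_left_mono)
    then show ?thesis
      using norm_triangle_ineq[of "f x" "g x"] *(3,4)[of x] by (simp add: distrib_right)
  qed
  then show ?case using *(1,2) by (intro exI[of _ "C + D"] exI[of _ "m + n"]) auto
next
  case (gauss_poly_mult f g)
  then obtain C m D n where *: "0 \<le> C" "0 \<le> D" "\<And>x. norm (f x) \<le> C * (1 + norm x) ^ m"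
    "\<And>x. norm (g x) \<le> D * (1 + norm x) ^ n" by blast
  have "norm (f x * g x) \<le> (C * D) * (1 + norm x) ^ (m + n)" for x
    using mult_mono[OF *(3)[of x] *(4)[of x]] *(1,2) by (simp add: norm_mult power_add ac_simps)
  then show ?case using *(1,2) by (intro exI[of _ "C * D"] exI[of _ "m + n"]) auto
qed

lemma gauss_has_derivative:
  "((\<lambda>x. complex_of_real (gauss (x - y))) has_derivative
     (\<lambda>h. - of_real ((x - y) \<bullet> h) * of_real (gauss (x - y)))) (at x)"
proof -
  have "((\<lambda>x. gauss (x - y)) has_derivative (\<lambda>h. - ((x - y) \<bullet> h) * gauss (x - y))) (at x)"
  proof -
    have "((\<lambda>x. - ((x - y) \<bullet> (x - y)) / 2) has_derivative (\<lambda>h. - ((x - y) \<bullet> h))) (at x)"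
      by (auto intro!: derivative_eq_intros simp: inner_commute)
    from has_derivative_exp[OF this] show ?thesis
      unfolding gauss_def power2_norm_eq_inner by (simp add: mult.commute)
  qed
  then have "((\<lambda>x. complex_of_real (gauss (x - y))) has_derivative
     (\<lambda>h. of_real (- ((x - y) \<bullet> h) * gauss (x - y)))) (at x)"
    by (rule has_derivative_of_real)
  then show ?thesis by simp
qed

lemma gauss_poly_sum: "(\<And>i. i \<in> I \<Longrightarrow> gauss_poly y (f i)) \<Longrightarrow> gauss_poly y (\<lambda>x. \<Sum>i\<in>I. f i x)"
proof (induction I rule: infinite_finite_induct)
  case (insert i I)
  then show ?case by (simp add: gauss_poly_add)
qed (auto simp: gauss_poly_const)

lemma gauss_poly_minus_inner: "gauss_poly y (\<lambda>x. - of_real ((x - y) \<bullet> b))"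
  using gauss_poly_add[OF gauss_poly_inner[of y "- b"] gauss_poly_const[of y "of_real (y \<bullet> b)"]]
  by (simp add: inner_diff_left)

lemma gauss_poly_derivative:
  assumes "gauss_poly y f"
  shows "\<exists>D. (\<forall>x. (f has_derivative D x) (at x)) \<and> (\<forall>b. gauss_poly y (\<lambda>x. D x b))"
  using assms
proof induction
  case (gauss_poly_const c)
  show ?case by (intro exI[of _ "\<lambda>x h. 0"]) (auto intro: gauss_poly.intros)
next
  case (gauss_poly_inner v)
  show ?case
    by (intro exI[of _ "\<lambda>x h. of_real (h \<bullet> v)"])
       (auto intro!: derivative_eq_intros gauss_poly.intros(1))
next
  case gauss_poly_gauss
  show ?case
    by (intro exI[of _ "\<lambda>x h. - of_real ((x - y) \<bullet> h) * of_real (gauss (x - y))"] conjI allI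
        gauss_has_derivative gauss_poly_mult gauss_poly_minus_inner gauss_poly.intros(3))
next
  case (gauss_poly_add f g)
  then obtain D E where *: "\<And>x. (f has_derivative D x) (at x)" "\<And>b. gauss_poly y (\<lambda>x. D x b)"
    "\<And>x. (g has_derivative E x) (at x)" "\<And>b. gauss_poly y (\<lambda>x. E x b)" by blast
  then show ?case
    by (intro exI[of _ "\<lambda>x h. D x h + E x h"]) (auto intro!: has_derivative_add gauss_poly.intros(4))
next
  case (gauss_poly_mult f g)
  then obtain D E where *: "\<And>x. (f has_derivative D x) (at x)" "\<And>b. gauss_poly y (\<lambda>x. D x b)"
    "\<And>x. (g has_derivative E x) (at x)" "\<And>b. gauss_poly y (\<lambda>x. E x b)" by blast
  then show ?case
    using gauss_poly_mult.hyps
    by (intro exI[of _ "\<lambda>x h. f x * E x h + D x h * g x"])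
       (auto intro!: has_derivative_mult gauss_poly.intros(4,5))
qed

text \<open>The Gaussian survives every differentiation. Its logarithmic derivative -(x - y) . b
  belongs to the class, so the cofactor stays there as well.\<close>

lemma iterated_partial_gauss_poly:
  assumes "gauss_poly y g"
  shows "\<exists>k. gauss_poly y k \<and> iterated_partial bs (\<lambda>x. of_real (gauss (x - y)) * g x) =
     (\<lambda>x. of_real (gauss (x - y)) * k x)"
proof (induction bs)
  case Nil
  then show ?case using assms by auto
next
  case (Cons b bs)
  then obtain k where k: "gauss_poly y k"
    and eq: "iterated_partial bs (\<lambda>x. of_real (gauss (x - y)) * g x) = (\<lambda>x. of_real (gauss (x - y)) * k x)"
    by blast
  obtain D where D: "\<And>x. (k has_derivative D x) (at x)" "\<And>b. gauss_poly y (\<lambda>x. D x b)"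
    using gauss_poly_derivative[OF k] by blast
  let ?k = "\<lambda>x. D x b + - of_real ((x - y) \<bullet> b) * k x"
  have "((\<lambda>x. of_real (gauss (x - y)) * k x) has_derivative
      (\<lambda>h. of_real (gauss (x - y)) * D x h + - of_real ((x - y) \<bullet> h) * of_real (gauss (x - y)) * k x)) (at x)" for x
    by (rule has_derivative_mult[OF gauss_has_derivative D(1)])
  from frechet_derivative_at[OF this, symmetric]
  have "iterated_partial (b # bs) (\<lambda>x. of_real (gauss (x - y)) * g x) = (\<lambda>x. of_real (gauss (x - y)) * ?k x)"
    using eq by (simp add: iterated_partial_def algebra_simps)
  moreover have "gauss_poly y ?k"
    by (intro gauss_poly_add gauss_poly_mult D k gauss_poly_minus_inner)
  ultimately show ?case by blast
qed

text \<open>With s = |x - y|, one has 1 + |x| \<le> (1 + |y|)(1 + s) and 1 + s \<le> exp s.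
  Completing the square in m s - s^2 / 2 gives the constant.\<close>

lemma power_mult_gauss_le: "(1 + norm x) ^ m * gauss (x - y) \<le> (1 + norm y) ^ m * exp ((real m)\<^sup>2 / 2)"
proof -
  let ?s = "norm (x - y)"
  have "norm x \<le> norm y + ?s" using norm_triangle_ineq[of y "x - y"] by simp
  also have "\<dots> \<le> norm y + ?s + norm y * ?s" by simp
  finally have "1 + norm x \<le> (1 + norm y) * (1 + ?s)" by (simp add: algebra_simps)
  then have "(1 + norm x) ^ m \<le> ((1 + norm y) * (1 + ?s)) ^ m" by (intro power_mono) auto
  also have "\<dots> = (1 + norm y) ^ m * (1 + ?s) ^ m" by (simp add: power_mult_distrib)
  also have "\<dots> \<le> (1 + norm y) ^ m * exp (real m * ?s)"
  proof (intro mult_left_mono)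
    have "(1 + ?s) ^ m \<le> exp ?s ^ m" by (intro power_mono) (auto simp: exp_ge_add_one_self)
    then show "(1 + ?s) ^ m \<le> exp (real m * ?s)" by (simp add: exp_of_nat_mult)
  qed auto
  finally have "(1 + norm x) ^ m * gauss (x - y) \<le> (1 + norm y) ^ m * exp (real m * ?s) * gauss (x - y)"
    by (intro mult_right_mono) auto
  also have "\<dots> = (1 + norm y) ^ m * exp (real m * ?s - ?s\<^sup>2 / 2)"
    by (simp add: gauss_def mult.assoc flip: exp_add)
  also have "\<dots> \<le> (1 + norm y) ^ m * exp ((real m)\<^sup>2 / 2)"
    using zero_le_power2[of "real m - ?s"]
    by (intro mult_left_mono) (auto simp: power2_diff algebra_simps power2_eq_square)
  finally show ?thesis .
qed

theorem schwartz_gauss_poly: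
  assumes "gauss_poly y g"
  shows "schwartz (\<lambda>x. of_real (gauss (x - y)) * g x)"
  unfolding schwartz_def
proof (intro ballI conjI allI)
  fix bs x and n :: nat
  obtain k where k: "gauss_poly y k"
    and eq: "iterated_partial bs (\<lambda>x. of_real (gauss (x - y)) * g x) = (\<lambda>x. of_real (gauss (x - y)) * k x)"
    using iterated_partial_gauss_poly[OF assms] by blast
  show "iterated_partial bs (\<lambda>x. of_real (gauss (x - y)) * g x) differentiable at x"
    unfolding eq differentiable_def using gauss_poly_derivative[OF k] has_derivative_mult[OF gauss_has_derivative]
    by blast
  obtain C m where C: "0 \<le> C" "\<And>x. norm (k x) \<le> C * (1 + norm x) ^ m"
    using gauss_poly_growth[OF k] by blast
  have "norm x ^ n * norm (of_real (gauss (x - y)) * k x) \<le> C * ((1 + norm y) ^ (n + m) * exp ((real (n + m))\<^sup>2 / 2))" for x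
  proof -
    have "norm x ^ n * norm (of_real (gauss (x - y)) * k x) = norm x ^ n * norm (k x) * gauss (x - y)"
      by (simp add: norm_mult)
    also have "\<dots> \<le> (1 + norm x) ^ n * (C * (1 + norm x) ^ m) * gauss (x - y)"
      using C by (intro mult_right_mono mult_mono power_mono) auto
    also have "\<dots> = C * ((1 + norm x) ^ (n + m) * gauss (x - y))" by (simp add: power_add)
    also have "\<dots> \<le> C * ((1 + norm y) ^ (n + m) * exp ((real (n + m))\<^sup>2 / 2))"
      by (intro mult_left_mono power_mult_gauss_le C)
    finally show ?thesis .
  qed
  then show "bounded (range (\<lambda>x. norm x ^ n * norm (iterated_partial bs (\<lambda>x. of_real (gauss (x - y)) * g x) x)))"
    unfolding eq by (auto simp: bounded_iff norm_mult power_abs)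
qed

text \<open>Keeping the p-th power makes this an honest integral: it scales and translates simply,
  and additivity up to the factor 2^p is elementary. That quasi-norm property takes the place of
  Minkowski's inequality.\<close>

definition Lp_int :: "real \<Rightarrow> ('a::euclidean_space \<Rightarrow> complex) \<Rightarrow> real" where
  "Lp_int p f = (LINT x|lborel. norm (f x) powr p)"

lemma Lp_int_nonneg [simp]: "0 \<le> Lp_int p f"
  by (simp add: Lp_int_def)

lemma Lp_norm_eq: "Lp_norm p f = Lp_int p f powr (1 / p)"
  by (simp add: Lp_norm_def Lp_int_def)

text \<open>The maximum guards against a negative \<open>C\<close>, which the definitions of
  boundedness allow.\<close>

lemma Lp_int_le_of_norm_le:
  assumes "p \<ge> 1" "Lp_norm p g \<le> C * Lp_norm p f"
  shows "Lp_int p g \<le> (max C 0) powr p * Lp_int p f"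
proof -
  have "Lp_norm p g \<le> max C 0 * Lp_norm p f"
    using assms(2) by (rule order_trans) (auto intro: mult_right_mono simp: Lp_norm_eq)
  then have "Lp_norm p g powr p \<le> (max C 0 * Lp_norm p f) powr p"
    using assms(1) by (intro powr_mono2) (auto simp: Lp_norm_eq)
  then show ?thesis
    using assms(1) by (simp add: Lp_norm_eq powr_mult powr_powr)
qed

lemma Lp_norm_le_of_int_le:
  assumes "p \<ge> 1" "Lp_int p g \<le> K * Lp_int p f" "0 \<le> K"
  shows "Lp_norm p g \<le> K powr (1 / p) * Lp_norm p f"
proof -
  have "Lp_int p g powr (1 / p) \<le> (K * Lp_int p f) powr (1 / p)"
    using assms by (intro powr_mono2) auto
  then show ?thesis using assms(3) by (simp add: Lp_norm_eq powr_mult)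
qed

lemma powr_add_le:
  fixes a b :: real
  assumes "p \<ge> 0" "0 \<le> a" "0 \<le> b"
  shows "(a + b) powr p \<le> 2 powr p * (a powr p + b powr p)"
proof -
  have "(a + b) powr p \<le> (2 * max a b) powr p" using assms by (intro powr_mono2) auto
  also have "\<dots> = 2 powr p * max a b powr p" using assms by (simp add: powr_mult)
  also have "\<dots> \<le> 2 powr p * (a powr p + b powr p)"
    by (intro mult_left_mono) (auto simp: max_def)
  finally show ?thesis .
qed

lemma Lp_spaceD: "f \<in> Lp_space p \<Longrightarrow> f \<in> borel_measurable borel"
  "f \<in> Lp_space p \<Longrightarrow> integrable lborel (\<lambda>x. norm (f x) powr p)"
  by (auto simp: Lp_space_def)

lemma Lp_space_bound:
  assumes "f \<in> borel_measurable borel" "integrable lborel g"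
    "AE x in lborel. norm (f x) powr p \<le> g x"
  shows "f \<in> Lp_space p" "Lp_int p f \<le> (LINT x|lborel. g x)"
proof -
  have [measurable]: "f \<in> borel_measurable borel" by fact
  have i: "integrable lborel (\<lambda>x. norm (f x) powr p)"
    by (rule Bochner_Integration.integrable_bound[OF assms(2)])
       (use assms(3) in \<open>auto elim!: eventually_mono\<close>)
  then show "f \<in> Lp_space p" using assms by (simp add: Lp_space_def)
  show "Lp_int p f \<le> (LINT x|lborel. g x)"
    unfolding Lp_int_def by (rule integral_mono_AE[OF i assms(2,3)])
qed

lemma
  assumes p: "p \<ge> 0" and f: "f \<in> Lp_space p" and g: "g \<in> Lp_space p"
  shows Lp_space_add: "(\<lambda>x. f x + g x) \<in> Lp_space p"
    and Lp_int_add: "Lp_int p (\<lambda>x. f x + g x) \<le> 2 powr p * (Lp_int p f + Lp_int p g)"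
proof -
  note [measurable] = Lp_spaceD(1)[OF f] Lp_spaceD(1)[OF g]
  have "norm (f x + g x) powr p \<le> (norm (f x) + norm (g x)) powr p" for x
    using p by (intro powr_mono2 norm_triangle_ineq) auto
  also have "\<dots> x \<le> 2 powr p * (norm (f x) powr p + norm (g x) powr p)" for x
    using p by (intro powr_add_le) auto
  finally have *: "AE x in lborel. norm (f x + g x) powr p \<le> 2 powr p * (norm (f x) powr p + norm (g x) powr p)"
    by simp
  note i = Lp_spaceD(2)[OF f] Lp_spaceD(2)[OF g]
  have j: "integrable lborel (\<lambda>x. 2 powr p * (norm (f x) powr p + norm (g x) powr p))"
    using i by auto
  show "(\<lambda>x. f x + g x) \<in> Lp_space p"
    by (rule Lp_space_bound(1)[OF _ j *]) measurable
  have "Lp_int p (\<lambda>x. f x + g x) \<le> (LINT x|lborel. 2 powr p * (norm (f x) powr p + norm (g x) powr p))"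
    by (rule Lp_space_bound(2)[OF _ j *]) measurable
  also have "\<dots> = 2 powr p * (Lp_int p f + Lp_int p g)"
    using i by (simp add: Lp_int_def)
  finally show "Lp_int p (\<lambda>x. f x + g x) \<le> 2 powr p * (Lp_int p f + Lp_int p g)" .
qed

lemma
  assumes f: "f \<in> Lp_space p"
  shows Lp_space_cmult: "(\<lambda>x. c * f x) \<in> Lp_space p"
    and Lp_int_cmult: "Lp_int p (\<lambda>x. c * f x) = norm c powr p * Lp_int p f"
proof -
  note [measurable] = Lp_spaceD(1)[OF f]
  have eq: "norm (c * f x) powr p = norm c powr p * norm (f x) powr p" for x
    by (simp add: norm_mult powr_mult)
  show "(\<lambda>x. c * f x) \<in> Lp_space p"
    using Lp_spaceD[OF f] by (simp add: Lp_space_def eq)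
  show "Lp_int p (\<lambda>x. c * f x) = norm c powr p * Lp_int p f"
    by (simp add: Lp_int_def eq)
qed

lemma Lp_int_uminus [simp]: "Lp_int p (\<lambda>x. - f x) = Lp_int p f"
  by (simp add: Lp_int_def)

lemma Lp_int_minus_commute: "Lp_int p (\<lambda>x. f x - g x) = Lp_int p (\<lambda>x. g x - f x)"
  by (simp add: Lp_int_def norm_minus_commute)

lemma
  assumes p: "p \<ge> 0" and f: "f \<in> Lp_space p" and g: "g \<in> Lp_space p"
  shows Lp_space_diff: "(\<lambda>x. f x - g x) \<in> Lp_space p"
    and Lp_int_diff: "Lp_int p (\<lambda>x. f x - g x) \<le> 2 powr p * (Lp_int p f + Lp_int p g)"
  using Lp_space_add[OF p f Lp_space_cmult[OF g, of "-1"]]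
    Lp_int_add[OF p f Lp_space_cmult[OF g, of "-1"]] by simp_all

lemma Lp_int_triangle3:
  assumes p: "p \<ge> 0" and f: "f \<in> Lp_space p" and g: "g \<in> Lp_space p" and h: "h \<in> Lp_space p"
  shows "Lp_int p (\<lambda>x. f x - h x) \<le> 2 powr p * (Lp_int p (\<lambda>x. f x - g x) + Lp_int p (\<lambda>x. g x - h x))"
  using Lp_int_add[OF p Lp_space_diff[OF p f g] Lp_space_diff[OF p g h]] by simp

lemma
  assumes f: "f \<in> Lp_space p" and g: "g \<in> borel_measurable borel" and eq: "AE x in lborel. g x = f x"
  shows Lp_space_cong_AE: "g \<in> Lp_space p" and Lp_int_cong_AE: "Lp_int p g = Lp_int p f"
proof -
  note [measurable] = Lp_spaceD(1)[OF f] g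
  show "Lp_int p g = Lp_int p f"
    unfolding Lp_int_def using eq by (intro integral_cong_AE) (auto elim!: eventually_mono)
  show "g \<in> Lp_space p"
    by (rule Lp_space_bound(1)[OF g Lp_spaceD(2)[OF f]]) (use eq in \<open>auto elim!: eventually_mono\<close>)
qed

lemma Lp_int_eq_0_imp_AE:
  assumes f: "f \<in> Lp_space p" and p: "p > 0" and 0: "Lp_int p f = 0"
  shows "AE x in lborel. f x = 0"
proof -
  have "AE x in lborel. norm (f x) powr p = 0"
    using integral_nonneg_eq_0_iff_AE[OF Lp_spaceD(2)[OF f]] 0 by (simp add: Lp_int_def)
  then show ?thesis by eventually_elim simp
qed

lemma le_1_plus_powr: "0 \<le> (t::real) \<Longrightarrow> p \<ge> 1 \<Longrightarrow> t \<le> 1 + t powr p"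
  using powr_mono[of 1 p t] by (cases "t \<le> 1") (auto simp: add_increasing2)

text \<open>A substitute for Hoelder's inequality: |g| \<le> 1 + |g|^p, where the first term pairs
  with integrability of \<open>k\<close> and the second with its boundedness.\<close>

lemma Lp_mult_integrable:
  assumes p: "p \<ge> 1" and g: "g \<in> Lp_space p" and k: "decay_bounded k"
  shows "integrable lborel (\<lambda>x. g x * k x)"
proof -
  note [measurable] = Lp_spaceD(1)[OF g]
  have ik: "integrable lborel k" by (rule decay_bounded_integrable[OF k])
  then have [measurable]: "k \<in> borel_measurable borel" by auto
  obtain B where B: "\<And>x. norm (k x) \<le> B" using decay_bounded_bounded[OF k] by metis
  have int: "integrable lborel (\<lambda>x. norm (k x) + B * norm (g x) powr p)"
    using ik Lp_spaceD(2)[OF g] by auto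
  have "norm (g x * k x) \<le> norm (k x) + B * norm (g x) powr p" for x
  proof -
    have "norm (g x * k x) \<le> (1 + norm (g x) powr p) * norm (k x)"
      unfolding norm_mult using p by (intro mult_right_mono le_1_plus_powr) auto
    also have "\<dots> \<le> norm (k x) + B * norm (g x) powr p"
      using mult_right_mono[OF B[of x], of "norm (g x) powr p"] by (simp add: algebra_simps)
    finally show ?thesis .
  qed
  then have le: "AE x in lborel. norm (g x * k x) \<le> norm (norm (k x) + B * norm (g x) powr p)"
    by (intro AE_I2) (metis abs_ge_self order_trans real_norm_def)
  show ?thesis
    by (rule Bochner_Integration.integrable_bound[OF int _ le]) measurable
qed

lemma integrable_bounded_in_Lp:
  assumes p: "p \<ge> 1" and f: "integrable lborel f" and B: "\<And>x. norm (f x) \<le> B"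
  shows "f \<in> Lp_space p"
proof (rule Lp_space_bound(1))
  show "f \<in> borel_measurable borel" using f by auto
  show "integrable lborel (\<lambda>x. B powr (p - 1) * norm (f x))" using f by simp
  have "norm (f x) powr p \<le> B powr (p - 1) * norm (f x)" for x
  proof (cases "f x = 0")
    case False
    have "norm (f x) powr p = norm (f x) powr (p - 1) * norm (f x)"
      using False powr_mult_base[of "norm (f x)" "p - 1"] by (simp add: mult.commute)
    also have "\<dots> \<le> B powr (p - 1) * norm (f x)"
      using p B by (intro mult_right_mono powr_mono2) auto
    finally show ?thesis .
  qed auto
  then show "AE x in lborel. norm (f x) powr p \<le> B powr (p - 1) * norm (f x)" by simp
qed

lemma decay_bounded_in_Lp:
  assumes "p \<ge> 1" "decay_bounded f"
  shows "f \<in> Lp_space p"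
proof -
  obtain B where "\<And>x. norm (f x) \<le> B" using decay_bounded_bounded[OF assms(2)] by metis
  then show ?thesis by (rule integrable_bounded_in_Lp[OF assms(1) decay_bounded_integrable[OF assms(2)]])
qed

section \<open>Distributional Fourier transforms of L^p functions\<close>

lemma has_fourier_transform_inverse_fourier:
  fixes h :: "'a::euclidean_space \<Rightarrow> complex"
  assumes h: "integrable lborel h"
  shows "has_fourier_transform (inverse_fourier h) h"
  unfolding has_fourier_transform_def
proof (intro allI impI conjI)
  fix \<phi> :: "'a \<Rightarrow> complex" assume \<phi>: "schwartz \<phi>"
  note dec = schwartz_decaying[OF \<phi>, of "2 * DIM('a)"]
  have i\<phi>: "integrable lborel (fourier \<phi>)"
    by (rule decay_bounded_integrable[OF fourier_decay_bounded[OF dec]])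
  have [measurable]: "h \<in> borel_measurable borel" "fourier \<phi> \<in> borel_measurable borel"
    using h i\<phi> by auto
  have d0: "decay_bounded \<phi>" by (rule schwartz_decay_bounded[OF \<phi>])
  then have [measurable]: "\<phi> \<in> borel_measurable borel"
    by (auto simp: decay_bounded_def borel_measurable_continuous_onI)
  obtain B where B: "\<And>x. norm (\<phi> x) \<le> B" using decay_bounded_bounded[OF d0] by metis
  show "integrable lborel (\<lambda>\<xi>. h \<xi> * \<phi> \<xi>)"
    by (rule integrable_mult_bounded[OF h _ B]) measurable
  note [measurable] = measurable_inverse_fourier[OF h]
  have "integrable lborel (\<lambda>x. fourier \<phi> x * inverse_fourier h x)"
    by (rule integrable_mult_bounded[OF i\<phi> _ norm_inverse_fourier_le]) measurable
  then show "integrable lborel (\<lambda>x. inverse_fourier h x * fourier \<phi> x)"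
    by (simp add: mult.commute)
  let ?c = "inverse ((2 * pi) ^ DIM('a))"
  have int: "integrable (lborel \<Otimes>\<^sub>M lborel) (\<lambda>(\<xi>, x). h \<xi> * fourier \<phi> x * cis (\<xi> \<bullet> x))"
    using integrable_pair_mult[OF h i\<phi>, of "\<lambda>z. cis (fst z \<bullet> snd z)" 1] by simp
  \<comment> \<open>The multiplication formula: Fubini moves the exponential from \<open>h\<close>
    to the transform of the test function, where inversion applies.\<close>
  have "(LINT x|lborel. inverse_fourier h x * fourier \<phi> x)
      = ?c *\<^sub>R (LINT x|lborel. LINT \<xi>|lborel. h \<xi> * fourier \<phi> x * cis (\<xi> \<bullet> x))"
  proof -
    have "inverse_fourier h x * fourier \<phi> x = ?c *\<^sub>R (LINT \<xi>|lborel. h \<xi> * fourier \<phi> x * cis (\<xi> \<bullet> x))" for x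
    proof -
      have "inverse_fourier h x * fourier \<phi> x = ?c *\<^sub>R (LINT \<xi>|lborel. (h \<xi> * cis (\<xi> \<bullet> x)) * fourier \<phi> x)"
        by (simp add: inverse_fourier_def)
      then show ?thesis by (simp add: ac_simps)
    qed
    then show ?thesis by simp
  qed
  also have "\<dots> = ?c *\<^sub>R (LINT \<xi>|lborel. LINT x|lborel. h \<xi> * fourier \<phi> x * cis (\<xi> \<bullet> x))"
    by (subst lborel_pair.Fubini_integral[OF int]) simp
  also have "\<dots> = (LINT \<xi>|lborel. h \<xi> * inverse_fourier (fourier \<phi>) \<xi>)"
    by (simp add: inverse_fourier_def mult.assoc inner_commute)
  also have "\<dots> = (LINT \<xi>|lborel. h \<xi> * \<phi> \<xi>)"
    by (simp add: decaying_inversion(1)[OF dec])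
  finally show "(LINT x|lborel. inverse_fourier h x * fourier \<phi> x) = (LINT \<xi>|lborel. h \<xi> * \<phi> \<xi>)" .
qed

lemma has_fourier_transform_cong_AE:
  assumes g: "has_fourier_transform g h" and eq: "AE x in lborel. g' x = g x" and [measurable]: "g' \<in> borel_measurable borel"
    and [measurable]: "g \<in> borel_measurable borel"
  shows "has_fourier_transform g' h"
  unfolding has_fourier_transform_def
proof (intro allI impI)
  fix \<phi> :: "'a \<Rightarrow> complex" assume \<phi>: "schwartz \<phi>"
  have [measurable]: "fourier \<phi> \<in> borel_measurable borel"
    by (intro measurable_fourier decay_bounded_integrable schwartz_decay_bounded \<phi>)
  have "AE x in lborel. g' x * fourier \<phi> x = g x * fourier \<phi> x"
    using eq by eventually_elim simp
  then have "integrable lborel (\<lambda>x. g' x * fourier \<phi> x) \<longleftrightarrow> integrable lborel (\<lambda>x. g x * fourier \<phi> x)"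
    "(LINT x|lborel. g' x * fourier \<phi> x) = (LINT x|lborel. g x * fourier \<phi> x)"
    by (intro integrable_cong_AE integral_cong_AE; simp)+
  then show "integrable lborel (\<lambda>x. g' x * fourier \<phi> x) \<and>
      integrable lborel (\<lambda>\<xi>. h \<xi> * \<phi> \<xi>) \<and>
      (LINT x|lborel. g' x * fourier \<phi> x) = (LINT \<xi>|lborel. h \<xi> * \<phi> \<xi>)"
    using g \<phi> by (simp add: has_fourier_transform_def)
qed

lemma fourier_shifted_gauss:
  fixes y :: "'a::euclidean_space"
  shows "fourier (\<lambda>x. of_real (gauss (x - y))) \<xi>
    = of_real (sqrt (2 * pi) ^ DIM('a)) * (of_real (gauss \<xi>) * cis (- (\<xi> \<bullet> y)))"
proof -
  have "fourier (\<lambda>x. of_real (gauss (x - y))) \<xi>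
      = (LINT x|lborel. of_real (gauss x) * cis (- ((y + x) \<bullet> \<xi>)))"
    unfolding fourier_cis
    using integral_shift[of "\<lambda>x. of_real (gauss (x - y)) * cis (- (x \<bullet> \<xi>))" y] by simp
  also have "\<dots> = (LINT x|lborel. of_real (gauss x) * cis (- (x \<bullet> \<xi>)) * cis (- (\<xi> \<bullet> y)))"
  proof -
    have "cis (- ((y + x) \<bullet> \<xi>)) = cis (- (x \<bullet> \<xi>)) * cis (- (\<xi> \<bullet> y))" for x
      unfolding cis_mult by (simp add: inner_left_distrib inner_commute[of \<xi> y] algebra_simps)
    then show ?thesis by (simp add: mult.assoc)
  qed
  also have "\<dots> = fourier (\<lambda>x. of_real (gauss x)) \<xi> * cis (- (\<xi> \<bullet> y))"
    by (simp add: fourier_cis)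
  finally show ?thesis by (simp add: fourier_gauss)
qed

text \<open>The transform of a Gaussian centred at \<open>y\<close> is a centred Gaussian times a
  character. Testing with it therefore evaluates at \<open>y\<close> the transform of the difference
  times a Gaussian. That product is integrable, so injectivity on L^1 applies, and the Gaussian can
  be divided out.\<close>

theorem has_fourier_transform_unique:
  fixes g h :: "'a::euclidean_space \<Rightarrow> complex"
  assumes p: "p \<ge> 1" and g: "g \<in> Lp_space p" and h: "integrable lborel h" and gh: "has_fourier_transform g h"
  shows "AE x in lborel. g x = inverse_fourier h x"
proof -
  note hh = has_fourier_transform_inverse_fourier[OF h]
  note [measurable] = Lp_spaceD(1)[OF g] measurable_inverse_fourier[OF h]
  let ?d = "complex_of_real (sqrt (2 * pi) ^ DIM('a))"
  have ig: "integrable lborel (\<lambda>x. complex_of_real (gauss (x::'a)))"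
    by (rule integrable_gauss_complex)
  have db: "decay_bounded (\<lambda>x. complex_of_real (gauss (x::'a)))"
    using schwartz_decay_bounded[OF schwartz_gauss_poly[OF gauss_poly_const, of 0 1]] by simp
  let ?u = "\<lambda>x. (g x - inverse_fourier h x) * of_real (gauss x)"
  have i1: "integrable lborel (\<lambda>x. g x * of_real (gauss x))"
    by (rule Lp_mult_integrable[OF p g db])
  have "integrable lborel (\<lambda>x. of_real (gauss x) * inverse_fourier h x)"
    by (rule integrable_mult_bounded[OF ig _ norm_inverse_fourier_le]) measurable
  then have i2: "integrable lborel (\<lambda>x. inverse_fourier h x * of_real (gauss x))"
    by (simp add: mult.commute)
  have iu: "integrable lborel ?u"
    using Bochner_Integration.integrable_diff[OF i1 i2] by (simp add: left_diff_distrib)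
  have "fourier ?u y = 0" for y
  proof -
    let ?\<phi> = "\<lambda>x. complex_of_real (gauss (x - y))"
    have s: "schwartz ?\<phi>"
      using schwartz_gauss_poly[OF gauss_poly_const, of y 1] by simp
    have *: "integrable lborel (\<lambda>x. k x * fourier ?\<phi> x)"
      "(LINT x|lborel. k x * fourier ?\<phi> x) = (LINT \<xi>|lborel. h \<xi> * ?\<phi> \<xi>)"
      if "has_fourier_transform k h" for k
      using that s by (auto simp: has_fourier_transform_def)
    have "0 = (LINT x|lborel. g x * fourier ?\<phi> x - inverse_fourier h x * fourier ?\<phi> x)"
      using *[OF gh] *[OF hh] by simp
    also have "\<dots> = (LINT x|lborel. ?d * (?u x * cis (- (x \<bullet> y))))"
      unfolding fourier_shifted_gauss by (simp add: algebra_simps)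
    also have "\<dots> = ?d * fourier ?u y"
      by (simp add: fourier_cis)
    finally show ?thesis by simp
  qed
  then have "AE x in lborel. ?u x = 0"
    by (rule fourier_eq_0_imp_AE_0[OF iu])
  then show ?thesis
    by eventually_elim (simp add: less_imp_neq[OF gauss_pos, symmetric])
qed

section \<open>Density of Schwartz functions\<close>

lemma Lp_int_dominated_tendsto_0:
  fixes f :: "nat \<Rightarrow> 'a::euclidean_space \<Rightarrow> complex"
  assumes p: "p > 0" and f: "\<And>n. f n \<in> borel_measurable borel" and w: "integrable lborel w"
    and lim: "AE x in lborel. (\<lambda>n. f n x) \<longlonglongrightarrow> 0"
    and le: "\<And>n x. norm (f n x) powr p \<le> w x"
  shows "(\<lambda>n. Lp_int p (f n)) \<longlonglongrightarrow> 0"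
proof -
  note [measurable] = f
  have [measurable]: "w \<in> borel_measurable borel" using w by auto
  have "(\<lambda>n. LINT x|lborel. norm (f n x) powr p) \<longlonglongrightarrow> (LINT x|(lborel::'a measure). 0)"
  proof (rule integral_dominated_convergence[OF _ _ w])
    show "AE x in lborel. (\<lambda>n. norm (f n x) powr p) \<longlonglongrightarrow> 0"
      using lim by eventually_elim (use p in \<open>auto intro!: tendsto_zero_powrI tendsto_norm_zero\<close>)
  qed (use le in auto)
  then show ?thesis by (simp add: Lp_int_def)
qed

text \<open>On these arguments a linear functional is the Gaussian times an affine function of x.
  Products and sums then stay in the class.\<close>

lemma gauss_poly_real_polynomial:
  fixes P :: "'a::euclidean_space \<times> real \<Rightarrow> real"
  assumes "real_polynomial_function P"
  shows "gauss_poly 0 (\<lambda>x. of_real (P (gauss x *\<^sub>R x, gauss x)))"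
  using assms
proof induction
  case (linear L)
  interpret bounded_linear L by fact
  have eq: "L (gauss x *\<^sub>R x, gauss x) = gauss (x - 0) * ((\<Sum>b\<in>Basis. (x \<bullet> b) * L (b, 0)) + L (0, 1))" for x
  proof -
    have "(x, 0) = (\<Sum>b\<in>Basis. (x \<bullet> b) *\<^sub>R (b, 0::real))"
      by (auto simp: prod_eq_iff fst_sum snd_sum euclidean_representation)
    then have "L (x, 0) = (\<Sum>b\<in>Basis. (x \<bullet> b) * L (b, 0))"
      by (simp only: sum scaleR) simp
    moreover have "(gauss x *\<^sub>R x, gauss x) = gauss x *\<^sub>R ((x, 0) + (0, 1))" by simp
    ultimately show ?thesis by (simp only: scaleR add) simp
  qed
  show ?case
    unfolding eq of_real_mult of_real_add of_real_sum
    by (intro gauss_poly.intros gauss_poly_sum)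
next
  case (const c)
  show ?case by (rule gauss_poly.intros)
next
  case (add f g)
  then show ?case by (simp add: gauss_poly.intros)
next
  case (mult f g)
  then show ?case by (simp add: gauss_poly.intros)
qed

text \<open>Stone--Weierstrass on the image of \<open>x \<mapsto> (gauss x *\<^sub>R x, gauss x)\<close>, an injective map into a
  bounded set; \<open>\<kappa>\<close> cuts off the singularity of its inverse at the origin.\<close>

lemma gauss_poly_approx_real:
  fixes f :: "'a::euclidean_space \<Rightarrow> real"
  assumes f: "continuous_on UNIV f" and supp: "\<And>x. norm x \<ge> R \<Longrightarrow> f x = 0" and "R > 0" and e: "e > 0"
  shows "\<exists>P. gauss_poly 0 (\<lambda>x. of_real (P x)) \<and> (\<forall>x. \<bar>f x - gauss x * P x\<bar> \<le> e * gauss x)"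
proof -
  \<comment> \<open>The values of the Gaussian at radii R + 1 and R. Hence \<open>\<kappa>\<close>
    is 1 wherever \<open>f\<close> can be nonzero and has dropped to 0 by radius R + 1.\<close>
  define s0 s1 where "s0 = exp (- (R + 1)\<^sup>2 / 2)" and "s1 = exp (- R\<^sup>2 / 2)"
  have s: "0 < s0" "s0 < s1" using \<open>R > 0\<close> by (auto simp: s0_def s1_def power2_eq_square algebra_simps)
  define \<kappa> where "\<kappa> s = min 1 (max 0 ((s - s0) / (s1 - s0)))" for s
  define G :: "'a \<times> real \<Rightarrow> real"
    where "G z = f ((1 / max (snd z) s0) *\<^sub>R fst z) * \<kappa> (snd z) / max (snd z) s0" for z
  \<comment> \<open>This radius bounds the image: |x| \<open>gauss x\<close> is at most exp (1/2),
    and the last coordinate is at most 1.\<close>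
  let ?S = "cball (0 :: 'a \<times> real) (exp (1 / 2) + 1)"
  have "max t s0 \<noteq> 0" for t using s by auto
  then have "continuous_on ?S G"
    unfolding G_def \<kappa>_def using s
    by (intro continuous_intros continuous_on_compose2[OF f]) auto
  then obtain P where P: "real_polynomial_function P" "\<And>z. z \<in> ?S \<Longrightarrow> \<bar>G z - P z\<bar> < e"
    using Stone_Weierstrass_real_polynomial_function[OF compact_cball _ e] by metis
  have "\<bar>f x - gauss x * P (gauss x *\<^sub>R x, gauss x)\<bar> \<le> e * gauss x" for x
  proof -
    let ?z = "(gauss x *\<^sub>R x, gauss x)"
    have "norm ?z \<le> norm x * gauss x + 1"
      by (rule order_trans[OF norm_Pair_le]) (simp add: mult.commute)
    also have "\<dots> \<le> exp (1 / 2) + 1"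
      using power_mult_gauss_le[of x 1 0] by (simp add: algebra_simps) (smt (verit) gauss_pos)
    finally have z: "?z \<in> ?S" by simp
    \<comment> \<open>Approximating the quotient by the Gaussian, rather than \<open>f\<close>,
      turns a uniform error into an error proportional to the Gaussian, which is small in every
      L^p.\<close>
    have "G ?z = f x / gauss x"
    proof (cases "norm x \<ge> R")
      case True
      show ?thesis
      proof (cases "gauss x > s0")
        case True
        then have "max (gauss x) s0 = gauss x" by simp
        then show ?thesis using \<open>norm x \<ge> R\<close> supp by (simp add: G_def less_imp_neq[OF gauss_pos, symmetric])
      next
        case False
        then have "\<kappa> (gauss x) = 0" using s by (simp add: \<kappa>_def divide_nonpos_pos)
        then show ?thesis using \<open>norm x \<ge> R\<close> supp by (simp add: G_def)
      qed
    next
      case False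
      then have "(norm x)\<^sup>2 \<le> R\<^sup>2" by (intro power_mono) auto
      then have "s1 \<le> gauss x" by (simp add: s1_def gauss_def)
      then have "\<kappa> (gauss x) = 1" "max (gauss x) s0 = gauss x" using s by (auto simp: \<kappa>_def)
      then show ?thesis by (simp add: G_def less_imp_neq[OF gauss_pos, symmetric])
    qed
    then have "f x - gauss x * P ?z = gauss x * (G ?z - P ?z)"
      by (simp add: right_diff_distrib less_imp_neq[OF gauss_pos, symmetric])
    then have "\<bar>f x - gauss x * P ?z\<bar> = gauss x * \<bar>G ?z - P ?z\<bar>"
      by (simp add: abs_mult)
    also have "\<dots> \<le> gauss x * e" using P(2)[OF z] by (intro mult_left_mono) auto
    finally show ?thesis by (simp add: mult.commute)
  qed
  then show ?thesis
    using gauss_poly_real_polynomial[OF P(1)]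
    by (intro exI[of _ "\<lambda>x. P (gauss x *\<^sub>R x, gauss x)"]) simp
qed

lemma gauss_poly_approx:
  fixes f :: "'a::euclidean_space \<Rightarrow> complex"
  assumes f: "continuous_on UNIV f" and supp: "\<And>x. norm x \<ge> R \<Longrightarrow> f x = 0" and R: "R > 0" and e: "e > 0"
  shows "\<exists>g. gauss_poly 0 g \<and> (\<forall>x. norm (f x - of_real (gauss x) * g x) \<le> e * gauss x)"
proof -
  have e2: "e / 2 > 0" using e by simp
  obtain P where P: "gauss_poly 0 (\<lambda>x. complex_of_real (P x))" "\<And>x. \<bar>Re (f x) - gauss x * P x\<bar> \<le> e / 2 * gauss x"
    using gauss_poly_approx_real[of "\<lambda>x. Re (f x)", OF _ _ R e2] supp f by (auto intro: continuous_intros)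
  obtain Q where Q: "gauss_poly 0 (\<lambda>x. complex_of_real (Q x))" "\<And>x. \<bar>Im (f x) - gauss x * Q x\<bar> \<le> e / 2 * gauss x"
    using gauss_poly_approx_real[of "\<lambda>x. Im (f x)", OF _ _ R e2] supp f by (auto intro: continuous_intros)
  let ?g = "\<lambda>x. of_real (P x) + \<i> * of_real (Q x)"
  have "norm (f x - of_real (gauss x) * ?g x) \<le> e * gauss x" for x
  proof -
    have "norm (f x - of_real (gauss x) * ?g x) \<le> \<bar>Re (f x) - gauss x * P x\<bar> + \<bar>Im (f x) - gauss x * Q x\<bar>"
      by (rule order_trans[OF cmod_le]) simp
    then show ?thesis using P(2)[of x] Q(2)[of x] by simp
  qed
  moreover have "gauss_poly 0 ?g" by (intro gauss_poly.intros P Q)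
  ultimately show ?thesis by blast
qed

text \<open>Two exponents at once, because the approximation is later used with q = 1: convergence
  in L^p controls an operator, convergence in L^1 controls Fourier transforms uniformly.\<close>

definition Lp_near :: "real \<Rightarrow> real \<Rightarrow> real \<Rightarrow> ('a::euclidean_space \<Rightarrow> complex) \<Rightarrow> ('a \<Rightarrow> complex) \<Rightarrow> bool" where
  "Lp_near p q e u v \<longleftrightarrow> v \<in> Lp_space p \<and> v \<in> Lp_space q \<and>
     Lp_int p (\<lambda>x. u x - v x) < e \<and> Lp_int q (\<lambda>x. u x - v x) < e"

lemma Lp_near_trans:
  assumes pq: "p \<ge> 1" "q \<ge> 1" and u: "u \<in> Lp_space p" "u \<in> Lp_space q"
    and uv: "Lp_near p q d u v" and vw: "Lp_near p q d v w"
    and e: "2 powr p * (2 * d) \<le> e" "2 powr q * (2 * d) \<le> e"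
  shows "Lp_near p q e u w"
proof -
  have *: "Lp_int r (\<lambda>x. u x - w x) < e"
    if "r \<ge> 1" "u \<in> Lp_space r" "v \<in> Lp_space r" "w \<in> Lp_space r" "2 powr r * (2 * d) \<le> e"
      "Lp_int r (\<lambda>x. u x - v x) < d" "Lp_int r (\<lambda>x. v x - w x) < d" for r
  proof -
    have "Lp_int r (\<lambda>x. u x - w x) \<le> 2 powr r * (Lp_int r (\<lambda>x. u x - v x) + Lp_int r (\<lambda>x. v x - w x))"
      using that by (intro Lp_int_triangle3) auto
    also have "\<dots> < 2 powr r * (2 * d)" using that by (intro mult_strict_left_mono) auto
    finally show ?thesis using that by simp
  qed
  show ?thesis
    using assms *[of p] *[of q] by (simp add: Lp_near_def)
qed

lemma Lp_near_eventuallyI: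
  assumes "\<And>n. f n \<in> Lp_space p" "\<And>n. f n \<in> Lp_space q"
    and "(\<lambda>n. Lp_int p (\<lambda>x. u x - f n x)) \<longlonglongrightarrow> 0" "(\<lambda>n. Lp_int q (\<lambda>x. u x - f n x)) \<longlonglongrightarrow> 0" and "e > 0"
  shows "\<exists>n::nat. Lp_near p q e u (f n)"
proof -
  have "eventually (\<lambda>n. Lp_int p (\<lambda>x. u x - f n x) < e \<and> Lp_int q (\<lambda>x. u x - f n x) < e) sequentially"
    using order_tendstoD(2)[OF assms(3,5)] order_tendstoD(2)[OF assms(4,5)] by eventually_elim simp
  then obtain n where "Lp_int p (\<lambda>x. u x - f n x) < e \<and> Lp_int q (\<lambda>x. u x - f n x) < e"
    by (auto dest: eventually_happens)
  then show ?thesis using assms by (auto simp: Lp_near_def)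
qed

lemma Lp_near_truncate:
  fixes u :: "'a::euclidean_space \<Rightarrow> complex"
  assumes pq: "p \<ge> 1" "q \<ge> 1" and u: "u \<in> Lp_space p" "u \<in> Lp_space q" and e: "e > 0"
  shows "\<exists>v n. Lp_near p q e u v \<and> v \<in> borel_measurable borel \<and> (\<forall>x. norm (v x) \<le> real n) \<and>
     (\<forall>x. norm x > real n \<longrightarrow> v x = 0)"
proof -
  define v where "v n x = (if norm x \<le> real n \<and> norm (u x) \<le> real n then u x else 0)" for n x
  note [measurable] = Lp_spaceD(1)[OF u(1)]
  have v[measurable]: "v n \<in> borel_measurable borel" for n
    unfolding v_def by measurable
  have lim: "(\<lambda>n. u x - v n x) \<longlonglongrightarrow> 0" for x
  proof (rule tendsto_eventually)
    obtain N where N: "max (norm x) (norm (u x)) \<le> real N" using real_arch_simple by blast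
    show "eventually (\<lambda>n. u x - v n x = 0) sequentially"
      using eventually_ge_at_top[of N] by eventually_elim (use N in \<open>auto simp: v_def\<close>)
  qed
  have *: "v n \<in> Lp_space r" "(\<lambda>n. Lp_int r (\<lambda>x. u x - v n x)) \<longlonglongrightarrow> 0"
    if "r \<ge> 1" "u \<in> Lp_space r" for r n
  proof -
    show "v n \<in> Lp_space r"
      by (rule Lp_space_bound(1)[OF v Lp_spaceD(2)[OF that(2)]]) (auto simp: v_def)
    show "(\<lambda>n. Lp_int r (\<lambda>x. u x - v n x)) \<longlonglongrightarrow> 0"
      by (rule Lp_int_dominated_tendsto_0[OF _ _ Lp_spaceD(2)[OF that(2)]])
         (use that lim in \<open>auto simp: v_def\<close>)
  qed
  obtain n where "Lp_near p q e u (v n)"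
    using Lp_near_eventuallyI[of v, OF _ _ *(2) *(2) e] * pq u by blast
  then show ?thesis using v by (intro exI[of _ "v n"] exI[of _ n]) (auto simp: v_def)
qed

lemma Lp_near_continuous:
  fixes v :: "'a::euclidean_space \<Rightarrow> complex"
  assumes pq: "p \<ge> 1" "q \<ge> 1" and [measurable]: "v \<in> borel_measurable borel" and B: "\<And>x. norm (v x) \<le> B" "B > 0"
    and supp: "\<And>x. norm x > R \<Longrightarrow> v x = 0" and e: "e > 0"
  shows "\<exists>f. Lp_near p q e v f \<and> continuous_on UNIV f \<and> (\<forall>x. norm x \<ge> R + 1 \<longrightarrow> f x = 0)"
proof -
  obtain g where g: "\<And>n::nat. continuous_on UNIV (g n)" "\<And>n x. norm (g n x) \<le> B"
    and lim: "AE x in lborel. (\<lambda>n. g n x) \<longlonglongrightarrow> v x"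
    by (rule continuous_approx_bounded[of v B]) (auto intro: B)
  \<comment> \<open>A continuous cutoff, equal to 1 on the ball of radius R that carries
    \<open>v\<close> and to 0 beyond radius R + 1. All approximants then live in one ball, on which
    constants are integrable majorants.\<close>
  define ch where "ch x = max 0 (min 1 (R + 1 - norm x))" for x :: 'a
  define f where "f n x = complex_of_real (ch x) * g n x" for n x
  have c: "continuous_on UNIV (f n)" for n
    unfolding f_def ch_def by (intro continuous_intros g)
  then have [measurable]: "f n \<in> borel_measurable borel" for n by (rule borel_measurable_continuous_onI)
  have fB: "norm (f n x) \<le> B * indicator (cball 0 (R + 1)) x" for n x
  proof -
    have "ch x * norm (g n x) \<le> 1 * B" using g(2)[of n x] B(2) by (intro mult_mono) (auto simp: ch_def)
    then show ?thesis by (auto simp: f_def norm_mult indicator_def) (auto simp: ch_def)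
  qed
  have vB: "norm (v x) \<le> B * indicator (cball 0 (R + 1)) x" for x
    using B(1)[of x] supp[of x] B(2) by (auto simp: indicator_def)
  have flim: "AE x in lborel. (\<lambda>n. v x - f n x) \<longlonglongrightarrow> 0"
    using lim
  proof eventually_elim
    fix x assume "(\<lambda>n. g n x) \<longlonglongrightarrow> v x"
    then have "(\<lambda>n. v x - f n x) \<longlonglongrightarrow> v x - complex_of_real (ch x) * v x"
      unfolding f_def by (intro tendsto_intros)
    moreover have "complex_of_real (ch x) * v x = v x"
      using supp[of x] by (cases "norm x > R") (auto simp: ch_def)
    ultimately show "(\<lambda>n. v x - f n x) \<longlonglongrightarrow> 0" by simp
  qed
  have *: "f n \<in> Lp_space r" "(\<lambda>n. Lp_int r (\<lambda>x. v x - f n x)) \<longlonglongrightarrow> 0" if r: "r \<ge> 1" for r n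
  proof -
    have i: "integrable lborel (\<lambda>x::'a. D powr r * indicator (cball 0 (R + 1)) x)" for D
      using emeasure_bounded_finite[OF bounded_cball] by (intro integrable_mult_right integrable_real_indicator) auto
    have le: "norm z powr r \<le> D powr r * indicator (cball 0 (R + 1)) x"
      if "norm z \<le> D * indicator (cball 0 (R + 1)) x" for z D and x :: 'a
      using that r by (auto simp: indicator_def intro: powr_mono2)
    show "f n \<in> Lp_space r"
      by (rule Lp_space_bound(1)[OF _ i[of B]]) (auto intro!: AE_I2 le fB)
    have d: "norm (v x - f n x) \<le> (2 * B) * indicator (cball 0 (R + 1)) x" for n x
      using norm_triangle_ineq4[of "v x" "f n x"] fB[of n x] vB[of x] by simp
    show "(\<lambda>n. Lp_int r (\<lambda>x. v x - f n x)) \<longlonglongrightarrow> 0"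
      by (rule Lp_int_dominated_tendsto_0[OF _ _ i[of "2 * B"] flim]) (use r in \<open>auto intro!: le d\<close>)
  qed
  obtain n where "Lp_near p q e v (f n)"
    using Lp_near_eventuallyI[of f, OF _ _ *(2) *(2) e] * pq by blast
  moreover have "f n x = 0" if "norm x \<ge> R + 1" for x
    using that by (simp add: f_def ch_def)
  ultimately show ?thesis using c by blast
qed

lemma gauss_mult_poly_in_Lp:
  assumes "p \<ge> 1" "gauss_poly 0 g"
  shows "(\<lambda>x. of_real (gauss x) * g x) \<in> Lp_space p"
  using schwartz_decay_bounded[OF schwartz_gauss_poly[OF assms(2)]] assms(1)
  by (intro decay_bounded_in_Lp) simp_all

text \<open>The errors are at most \<open>gauss\<close> / (n + 1). Since \<open>gauss\<close> is at
  most 1, so that its r-th power is at most \<open>gauss\<close>, one majorant serves both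
  exponents.\<close>

lemma Lp_near_gauss_poly_continuous:
  fixes f :: "'a::euclidean_space \<Rightarrow> complex"
  assumes pq: "p \<ge> 1" "q \<ge> 1" and f: "continuous_on UNIV f" and supp: "\<And>x. norm x \<ge> R \<Longrightarrow> f x = 0" and R: "R > 0"
    and e: "e > 0"
  shows "\<exists>g. gauss_poly 0 g \<and> Lp_near p q e f (\<lambda>x. of_real (gauss x) * g x)"
proof -
  have "\<exists>g. gauss_poly 0 g \<and> (\<forall>x. norm (f x - of_real (gauss x) * g x) \<le> 1 / real (Suc n) * gauss x)" for n
    by (rule gauss_poly_approx[OF f supp R]) auto
  then obtain g where g: "\<And>n. gauss_poly 0 (g n)"
    "\<And>n x. norm (f x - of_real (gauss x) * g n x) \<le> 1 / real (Suc n) * gauss x"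
    by metis
  let ?s = "\<lambda>n x. of_real (gauss x) * g n x"
  have [measurable]: "f \<in> borel_measurable borel" using f by (rule borel_measurable_continuous_onI)
  have [measurable]: "?s n \<in> borel_measurable borel" for n
    by (rule Lp_spaceD(1)[OF gauss_mult_poly_in_Lp[OF pq(1) g(1)]])
  have "(\<lambda>n. f x - ?s n x) \<longlonglongrightarrow> 0" for x
  proof (rule Lim_null_comparison)
    have "(\<lambda>n. 1 / real (Suc n) * gauss x) \<longlonglongrightarrow> 0 * gauss x"
      by (intro tendsto_intros LIMSEQ_Suc[OF lim_const_over_n[of 1]])
    then show "(\<lambda>n. 1 / real (Suc n) * gauss x) \<longlonglongrightarrow> 0" by simp
  qed (use g(2) in auto)
  then have lim: "AE x in lborel. (\<lambda>n. f x - ?s n x) \<longlonglongrightarrow> 0" by simp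
  have *: "(\<lambda>n. Lp_int r (\<lambda>x. f x - ?s n x)) \<longlonglongrightarrow> 0" if r: "r \<ge> 1" for r
  proof (rule Lp_int_dominated_tendsto_0[OF _ _ integrable_gauss lim])
    fix n x
    have "norm (f x - ?s n x) \<le> 1 * gauss x"
      by (rule order_trans[OF g(2)]) (intro mult_right_mono; simp)
    then have "norm (f x - ?s n x) powr r \<le> gauss x powr r"
      using r by (intro powr_mono2) auto
    also have "\<dots> \<le> gauss x powr 1"
      using r by (intro powr_mono') auto
    finally show "norm (f x - ?s n x) powr r \<le> gauss x" by simp
  qed (use r in auto)
  obtain n where "Lp_near p q e f (?s n)"
    using Lp_near_eventuallyI[of ?s p q f e] * pq gauss_mult_poly_in_Lp[OF pq(1) g(1)]
      gauss_mult_poly_in_Lp[OF pq(2) g(1)] e by blast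
  then show ?thesis using g(1) by blast
qed

theorem gauss_poly_dense:
  fixes u :: "'a::euclidean_space \<Rightarrow> complex"
  assumes pq: "p \<ge> 1" "q \<ge> 1" and u: "u \<in> Lp_space p" "u \<in> Lp_space q" and e: "e > 0"
  shows "\<exists>g. gauss_poly 0 g \<and> Lp_near p q e u (\<lambda>x. of_real (gauss x) * g x)"
proof -
  \<comment> \<open>\<open>M\<close> exceeds the loss 2 * 2^r of the triangle inequality for r = p
    and for r = q. The inequality is used twice, hence the two divisions by
    \<open>M\<close>.\<close>
  define M where "M = 2 * (2 powr p + 2 powr q)"
  define d where "d = e / M"
  define c where "c = d / M"
  have M: "M > 0" by (simp add: M_def add_pos_pos)
  have d: "d > 0" "c > 0" "M * d = e" "M * c = d" using e M by (auto simp: d_def c_def)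
  have de: "2 powr r * (2 * d) \<le> e" "2 powr r * (2 * c) \<le> d" if "r \<in> {p, q}" for r
  proof -
    have "2 powr r * 2 \<le> M" using that by (auto simp: M_def)
    from mult_right_mono[OF this, of d] mult_right_mono[OF this, of c] d
    show "2 powr r * (2 * d) \<le> e" "2 powr r * (2 * c) \<le> d" by auto
  qed
  obtain v n where uv: "Lp_near p q d u v" and v: "v \<in> borel_measurable borel" "\<And>x. norm (v x) \<le> real n"
    "\<And>x. norm x > real n \<Longrightarrow> v x = 0"
    using Lp_near_truncate[OF pq u d(1)] by blast
  have vL: "v \<in> Lp_space p" "v \<in> Lp_space q" using uv by (auto simp: Lp_near_def)
  have n: "real n + 1 > 0" "norm (v x) \<le> real n + 1" for x using v(2)[of x] by linarith+
  obtain f where vf: "Lp_near p q c v f" and f: "continuous_on UNIV f" "\<And>x. norm x \<ge> real n + 1 \<Longrightarrow> f x = 0"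
    using Lp_near_continuous[OF pq v(1) n(2,1) v(3) d(2)] by blast
  obtain g where g: "gauss_poly 0 g" and fg: "Lp_near p q c f (\<lambda>x. of_real (gauss x) * g x)"
    using Lp_near_gauss_poly_continuous[OF pq f n(1) d(2)] by blast
  have "Lp_near p q d v (\<lambda>x. of_real (gauss x) * g x)"
    by (rule Lp_near_trans[OF pq vL vf fg]) (auto intro: de)
  then have "Lp_near p q e u (\<lambda>x. of_real (gauss x) * g x)"
    by (rule Lp_near_trans[OF pq u uv]) (auto intro: de)
  then show ?thesis using g by blast
qed

section \<open>Bounded operators on \<open>L\<^sup>p\<close>\<close>

lemma Lp_int_fatou:
  fixes f :: "nat \<Rightarrow> 'a::euclidean_space \<Rightarrow> complex"
  assumes p: "p > 0" and f: "\<And>n. f n \<in> Lp_space p" and g[measurable]: "g \<in> borel_measurable borel"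
    and lim: "AE x in lborel. (\<lambda>n. f n x) \<longlonglongrightarrow> g x"
    and le: "eventually (\<lambda>n. Lp_int p (f n) \<le> C) sequentially"
  shows "g \<in> Lp_space p" "Lp_int p g \<le> C"
proof -
  note [measurable] = Lp_spaceD(1)[OF f]
  obtain n where "Lp_int p (f n) \<le> C" using eventually_happens[OF le] by auto
  then have C: "0 \<le> C" using Lp_int_nonneg order_trans by blast
  have "(\<integral>\<^sup>+x. ennreal (norm (g x) powr p) \<partial>lborel) = (\<integral>\<^sup>+x. liminf (\<lambda>n. ennreal (norm (f n x) powr p)) \<partial>lborel)"
    using lim
  proof (intro nn_integral_cong_AE, eventually_elim)
    fix x assume "(\<lambda>n. f n x) \<longlonglongrightarrow> g x"
    then have "(\<lambda>n. norm (f n x) powr p) \<longlonglongrightarrow> norm (g x) powr p"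
      using p by (intro tendsto_powr' tendsto_norm tendsto_const) auto
    then have "(\<lambda>n. ennreal (norm (f n x) powr p)) \<longlonglongrightarrow> ennreal (norm (g x) powr p)"
      by (rule tendsto_ennrealI)
    then show "ennreal (norm (g x) powr p) = liminf (\<lambda>n. ennreal (norm (f n x) powr p))"
      by (intro lim_imp_Liminf[symmetric]) auto
  qed
  also have "\<dots> \<le> liminf (\<lambda>n. \<integral>\<^sup>+x. ennreal (norm (f n x) powr p) \<partial>lborel)"
    by (rule nn_integral_liminf) measurable
  also have "\<dots> = liminf (\<lambda>n. ennreal (Lp_int p (f n)))"
    using Lp_spaceD(2)[OF f] by (simp add: Lp_int_def nn_integral_eq_integral)
  also have "\<dots> \<le> liminf (\<lambda>n::nat. ennreal C)"
    using le by (intro Liminf_mono) (auto elim!: eventually_mono intro: ennreal_leI)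
  also have "\<dots> = ennreal C" by (simp add: Liminf_const)
  finally have nn: "(\<integral>\<^sup>+x. ennreal (norm (g x) powr p) \<partial>lborel) \<le> ennreal C" .
  then have "(\<integral>\<^sup>+x. ennreal (norm (g x) powr p) \<partial>lborel) < \<infinity>"
    using ennreal_less_top le_less_trans by fastforce
  then have i: "integrable lborel (\<lambda>x. norm (g x) powr p)"
    by (intro integrableI_bounded) auto
  then show "g \<in> Lp_space p" by (simp add: Lp_space_def)
  show "Lp_int p g \<le> C"
    using nn C i by (simp add: Lp_int_def nn_integral_eq_integral)
qed

text \<open>The terms of a convergent series are eventually below 1, so the increments are
  eventually below (1/2)^k and the telescoping series converges.\<close>

lemma LIMSEQ_of_fast_differences:
  fixes a :: "nat \<Rightarrow> complex"
  assumes p: "p > 0" and s: "summable (\<lambda>k. (2 ^ k * norm (a (Suc k) - a k)) powr p)"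
  shows "convergent a"
proof -
  have "(\<lambda>k. (2 ^ k * norm (a (Suc k) - a k)) powr p) \<longlonglongrightarrow> 0"
    by (rule summable_LIMSEQ_zero[OF s])
  then have "eventually (\<lambda>k. (2 ^ k * norm (a (Suc k) - a k)) powr p < 1) sequentially"
    by (rule order_tendstoD) simp
  then have ev: "eventually (\<lambda>k. norm (a (Suc k) - a k) \<le> (1 / 2) ^ k) sequentially"
  proof eventually_elim
    fix k assume "(2 ^ k * norm (a (Suc k) - a k)) powr p < 1"
    then have "2 ^ k * norm (a (Suc k) - a k) < 1"
      using p powr_mono2[of p 1 "2 ^ k * norm (a (Suc k) - a k)"] by (force simp: not_less[symmetric])
    then show "norm (a (Suc k) - a k) \<le> (1 / 2) ^ k" by (simp add: field_simps power_divide)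
  qed
  have "summable (\<lambda>k. a (Suc k) - a k)"
    by (rule summable_comparison_test_ev[OF ev]) simp
  then have "convergent (\<lambda>n. (\<Sum>k<n. a (Suc k) - a k))"
    by (simp add: summable_iff_convergent)
  then have "convergent (\<lambda>n. (a n - a 0) + a 0)"
    by (intro convergent_add convergent_const) (simp add: sum_lessThan_telescope)
  then show ?thesis by simp
qed

text \<open>The Riesz-Fischer argument: a rapidly Cauchy subsequence converges almost everywhere,
  and Fatou's lemma shows that its pointwise limit is the limit in L^p.\<close>

theorem Lp_complete:
  fixes f :: "nat \<Rightarrow> 'a::euclidean_space \<Rightarrow> complex"
  assumes p: "p \<ge> 1" and f: "\<And>n. f n \<in> Lp_space p"
    and cauchy: "\<And>e. e > 0 \<Longrightarrow> \<exists>N. \<forall>m\<ge>N. \<forall>n\<ge>N. Lp_int p (\<lambda>x. f m x - f n x) < e"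
  shows "\<exists>g\<in>Lp_space p. (\<lambda>n. Lp_int p (\<lambda>x. f n x - g x)) \<longlonglongrightarrow> 0"
proof -
  note [measurable] = Lp_spaceD(1)[OF f]
  \<comment> \<open>One factor (2^p)^k absorbs the weight 2^k inside the p-th power; the remaining
    2^k leaves a convergent geometric series.\<close>
  define c where "c k = (2 * 2 powr p) ^ k" for k :: nat
  have c: "c k > 0" for k by (simp add: c_def)
  have "\<exists>N. \<forall>m\<ge>N. \<forall>n\<ge>N. Lp_int p (\<lambda>x. f m x - f n x) < 1 / c k" for k
    using c by (intro cauchy) simp
  then obtain N where N: "\<And>k m n. m \<ge> N k \<Longrightarrow> n \<ge> N k \<Longrightarrow> Lp_int p (\<lambda>x. f m x - f n x) < 1 / c k"
    by metis
  \<comment> \<open>The maximum puts both \<open>r k\<close> and \<open>r (Suc k)\<close> beyond the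
    threshold \<open>N k\<close>, and the summand \<open>k\<close> makes the indices tend to
    infinity.\<close>
  define r where "r k = k + Max (N ` {..k})" for k
  have rN: "N k \<le> r k" "N k \<le> r (Suc k)" "k \<le> r k" for k
  proof -
    have "N k \<le> Max (N ` {..j})" if "k \<le> j" for j using that by (intro Max_ge) auto
    then show "N k \<le> r k" "N k \<le> r (Suc k)" "k \<le> r k"
      unfolding r_def by (metis le_refl trans_le_add2, metis le_SucI le_refl trans_le_add2, simp)
  qed
  let ?d = "\<lambda>k x. (2 ^ k * norm (f (r (Suc k)) x - f (r k) x)) powr p"
  have d_int: "(\<integral>\<^sup>+x. ennreal (?d k x) \<partial>lborel) \<le> ennreal ((1 / 2) ^ k)" for k
  proof -
    have eq: "?d k x = (2 powr p) ^ k * norm (f (r (Suc k)) x - f (r k) x) powr p" for x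
      by (simp add: powr_mult powr_power flip: powr_realpow) (simp add: powr_powr mult.commute)
    have i: "integrable lborel (?d k)"
      unfolding eq using Lp_spaceD(2)[OF Lp_space_diff[OF _ f f]] p by simp
    have "(LINT x|lborel. ?d k x) = (2 powr p) ^ k * Lp_int p (\<lambda>x. f (r (Suc k)) x - f (r k) x)"
      unfolding eq by (simp add: Lp_int_def)
    also have "\<dots> \<le> (2 powr p) ^ k * (1 / c k)"
      using N[OF rN(2,1)] by (intro mult_left_mono) (auto intro: less_imp_le)
    also have "\<dots> = (1 / 2) ^ k" by (simp add: c_def power_mult_distrib power_divide)
    finally show ?thesis
      using i by (simp add: nn_integral_eq_integral ennreal_leI)
  qed
  have "(\<integral>\<^sup>+x. (\<Sum>k. ennreal (?d k x)) \<partial>lborel) = (\<Sum>k. \<integral>\<^sup>+x. ennreal (?d k x) \<partial>lborel)"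
    by (rule nn_integral_suminf) measurable
  also have "\<dots> \<le> (\<Sum>k. ennreal ((1 / 2) ^ k))"
    by (intro suminf_le d_int) auto
  also have "\<dots> = ennreal (\<Sum>k. (1 / 2) ^ k)"
    by (rule suminf_ennreal2) (auto intro: summable_geometric)
  also have "\<dots> < \<infinity>"
    unfolding infinity_ennreal_def by (rule ennreal_less_top)
  finally have "AE x in lborel. (\<Sum>k. ennreal (?d k x)) \<noteq> \<infinity>"
    by (intro nn_integral_noteq_infinite) auto
  then have lim: "AE x in lborel. (\<lambda>k. f (r k) x) \<longlonglongrightarrow> lim (\<lambda>k. f (r k) x)"
  proof eventually_elim
    fix x assume "(\<Sum>k. ennreal (?d k x)) \<noteq> \<infinity>"
    then have "summable (\<lambda>k. ?d k x)" by (intro summable_suminf_not_top) auto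
    then have "convergent (\<lambda>k. f (r k) x)" using p by (intro LIMSEQ_of_fast_differences[of p]) auto
    then show "(\<lambda>k. f (r k) x) \<longlonglongrightarrow> lim (\<lambda>k. f (r k) x)" by (simp add: convergent_LIMSEQ_iff)
  qed
  define g where "g x = lim (\<lambda>k. f (r k) x)" for x
  have g[measurable]: "g \<in> borel_measurable borel"
    unfolding g_def by (rule borel_measurable_lim_metric) measurable
  \<comment> \<open>Fatou's lemma along the subsequence carries a Cauchy bound over to the
    limit.\<close>
  have *: "(\<lambda>x. f n x - g x) \<in> Lp_space p \<and> Lp_int p (\<lambda>x. f n x - g x) \<le> e"
    if e: "\<And>m. m \<ge> M \<Longrightarrow> Lp_int p (\<lambda>x. f n x - f m x) \<le> e" for n e M
  proof -
    have 1: "(\<lambda>x. f n x - f (r k) x) \<in> Lp_space p" for k using p by (intro Lp_space_diff f) auto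
    have 2: "AE x in lborel. (\<lambda>k. f n x - f (r k) x) \<longlonglongrightarrow> f n x - g x"
      using lim by eventually_elim (auto simp: g_def intro: tendsto_intros)
    have 3: "eventually (\<lambda>k. Lp_int p (\<lambda>x. f n x - f (r k) x) \<le> e) sequentially"
      using eventually_ge_at_top[of M] by eventually_elim (use rN(3) e order_trans in blast)
    show ?thesis
      using Lp_int_fatou[OF _ 1 _ 2 3] p by simp
  qed
  have "(\<lambda>n. Lp_int p (\<lambda>x. f n x - g x)) \<longlonglongrightarrow> 0"
  proof (rule LIMSEQ_I)
    fix e :: real assume e: "e > 0"
    obtain M where M: "\<And>m n. m \<ge> M \<Longrightarrow> n \<ge> M \<Longrightarrow> Lp_int p (\<lambda>x. f m x - f n x) < e / 2"
      using cauchy[of "e / 2"] e by auto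
    have "norm (Lp_int p (\<lambda>x. f n x - g x) - 0) < e" if "n \<ge> M" for n
      using *[of M n "e / 2"] M[OF that] e by (auto simp: less_imp_le)
    then show "\<exists>M. \<forall>n\<ge>M. norm (Lp_int p (\<lambda>x. f n x - g x) - 0) < e" by blast
  qed
  moreover have "g \<in> Lp_space p"
  proof -
    obtain M where M: "\<And>m n. m \<ge> M \<Longrightarrow> n \<ge> M \<Longrightarrow> Lp_int p (\<lambda>x. f m x - f n x) < 1"
      using cauchy[of 1] by auto
    have "(\<lambda>x. f M x - g x) \<in> Lp_space p"
      using *[of M M 1] M[of M] by (auto simp: less_imp_le)
    from Lp_space_diff[OF _ f[of M] this] show ?thesis using p by simp
  qed
  ultimately show ?thesis by blast
qed

lemma bounded_Lp_operatorI:
  assumes p: "p \<ge> 1" and "\<And>f. f \<in> Lp_space p \<Longrightarrow> T f \<in> Lp_space p"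
    and "\<And>f g. f \<in> Lp_space p \<Longrightarrow> g \<in> Lp_space p \<Longrightarrow> AE x in lborel. T (\<lambda>y. f y + g y) x = T f x + T g x"
    and "\<And>c f. f \<in> Lp_space p \<Longrightarrow> AE x in lborel. T (\<lambda>y. c * f y) x = c * T f x"
    and K: "\<And>f. f \<in> Lp_space p \<Longrightarrow> Lp_int p (T f) \<le> K * Lp_int p f" "K \<ge> 0"
  shows "bounded_Lp_operator p T"
  unfolding bounded_Lp_operator_def
  using assms Lp_norm_le_of_int_le[OF p K(1,2)] by blast

lemma
  assumes "bounded_Lp_operator p T"
  shows bounded_Lp_operator_space: "f \<in> Lp_space p \<Longrightarrow> T f \<in> Lp_space p"
    and bounded_Lp_operator_add: "f \<in> Lp_space p \<Longrightarrow> g \<in> Lp_space p \<Longrightarrow>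
      AE x in lborel. T (\<lambda>y. f y + g y) x = T f x + T g x"
    and bounded_Lp_operator_cmult: "f \<in> Lp_space p \<Longrightarrow> AE x in lborel. T (\<lambda>y. c * f y) x = c * T f x"
  using assms unfolding bounded_Lp_operator_def by blast+

lemma bounded_Lp_operator_int_bound:
  assumes "p \<ge> 1" "bounded_Lp_operator p T"
  obtains K where "K \<ge> 0" "\<And>f. f \<in> Lp_space p \<Longrightarrow> Lp_int p (T f) \<le> K * Lp_int p f"
proof -
  obtain C where "\<And>f. f \<in> Lp_space p \<Longrightarrow> Lp_norm p (T f) \<le> C * Lp_norm p f"
    using assms(2) unfolding bounded_Lp_operator_def by blast
  then show ?thesis
    by (intro that[of "(max C 0) powr p"] Lp_int_le_of_norm_le[OF assms(1)]) auto
qed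

lemma bounded_Lp_operator_diff:
  assumes T: "bounded_Lp_operator p T" and p: "p \<ge> 1" and f: "f \<in> Lp_space p" and g: "g \<in> Lp_space p"
  shows "AE x in lborel. T (\<lambda>y. f y - g y) x = T f x - T g x"
  using bounded_Lp_operator_add[OF T f Lp_space_cmult[OF g, of "-1"]]
    bounded_Lp_operator_cmult[OF T g, of "-1"]
  by eventually_elim simp

text \<open>The difference of the inputs has vanishing \<open>Lp_int\<close>, hence so does its
  image. This legitimises exchanging representatives inside an operator.\<close>

lemma bounded_Lp_operator_cong_AE:
  assumes T: "bounded_Lp_operator p T" and p: "p \<ge> 1" and f: "f \<in> Lp_space p" and g: "g \<in> Lp_space p"
    and eq: "AE x in lborel. f x = g x"
  shows "AE x in lborel. T f x = T g x"
proof -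
  obtain K where K: "K \<ge> 0" "\<And>f. f \<in> Lp_space p \<Longrightarrow> Lp_int p (T f) \<le> K * Lp_int p f"
    using bounded_Lp_operator_int_bound[OF p T] by metis
  have d: "(\<lambda>x. f x - g x) \<in> Lp_space p" using p f g by (intro Lp_space_diff) auto
  have "Lp_int p (\<lambda>x. f x - g x) = Lp_int p (\<lambda>x. 0 * f x)"
    using eq Lp_spaceD(1)[OF d]
    by (intro Lp_int_cong_AE[OF Lp_space_cmult[OF f]]) (auto elim!: eventually_mono)
  also have "\<dots> = 0" by (simp add: Lp_int_def)
  finally have "Lp_int p (T (\<lambda>x. f x - g x)) = 0"
    using K(2)[OF d] by (intro antisym) auto
  then have "AE x in lborel. T (\<lambda>x. f x - g x) x = 0"
    using p by (intro Lp_int_eq_0_imp_AE[OF bounded_Lp_operator_space[OF T d]]) auto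
  then show ?thesis
    using bounded_Lp_operator_diff[OF T p f g] by eventually_elim simp
qed

lemma le_add_epsilon_mult:
  fixes a b c :: real
  assumes "\<And>e. e > 0 \<Longrightarrow> a \<le> b + e * c"
  shows "a \<le> b"
proof (rule field_le_epsilon)
  fix e :: real assume e: "e > 0"
  have "a \<le> b + e / (\<bar>c\<bar> + 1) * c" using e by (intro assms) (simp add: add_nonneg_pos)
  also have "e / (\<bar>c\<bar> + 1) * c \<le> e"
  proof -
    have "e * c \<le> e * (\<bar>c\<bar> + 1)" using e by (intro mult_left_mono) auto
    then show ?thesis by (simp add: field_simps add_nonneg_pos)
  qed
  finally show "a \<le> b + e" by simp
qed

text \<open>\<open>R\<close> is the closure in L^p of the graph of \<open>T\<close> on
  \<open>D\<close>. Completeness gives it full domain, the bound makes it single-valued up to null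
  sets, and \<open>S\<close> chooses a representative; linearity accordingly holds almost
  everywhere.\<close>

theorem Lp_operator_extension:
  fixes T :: "('a::euclidean_space \<Rightarrow> complex) \<Rightarrow> 'a \<Rightarrow> complex"
  assumes p: "p \<ge> 1" and D: "D \<subseteq> Lp_space p"
    and D_add: "\<And>f g. f \<in> D \<Longrightarrow> g \<in> D \<Longrightarrow> (\<lambda>x. f x + g x) \<in> D"
    and D_cmult: "\<And>c f. f \<in> D \<Longrightarrow> (\<lambda>x. c * f x) \<in> D"
    and dense: "\<And>u e. u \<in> Lp_space p \<Longrightarrow> e > 0 \<Longrightarrow> \<exists>s\<in>D. Lp_int p (\<lambda>x. u x - s x) < e"
    and T: "\<And>f. f \<in> D \<Longrightarrow> T f \<in> Lp_space p"
    and T_add: "\<And>f g x. f \<in> D \<Longrightarrow> g \<in> D \<Longrightarrow> T (\<lambda>x. f x + g x) x = T f x + T g x"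
    and T_cmult: "\<And>c f x. f \<in> D \<Longrightarrow> T (\<lambda>x. c * f x) x = c * T f x"
    and K: "\<And>f. f \<in> D \<Longrightarrow> Lp_int p (T f) \<le> K * Lp_int p f" "K \<ge> 0"
  shows "\<exists>S. bounded_Lp_operator p S \<and> (\<forall>f\<in>D. AE x in lborel. S f x = T f x)"
proof -
  have p0: "p \<ge> 0" using p by simp
  define R where "R f g \<longleftrightarrow> g \<in> Lp_space p \<and>
    (\<forall>e>0. \<exists>s\<in>D. Lp_int p (\<lambda>x. f x - s x) < e \<and> Lp_int p (\<lambda>x. g x - T s x) < e)" for f g
  have DL: "s \<in> D \<Longrightarrow> s \<in> Lp_space p" for s using D by blast
  have T_diff: "(\<lambda>x. T f x - T g x) = T (\<lambda>x. f x - g x)" "(\<lambda>x. f x - g x) \<in> D"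
    if "f \<in> D" "g \<in> D" for f g
  proof -
    have "T (\<lambda>x. f x + - 1 * g x) x = T f x - T g x" for x
      using T_add[OF that(1) D_cmult[OF that(2), of "-1"]] T_cmult[OF that(2), of "-1"] by simp
    then show "(\<lambda>x. T f x - T g x) = T (\<lambda>x. f x - g x)" by (simp add: fun_eq_iff)
    show "(\<lambda>x. f x - g x) \<in> D" using D_add[OF that(1) D_cmult[OF that(2), of "-1"]] by simp
  qed
  have ex: "\<exists>g. R f g" if f: "f \<in> Lp_space p" for f
  proof -
    have "\<exists>s\<in>D. Lp_int p (\<lambda>x. f x - s x) < 1 / real (Suc n)" for n by (intro dense f) simp
    then obtain s where s: "\<And>n. s n \<in> D" "\<And>n. Lp_int p (\<lambda>x. f x - s n x) < 1 / real (Suc n)"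
      by metis
    have sn: "Lp_int p (\<lambda>x. f x - s n x) < 1 / real (Suc N)" if "n \<ge> N" for n N
      using that by (intro less_le_trans[OF s(2)[of n]]) (simp add: frac_le)
    have "\<exists>g\<in>Lp_space p. (\<lambda>n. Lp_int p (\<lambda>x. T (s n) x - g x)) \<longlonglongrightarrow> 0"
    proof (rule Lp_complete[OF p T[OF s(1)]])
      fix e :: real assume e: "e > 0"
      define M where "M = K * (2 powr p * 2)"
      have M: "0 \<le> M" using K by (simp add: M_def)
      obtain N where N: "M / e < real (Suc N)" using reals_Archimedean2 less_trans of_nat_less_iff lessI by metis
      have "Lp_int p (\<lambda>x. T (s m) x - T (s n) x) < e" if "m \<ge> N" "n \<ge> N" for m n
      proof -
        have "Lp_int p (\<lambda>x. T (s m) x - T (s n) x) \<le> K * Lp_int p (\<lambda>x. s m x - s n x)"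
          unfolding T_diff(1)[OF s(1) s(1)] by (intro K T_diff(2) s)
        also have "\<dots> \<le> K * (2 powr p * (Lp_int p (\<lambda>x. s m x - f x) + Lp_int p (\<lambda>x. f x - s n x)))"
          using K by (intro mult_left_mono Lp_int_triangle3 DL s f p0)
        also have "\<dots> \<le> K * (2 powr p * (1 / real (Suc N) + 1 / real (Suc N)))"
          using K sn[OF that(1)] sn[OF that(2)]
          by (intro mult_left_mono add_mono) (auto simp: Lp_int_minus_commute[of p _ f])
        also have "\<dots> = M / real (Suc N)" by (simp add: M_def)
        also have "\<dots> < e" using N e by (simp add: field_simps)
        finally show ?thesis .
      qed
      then show "\<exists>N. \<forall>m\<ge>N. \<forall>n\<ge>N. Lp_int p (\<lambda>x. T (s m) x - T (s n) x) < e" by blast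
    qed
    then obtain g where g: "g \<in> Lp_space p" "(\<lambda>n. Lp_int p (\<lambda>x. T (s n) x - g x)) \<longlonglongrightarrow> 0" by blast
    have "R f g"
      unfolding R_def
    proof (intro conjI allI impI g)
      fix e :: real assume e: "e > 0"
      obtain N where N: "1 / real (Suc N) < e" using e nat_approx_posE by blast
      have "eventually (\<lambda>n. Lp_int p (\<lambda>x. T (s n) x - g x) < e \<and> n \<ge> N) sequentially"
        using order_tendstoD(2)[OF g(2) e] eventually_ge_at_top[of N] by eventually_elim simp
      then obtain n where n: "Lp_int p (\<lambda>x. T (s n) x - g x) < e" "n \<ge> N"
        by (auto dest: eventually_happens)
      then show "\<exists>s\<in>D. Lp_int p (\<lambda>x. f x - s x) < e \<and> Lp_int p (\<lambda>x. g x - T s x) < e"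
        using s(1)[of n] sn[OF n(2)] N by (intro bexI[of _ "s n"]) (auto simp: Lp_int_minus_commute[of p g])
    qed
    then show ?thesis by blast
  qed
  \<comment> \<open>Two passages through the triangle inequality, from \<open>f\<close> to
    \<open>s\<close> and from \<open>T s\<close> to \<open>g\<close>, cost the factor 2^p each; the
    approximation errors disappear as e tends to 0.\<close>
  have bound: "Lp_int p g \<le> (2 powr p * 2 powr p * K) * Lp_int p f" if f: "f \<in> Lp_space p" and R: "R f g" for f g
  proof (rule le_add_epsilon_mult)
    fix e :: real assume "e > 0"
    then obtain s where s: "s \<in> D" "Lp_int p (\<lambda>x. f x - s x) < e" "Lp_int p (\<lambda>x. g x - T s x) < e"
      and g: "g \<in> Lp_space p" using R by (auto simp: R_def)
    have "Lp_int p s \<le> 2 powr p * (Lp_int p (\<lambda>x. f x - s x) + Lp_int p f)"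
      using Lp_int_diff[OF p0 f Lp_space_diff[OF p0 f DL[OF s(1)]]] by (simp add: add.commute)
    also have "\<dots> \<le> 2 powr p * (e + Lp_int p f)" using s by (intro mult_left_mono) auto
    finally have 1: "Lp_int p s \<le> 2 powr p * (e + Lp_int p f)" .
    have "Lp_int p g \<le> 2 powr p * (Lp_int p (\<lambda>x. g x - T s x) + Lp_int p (T s))"
      using Lp_int_add[OF p0 Lp_space_diff[OF p0 g T[OF s(1)]] T[OF s(1)]] by simp
    also have "\<dots> \<le> 2 powr p * (e + K * Lp_int p s)"
      using s K(1)[OF s(1)] by (intro mult_left_mono add_mono) auto
    also have "\<dots> \<le> 2 powr p * (e + K * (2 powr p * (e + Lp_int p f)))"
      using 1 K(2) by (intro mult_left_mono add_mono) auto
    finally show "Lp_int p g \<le> (2 powr p * 2 powr p * K) * Lp_int p f + e * (2 powr p * (1 + K * 2 powr p))"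
      by (simp add: algebra_simps)
  qed
  have R_add: "R (\<lambda>x. f x + f' x) (\<lambda>x. g x + g' x)"
    if f: "f \<in> Lp_space p" "f' \<in> Lp_space p" and R: "R f g" "R f' g'" for f f' g g'
    unfolding R_def
  proof (intro conjI allI impI)
    have g: "g \<in> Lp_space p" "g' \<in> Lp_space p" using R by (auto simp: R_def)
    then show "(\<lambda>x. g x + g' x) \<in> Lp_space p" by (intro Lp_space_add p0)
    fix e :: real assume "e > 0"
    define d where "d = e / (2 powr p * 2)"
    have d: "d > 0" "2 powr p * (d + d) = e" using \<open>e > 0\<close> by (auto simp: d_def)
    obtain s where s: "s \<in> D" "Lp_int p (\<lambda>x. f x - s x) < d" "Lp_int p (\<lambda>x. g x - T s x) < d"
      using R(1) d(1) by (auto simp: R_def)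
    obtain s' where s': "s' \<in> D" "Lp_int p (\<lambda>x. f' x - s' x) < d" "Lp_int p (\<lambda>x. g' x - T s' x) < d"
      using R(2) d(1) by (auto simp: R_def)
    have *: "Lp_int p (\<lambda>x. (a x + a' x) - (b x + b' x)) < e"
      if "a \<in> Lp_space p" "a' \<in> Lp_space p" "b \<in> Lp_space p" "b' \<in> Lp_space p"
        "Lp_int p (\<lambda>x. a x - b x) < d" "Lp_int p (\<lambda>x. a' x - b' x) < d" for a a' b b'
    proof -
      have "Lp_int p (\<lambda>x. (a x - b x) + (a' x - b' x)) \<le>
          2 powr p * (Lp_int p (\<lambda>x. a x - b x) + Lp_int p (\<lambda>x. a' x - b' x))"
        using that by (intro Lp_int_add Lp_space_diff p0)
      also have "\<dots> < 2 powr p * (d + d)" using that by (intro mult_strict_left_mono) auto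
      also have "\<dots> = e" by (rule d)
      finally show ?thesis by (simp add: algebra_simps)
    qed
    show "\<exists>s\<in>D. Lp_int p (\<lambda>x. f x + f' x - s x) < e \<and> Lp_int p (\<lambda>x. g x + g' x - T s x) < e"
      using *[OF f DL[OF s(1)] DL[OF s'(1)] s(2) s'(2)] *[OF g T[OF s(1)] T[OF s'(1)] s(3) s'(3)]
      by (intro bexI[of _ "\<lambda>x. s x + s' x"] D_add s s') (simp add: T_add[OF s(1) s'(1)])
  qed
  have R_cmult: "R (\<lambda>x. c * f x) (\<lambda>x. c * g x)" if f: "f \<in> Lp_space p" and R: "R f g" for c f g
    unfolding R_def
  proof (intro conjI allI impI)
    have g: "g \<in> Lp_space p" using R by (auto simp: R_def)
    then show "(\<lambda>x. c * g x) \<in> Lp_space p" by (rule Lp_space_cmult)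
    fix e :: real assume "e > 0"
    \<comment> \<open>The added 1 keeps the denominator positive for \<open>c = 0\<close> and makes
      the final inequality strict.\<close>
    define d where "d = e / (norm c powr p + 1)"
    have c1: "norm c powr p + 1 > 0" by (simp add: add_nonneg_pos)
    then have d: "d > 0" "norm c powr p * d < e"
      using \<open>e > 0\<close> unfolding d_def times_divide_eq_right pos_divide_less_eq[OF c1]
      by (auto simp: algebra_simps intro: divide_pos_pos)
    obtain s where s: "s \<in> D" "Lp_int p (\<lambda>x. f x - s x) < d" "Lp_int p (\<lambda>x. g x - T s x) < d"
      using R d(1) by (auto simp: R_def)
    have *: "Lp_int p (\<lambda>x. c * a x - c * b x) < e"
      if "a \<in> Lp_space p" "b \<in> Lp_space p" "Lp_int p (\<lambda>x. a x - b x) < d" for a b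
    proof -
      have "Lp_int p (\<lambda>x. c * (a x - b x)) = norm c powr p * Lp_int p (\<lambda>x. a x - b x)"
        using that by (intro Lp_int_cmult Lp_space_diff p0)
      also have "\<dots> \<le> norm c powr p * d" using that by (intro mult_left_mono) auto
      finally show ?thesis using d by (simp add: algebra_simps)
    qed
    show "\<exists>s\<in>D. Lp_int p (\<lambda>x. c * f x - s x) < e \<and> Lp_int p (\<lambda>x. c * g x - T s x) < e"
      using *[OF f DL[OF s(1)] s(2)] *[OF g T[OF s(1)] s(3)]
      by (intro bexI[of _ "\<lambda>x. c * s x"] D_cmult s) (simp add: T_cmult[OF s(1)])
  qed
  have unique: "AE x in lborel. g x = g' x" if f: "f \<in> Lp_space p" and R: "R f g" "R f g'" for f g g'
  proof -
    have "R (\<lambda>x. f x + - 1 * f x) (\<lambda>x. g x + - 1 * g' x)"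
      by (intro R_add R_cmult f R Lp_space_cmult)
    \<comment> \<open>Two limits for the same \<open>f\<close> differ by a limit for the zero
      function, which the bound forces to vanish.\<close>
    then have R0: "R (\<lambda>x. 0 * f x) (\<lambda>x. g x - g' x)" by simp
    have "Lp_int p (\<lambda>x. g x - g' x) \<le> (2 powr p * 2 powr p * K) * Lp_int p (\<lambda>x. 0 * f x)"
      by (rule bound[OF Lp_space_cmult[OF f] R0])
    then have "Lp_int p (\<lambda>x. g x - g' x) = 0"
      by (intro antisym) (auto simp: Lp_int_def)
    then have "AE x in lborel. g x - g' x = 0"
      using p R by (intro Lp_int_eq_0_imp_AE[of _ p] Lp_space_diff) (auto simp: R_def)
    then show ?thesis by eventually_elim simp
  qed
  define S where "S f = (SOME g. R f g)" for f
  have S: "R f (S f)" if "f \<in> Lp_space p" for f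
    unfolding S_def by (rule someI_ex[OF ex[OF that]])
  have "bounded_Lp_operator p S"
  proof (rule bounded_Lp_operatorI[OF p])
    show "S f \<in> Lp_space p" if "f \<in> Lp_space p" for f using S[OF that] by (simp add: R_def)
    show "AE x in lborel. S (\<lambda>y. f y + g y) x = S f x + S g x" if "f \<in> Lp_space p" "g \<in> Lp_space p" for f g
      using that by (intro unique[of "\<lambda>y. f y + g y"] R_add S Lp_space_add p0)
    show "AE x in lborel. S (\<lambda>y. c * f y) x = c * S f x" if "f \<in> Lp_space p" for f c
      using that by (intro unique[of "\<lambda>y. c * f y"] R_cmult S Lp_space_cmult)
    show "Lp_int p (S f) \<le> (2 powr p * 2 powr p * K) * Lp_int p f" if "f \<in> Lp_space p" for f
      using that by (intro bound S)
  qed (use K in auto)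
  moreover have "AE x in lborel. S f x = T f x" if f: "f \<in> D" for f
  proof (rule unique[OF DL[OF f] S[OF DL[OF f]]])
    show "R f (T f)" using f T[OF f] by (auto simp: R_def Lp_int_def intro!: bexI[of _ f])
  qed
  ultimately show ?thesis by blast
qed

section \<open>Multiplier operators on \<open>L\<^sup>p\<close>\<close>

lemma powr_tangent:
  fixes s t p :: real
  assumes p: "p \<ge> 1" and s: "s > 0" and t: "t \<ge> 0"
  shows "p * (t * s powr (p - 1)) \<le> t powr p + (p - 1) * s powr p"
proof (cases "t = 0")
  case True
  then show ?thesis using p by simp
next
  case False
  then have t: "t > 0" using t by simp
  \<comment> \<open>Young's inequality for products; rearranged, it says that the graph of the p-th
    power lies above its tangent at \<open>s\<close>.\<close>
  have "(t powr p) powr (1 / p) * (s powr p) powr (1 - 1 / p) \<le> 1 / p * t powr p + (1 - 1 / p) * s powr p"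
    using p s t by (intro Youngs_inequality_0) auto
  moreover have "(t powr p) powr (1 / p) = t" "(s powr p) powr (1 - 1 / p) = s powr (p - 1)"
    using p t by (auto simp: powr_powr right_diff_distrib)
  ultimately have "t * s powr (p - 1) \<le> 1 / p * t powr p + (1 - 1 / p) * s powr p" by simp
  then have "p * (t * s powr (p - 1)) \<le> p * (1 / p * t powr p + (1 - 1 / p) * s powr p)"
    using p by (intro mult_left_mono) auto
  also have "\<dots> = t powr p + (p - 1) * s powr p" using p by (simp add: field_simps)
  finally show ?thesis .
qed

text \<open>Jensen's inequality for a weight of total mass \<open>A\<close>: the tangent inequality
  is taken at the mean value F / A and integrated.\<close>

lemma powr_integral_le:
  fixes w t :: "'a \<Rightarrow> real"
  assumes p: "p \<ge> 1" and w: "integrable M w" and wt: "integrable M (\<lambda>x. w x * t x)"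
    and wtp: "integrable M (\<lambda>x. w x * t x powr p)" and nn: "\<And>x. w x \<ge> 0" "\<And>x. t x \<ge> 0"
    and A: "(LINT x|M. w x) = A" "A > 0"
  shows "(LINT x|M. w x * t x) powr p \<le> A powr (p - 1) * (LINT x|M. w x * t x powr p)"
proof -
  define F where "F = (LINT x|M. w x * t x)"
  define I where "I = (LINT x|M. w x * t x powr p)"
  have I: "I \<ge> 0" unfolding I_def using nn by (intro Bochner_Integration.integral_nonneg) auto
  have F0: "F \<ge> 0" unfolding F_def using nn by (intro Bochner_Integration.integral_nonneg) auto
  have "F powr p \<le> A powr (p - 1) * I"
  proof (cases "F = 0")
    case True then show ?thesis using I by simp
  next
    case False
    define s where "s = F / A"
    have F: "F > 0" using False F0 by simp
    then have s: "s > 0" using A by (simp add: s_def)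
    have "(LINT x|M. p * s powr (p - 1) * (w x * t x)) \<le> (LINT x|M. w x * t x powr p + (p - 1) * s powr p * w x)"
    proof (rule integral_mono)
      fix x
      have "w x * (p * (t x * s powr (p - 1))) \<le> w x * (t x powr p + (p - 1) * s powr p)"
        by (intro mult_left_mono powr_tangent p s nn)
      then show "p * s powr (p - 1) * (w x * t x) \<le> w x * t x powr p + (p - 1) * s powr p * w x"
        by (simp add: algebra_simps)
    qed (use w wt wtp in auto)
    then have "p * s powr (p - 1) * F \<le> I + (p - 1) * s powr p * A"
      using w wt wtp A by (simp add: F_def I_def)
    moreover have "p * s powr (p - 1) * F = p * (s powr p * A)"
    proof -
      have "s powr p = s * s powr (p - 1)" using s powr_mult_base[of s "p - 1"] by simp
      then show ?thesis using A by (simp add: s_def)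
    qed
    moreover have "(p - 1) * s powr p * A = p * (s powr p * A) - s powr p * A"
      by (simp add: left_diff_distrib)
    ultimately have "s powr p * A \<le> I" by linarith
    then have "A powr (p - 1) * (s powr p * A) \<le> A powr (p - 1) * I" by (intro mult_left_mono) auto
    moreover have "A powr (p - 1) * (s powr p * A) = F powr p"
    proof -
      have "A powr p = A * A powr (p - 1)" using A powr_mult_base[of A "p - 1"] by simp
      then have "A powr (p - 1) * (s powr p * A) = s powr p * A powr p" by simp
      also have "\<dots> = (s * A) powr p" using s A by (simp add: powr_mult)
      finally show ?thesis using A by (simp add: s_def)
    qed
    ultimately show ?thesis by simp
  qed
  then show ?thesis by (simp add: F_def I_def)
qed

definition convolve :: "('a::euclidean_space \<Rightarrow> complex) \<Rightarrow> ('a \<Rightarrow> complex) \<Rightarrow> 'a \<Rightarrow> complex" where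
  "convolve K f x = (LINT y|lborel. K y * f (x - y))"

lemma integrable_convolve_pair:
  fixes f :: "'a::euclidean_space \<Rightarrow> real"
  assumes w: "integrable lborel w" and f: "integrable lborel f"
  shows "integrable (lborel \<Otimes>\<^sub>M lborel) (\<lambda>(y, x). w y * f (x - y))"
    and "(LINT x|lborel. LINT y|lborel. w y * f (x - y)) = (LINT y|lborel. w y) * (LINT x|lborel. f x)"
proof -
  have [measurable]: "w \<in> borel_measurable borel" "f \<in> borel_measurable borel" using w f by auto
  have sh: "integrable lborel (\<lambda>x. g (x - y))" "(LINT x|lborel. g (x - y)) = (LINT x|lborel. g x)"
    if "integrable lborel g" for y and g :: "'a \<Rightarrow> real"
    using integrable_shift[OF that, of "-y"] integral_shift[of g "-y"] that by auto
  have int: "integrable (lborel \<Otimes>\<^sub>M lborel) (\<lambda>z. w (fst z) * f (snd z - fst z))"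
    by (rule lborel_pair.Fubini_integrable)
       (use w f sh(1)[OF f] in \<open>auto simp: abs_mult sh(2)[of "\<lambda>x. \<bar>f x\<bar>"]\<close>)
  then show 1: "integrable (lborel \<Otimes>\<^sub>M lborel) (\<lambda>(y, x). w y * f (x - y))"
    by (simp add: case_prod_beta')
  have "(LINT x|lborel. LINT y|lborel. w y * f (x - y)) = (LINT y|lborel. LINT x|lborel. w y * f (x - y))"
    by (rule lborel_pair.Fubini_integral[OF 1])
  also have "\<dots> = (LINT y|lborel. w y) * (LINT x|lborel. f x)"
    by (simp add: sh(2)[OF f])
  finally show "(LINT x|lborel. LINT y|lborel. w y * f (x - y)) = (LINT y|lborel. w y) * (LINT x|lborel. f x)" .
qed

text \<open>Young's inequality for L^1 * L^p: Jensen bounds the p-th power of the inner integral,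
  and Fubini then gives the factor A^(p-1) * A.\<close>

theorem bounded_Lp_operator_convolve:
  fixes K :: "'a::euclidean_space \<Rightarrow> complex"
  assumes p: "p \<ge> 1" and K: "decay_bounded K"
  shows "bounded_Lp_operator p (convolve K)"
proof -
  obtain C0 where C0: "C0 \<ge> 0" "\<And>x. norm (K x) \<le> C0 * decay_weight x"
    using decay_boundedE[OF K] by metis
  \<comment> \<open>The added 1 makes the majorant strictly positive even for \<open>K = 0\<close>,
    so that its mass \<open>A\<close> can be divided by.\<close>
  define w where "w x = (C0 + 1) * decay_weight x" for x :: 'a
  have Kw: "norm (K x) \<le> w x" and w0: "w x > 0" for x
  proof -
    show "w x > 0" using C0(1) decay_weight_pos[of x] by (simp add: w_def)
    show "norm (K x) \<le> w x"
      using C0(2)[of x] decay_weight_pos[of x] by (simp add: w_def distrib_right)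
  qed
  have w: "integrable lborel w"
    unfolding w_def by (intro integrable_mult_right integrable_decay_weight)
  have iK: "integrable lborel K" by (rule decay_bounded_integrable[OF K])
  have [measurable]: "w \<in> borel_measurable borel" "K \<in> borel_measurable borel" using w iK by auto
  define A where "A = (LINT x|lborel. w x)"
  have A: "A > 0"
  proof -
    have "A \<ge> 0" unfolding A_def using w0 by (intro Bochner_Integration.integral_nonneg) (auto intro: less_imp_le)
    moreover have "A \<noteq> 0"
    proof
      assume "A = 0"
      then have "AE x in lborel. w x = 0"
        using integral_nonneg_eq_0_iff_AE[OF w] w0 by (auto simp: A_def intro: less_imp_le)
      then have "AE x in (lborel :: 'a measure). False"
        by eventually_elim (use w0 in \<open>simp add: less_imp_neq[symmetric]\<close>)
      then show False by (simp add: AE_iff_measurable[OF _ refl])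
    qed
    ultimately show ?thesis by simp
  qed
  \<comment> \<open>Fubini yields convergence only for almost every x, and so additivity of the
    convolution also holds almost everywhere. The first power follows from the p-th by t \<le> 1 +
    t^p.\<close>
  have main: "AE x in lborel. integrable lborel (\<lambda>y. w y * norm (f (x - y))) \<and>
      integrable lborel (\<lambda>y. w y * norm (f (x - y)) powr p)"
    if f: "f \<in> Lp_space p" for f
  proof -
    note [measurable] = Lp_spaceD(1)[OF f]
    have "AE x in lborel. integrable lborel (\<lambda>y. w y * norm (f (x - y)) powr p)"
      by (rule lborel_pair.AE_integrable_snd[OF integrable_convolve_pair(1)[OF w Lp_spaceD(2)[OF f]]])
    then show ?thesis
    proof eventually_elim
      fix x assume i: "integrable lborel (\<lambda>y. w y * norm (f (x - y)) powr p)"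
      have "integrable lborel (\<lambda>y. w y * norm (f (x - y)))"
      proof (rule Bochner_Integration.integrable_bound)
        show "integrable lborel (\<lambda>y. w y + w y * norm (f (x - y)) powr p)" using w i by simp
        have "w y * norm (f (x - y)) \<le> w y + w y * norm (f (x - y)) powr p" for y
          using mult_left_mono[OF le_1_plus_powr[of "norm (f (x - y))" p], of "w y"] w0[of y] p
          by (simp add: distrib_left)
        then show "AE y in lborel. norm (w y * norm (f (x - y))) \<le> norm (w y + w y * norm (f (x - y)) powr p)"
          using w0 by (auto intro!: AE_I2 simp: abs_mult abs_of_pos order_trans[OF _ abs_ge_self])
      qed measurable
      then show "integrable lborel (\<lambda>y. w y * norm (f (x - y))) \<and>
          integrable lborel (\<lambda>y. w y * norm (f (x - y)) powr p)" using i by simp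
    qed
  qed
  have Kf: "integrable lborel (\<lambda>y. K y * f (x - y))"
    if [measurable]: "f \<in> borel_measurable borel" and i: "integrable lborel (\<lambda>y. w y * norm (f (x - y)))" for f x
    by (rule Bochner_Integration.integrable_bound[OF i])
       (auto intro!: AE_I2 mult_right_mono simp: norm_mult abs_mult Kw abs_of_pos w0)
  show ?thesis
  proof (rule bounded_Lp_operatorI[OF p])
    fix f :: "'a \<Rightarrow> complex" assume f: "f \<in> Lp_space p"
    note [measurable] = Lp_spaceD(1)[OF f]
    have m: "convolve K f \<in> borel_measurable borel"
      unfolding convolve_def[abs_def] by measurable
    have i: "integrable lborel (\<lambda>x. A powr (p - 1) * (LINT y|lborel. w y * norm (f (x - y)) powr p))"
      using lborel_pair.integrable_snd[OF integrable_convolve_pair(1)[OF w Lp_spaceD(2)[OF f]]] by simp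
    have le: "AE x in lborel. norm (convolve K f x) powr p \<le> A powr (p - 1) * (LINT y|lborel. w y * norm (f (x - y)) powr p)"
      using main[OF f]
    proof eventually_elim
      fix x assume x: "integrable lborel (\<lambda>y. w y * norm (f (x - y))) \<and>
          integrable lborel (\<lambda>y. w y * norm (f (x - y)) powr p)"
      have "norm (convolve K f x) \<le> (LINT y|lborel. norm (K y * f (x - y)))"
        unfolding convolve_def by (rule integral_norm_bound)
      also have "\<dots> \<le> (LINT y|lborel. w y * norm (f (x - y)))"
        using x w0 by (intro integral_mono') (auto simp: norm_mult Kw less_imp_le intro: mult_right_mono)
      finally have "norm (convolve K f x) powr p \<le> (LINT y|lborel. w y * norm (f (x - y))) powr p"
        using p by (intro powr_mono2) auto
      also have "\<dots> \<le> A powr (p - 1) * (LINT y|lborel. w y * norm (f (x - y)) powr p)"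
        using x w0 A by (intro powr_integral_le p w) (auto simp: A_def less_imp_le)
      finally show "norm (convolve K f x) powr p \<le> A powr (p - 1) * (LINT y|lborel. w y * norm (f (x - y)) powr p)" .
    qed
    show "convolve K f \<in> Lp_space p" by (rule Lp_space_bound(1)[OF m i le])
    have "Lp_int p (convolve K f) \<le> (LINT x|lborel. A powr (p - 1) * (LINT y|lborel. w y * norm (f (x - y)) powr p))"
      by (rule Lp_space_bound(2)[OF m i le])
    also have "\<dots> = A powr (p - 1) * A * Lp_int p f"
      using integrable_convolve_pair(2)[OF w Lp_spaceD(2)[OF f]] by (simp add: A_def Lp_int_def)
    finally show "Lp_int p (convolve K f) \<le> A powr (p - 1) * A * Lp_int p f" .
    show "AE x in lborel. convolve K (\<lambda>y. c * f y) x = c * convolve K f x" for c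
      by (simp add: convolve_def mult.left_commute)
    fix g :: "'a \<Rightarrow> complex" assume g: "g \<in> Lp_space p"
    show "AE x in lborel. convolve K (\<lambda>y. f y + g y) x = convolve K f x + convolve K g x"
      using main[OF f] main[OF g]
      by eventually_elim (simp add: convolve_def distrib_left Kf Lp_spaceD(1)[OF f] Lp_spaceD(1)[OF g])
  qed (use A in simp)
qed

text \<open>Boundedness of the symbol keeps \<open>m\<close> times \<open>h\<close> integrable, so
  the right-hand side is an honest integral, and the image is again an admissible input for the next
  operator.\<close>

definition Lp_multiplier ::
    "real \<Rightarrow> ('a::euclidean_space \<Rightarrow> complex) \<Rightarrow> (('a \<Rightarrow> complex) \<Rightarrow> ('a \<Rightarrow> complex)) \<Rightarrow> bool" where
  "Lp_multiplier p m T \<longleftrightarrow>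
     bounded_Lp_operator p T \<and> m \<in> borel_measurable borel \<and> (\<exists>B. \<forall>\<xi>. norm (m \<xi>) \<le> B) \<and>
     (\<forall>h. integrable lborel h \<longrightarrow> inverse_fourier h \<in> Lp_space p \<longrightarrow>
        (AE x in lborel. T (inverse_fourier h) x = inverse_fourier (\<lambda>\<xi>. m \<xi> * h \<xi>) x))"

lemma Lp_multiplierD:
  assumes "Lp_multiplier p m T"
  shows "bounded_Lp_operator p T" "m \<in> borel_measurable borel" "\<exists>B. \<forall>\<xi>. norm (m \<xi>) \<le> B"
    "integrable lborel h \<Longrightarrow> inverse_fourier h \<in> Lp_space p \<Longrightarrow>
      AE x in lborel. T (inverse_fourier h) x = inverse_fourier (\<lambda>\<xi>. m \<xi> * h \<xi>) x"
  using assms unfolding Lp_multiplier_def by blast+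

lemma Lp_multiplier_integrable:
  assumes T: "Lp_multiplier p m T" and h: "integrable lborel h"
  shows "integrable lborel (\<lambda>\<xi>. m \<xi> * h \<xi>)"
proof -
  obtain B where B: "\<And>\<xi>. norm (m \<xi>) \<le> B" using Lp_multiplierD(3)[OF T] by blast
  have [measurable]: "m \<in> borel_measurable borel" by (rule Lp_multiplierD(2)[OF T])
  have "integrable lborel (\<lambda>\<xi>. h \<xi> * m \<xi>)"
    by (rule integrable_mult_bounded[OF h _ B]) measurable
  then show ?thesis by (simp add: mult.commute)
qed

text \<open>Enough smoothness makes the kernel integrable and lets inversion recover
  \<open>G\<close> from it; Fubini does the rest. Here multipliers arise without any prior bound on
  an operator.\<close>

lemma Lp_multiplier_convolve:
  fixes G :: "'a::euclidean_space \<Rightarrow> complex"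
  assumes p: "p \<ge> 1" and G: "decaying (2 * DIM('a)) G"
  shows "Lp_multiplier p G (convolve (inverse_fourier G))"
  unfolding Lp_multiplier_def
proof (intro conjI allI impI)
  let ?K = "inverse_fourier G"
  have dK: "decay_bounded ?K" by (rule decay_bounded_inverse_fourier[OF G])
  then have iK: "integrable lborel ?K" by (rule decay_bounded_integrable)
  show "bounded_Lp_operator p (convolve ?K)" by (rule bounded_Lp_operator_convolve[OF p dK])
  have dG: "decay_bounded G" by (rule decaying_imp_decay_bounded[OF G])
  show "G \<in> borel_measurable borel"
    using borel_measurable_integrable[OF decay_bounded_integrable[OF dG]] by simp
  show "\<exists>B. \<forall>\<xi>. norm (G \<xi>) \<le> B" using decay_bounded_bounded[OF dG] by metis
  fix h :: "'a \<Rightarrow> complex" assume h: "integrable lborel h"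
  let ?c = "inverse ((2 * pi) ^ DIM('a))"
  have "convolve ?K (inverse_fourier h) x = inverse_fourier (\<lambda>\<xi>. G \<xi> * h \<xi>) x" for x
  proof -
    have int: "integrable (lborel \<Otimes>\<^sub>M lborel) (\<lambda>(y, \<eta>). ?K y * h \<eta> * cis (\<eta> \<bullet> (x - y)))"
      using integrable_pair_mult[OF iK h, of "\<lambda>z. cis (snd z \<bullet> (x - fst z))" 1] by simp
    have "convolve ?K (inverse_fourier h) x = ?c *\<^sub>R (LINT y|lborel. LINT \<eta>|lborel. ?K y * h \<eta> * cis (\<eta> \<bullet> (x - y)))"
      by (simp add: convolve_def inverse_fourier_def[of h] mult.assoc)
    also have "\<dots> = ?c *\<^sub>R (LINT \<eta>|lborel. LINT y|lborel. ?K y * h \<eta> * cis (\<eta> \<bullet> (x - y)))"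
      by (subst lborel_pair.Fubini_integral[OF int]) simp
    also have "\<dots> = ?c *\<^sub>R (LINT \<eta>|lborel. fourier ?K \<eta> * h \<eta> * cis (\<eta> \<bullet> x))"
    proof -
      have "(LINT y|lborel. ?K y * h \<eta> * cis (\<eta> \<bullet> (x - y))) = fourier ?K \<eta> * h \<eta> * cis (\<eta> \<bullet> x)" for \<eta>
      proof -
        have e: "?K y * h \<eta> * cis (\<eta> \<bullet> (x - y)) = ?K y * cis (- (y \<bullet> \<eta>)) * (h \<eta> * cis (\<eta> \<bullet> x))" for y
        proof -
          have "cis (\<eta> \<bullet> (x - y)) = cis (- (y \<bullet> \<eta>)) * cis (\<eta> \<bullet> x)"
            by (simp add: cis_mult inner_diff_right inner_commute)
          then show ?thesis by simp
        qed
        show ?thesis unfolding e by (simp add: fourier_cis)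
      qed
      then show ?thesis by simp
    qed
    also have "\<dots> = inverse_fourier (\<lambda>\<xi>. G \<xi> * h \<xi>) x"
      by (simp add: inverse_fourier_def[of "\<lambda>\<xi>. G \<xi> * h \<xi>"] decaying_inversion(2)[OF G])
    finally show ?thesis .
  qed
  then show "AE x in lborel. convolve ?K (inverse_fourier h) x = inverse_fourier (\<lambda>\<xi>. G \<xi> * h \<xi>) x" by simp
qed

lemma Lp_multiplier_ident: "p \<ge> 1 \<Longrightarrow> Lp_multiplier p (\<lambda>\<xi>. 1) (\<lambda>f. f)"
  unfolding Lp_multiplier_def
  by (intro conjI bounded_Lp_operatorI[where K=1]) auto

lemma Lp_multiplier_cmult:
  assumes p: "p \<ge> 1" and T: "Lp_multiplier p m T"
  shows "Lp_multiplier p (\<lambda>\<xi>. c * m \<xi>) (\<lambda>f x. c * T f x)"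
  unfolding Lp_multiplier_def
proof (intro conjI allI impI)
  note T' = Lp_multiplierD[OF T]
  note b = T'(1)
  obtain K where K: "K \<ge> 0" "\<And>f. f \<in> Lp_space p \<Longrightarrow> Lp_int p (T f) \<le> K * Lp_int p f"
    using bounded_Lp_operator_int_bound[OF p b] by metis
  show "bounded_Lp_operator p (\<lambda>f x. c * T f x)"
  proof (rule bounded_Lp_operatorI[OF p])
    fix f :: "'a \<Rightarrow> complex" assume f: "f \<in> Lp_space p"
    show "(\<lambda>x. c * T f x) \<in> Lp_space p" by (intro Lp_space_cmult bounded_Lp_operator_space[OF b f])
    show "AE x in lborel. c * T (\<lambda>y. d * f y) x = d * (c * T f x)" for d
      using bounded_Lp_operator_cmult[OF b f, of d] by eventually_elim simp
    show "Lp_int p (\<lambda>x. c * T f x) \<le> norm c powr p * K * Lp_int p f"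
      unfolding Lp_int_cmult[OF bounded_Lp_operator_space[OF b f]] mult.assoc
      by (intro mult_left_mono K f) auto
    show "AE x in lborel. c * T (\<lambda>y. f y + g y) x = c * T f x + c * T g x" if "g \<in> Lp_space p" for g
      using bounded_Lp_operator_add[OF b f that] by eventually_elim (simp add: distrib_left)
  qed (use K in simp)
  have [measurable]: "m \<in> borel_measurable borel" by (rule T')
  show "(\<lambda>\<xi>. c * m \<xi>) \<in> borel_measurable borel" by measurable
  obtain B where "\<And>\<xi>. norm (m \<xi>) \<le> B" using T'(3) by blast
  then show "\<exists>B. \<forall>\<xi>. norm (c * m \<xi>) \<le> B"
    by (intro exI[of _ "norm c * B"]) (auto simp: norm_mult intro: mult_left_mono)
  fix h :: "'a \<Rightarrow> complex" assume "integrable lborel h" "inverse_fourier h \<in> Lp_space p"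
  from T'(4)[OF this]
  show "AE x in lborel. c * T (inverse_fourier h) x = inverse_fourier (\<lambda>\<xi>. c * m \<xi> * h \<xi>) x"
    by eventually_elim (simp add: mult.assoc inverse_fourier_cmult)
qed

lemma Lp_multiplier_add:
  assumes p: "p \<ge> 1" and S: "Lp_multiplier p k S" and T: "Lp_multiplier p m T"
  shows "Lp_multiplier p (\<lambda>\<xi>. k \<xi> + m \<xi>) (\<lambda>f x. S f x + T f x)"
  unfolding Lp_multiplier_def
proof (intro conjI allI impI)
  note S' = Lp_multiplierD[OF S] and T' = Lp_multiplierD[OF T]
  note bS = S'(1) and bT = T'(1)
  obtain K where K: "K \<ge> 0" "\<And>f. f \<in> Lp_space p \<Longrightarrow> Lp_int p (T f) \<le> K * Lp_int p f"
    using bounded_Lp_operator_int_bound[OF p bT] by metis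
  obtain L where L: "L \<ge> 0" "\<And>f. f \<in> Lp_space p \<Longrightarrow> Lp_int p (S f) \<le> L * Lp_int p f"
    using bounded_Lp_operator_int_bound[OF p bS] by metis
  have p0: "p \<ge> 0" using p by simp
  show "bounded_Lp_operator p (\<lambda>f x. S f x + T f x)"
  proof (rule bounded_Lp_operatorI[OF p])
    fix f :: "'a \<Rightarrow> complex" assume f: "f \<in> Lp_space p"
    note sp = bounded_Lp_operator_space[OF bS f] bounded_Lp_operator_space[OF bT f]
    show "(\<lambda>x. S f x + T f x) \<in> Lp_space p" by (intro Lp_space_add sp p0)
    show "AE x in lborel. S (\<lambda>y. d * f y) x + T (\<lambda>y. d * f y) x = d * (S f x + T f x)" for d
      using bounded_Lp_operator_cmult[OF bS f, of d] bounded_Lp_operator_cmult[OF bT f, of d]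
      by eventually_elim (simp add: distrib_left)
    have "Lp_int p (\<lambda>x. S f x + T f x) \<le> 2 powr p * (Lp_int p (S f) + Lp_int p (T f))"
      by (intro Lp_int_add sp p0)
    also have "\<dots> \<le> 2 powr p * (L * Lp_int p f + K * Lp_int p f)"
      by (intro mult_left_mono add_mono K L f) auto
    finally show "Lp_int p (\<lambda>x. S f x + T f x) \<le> 2 powr p * (L + K) * Lp_int p f"
      by (simp add: algebra_simps)
    show "AE x in lborel. S (\<lambda>y. f y + g y) x + T (\<lambda>y. f y + g y) x = S f x + T f x + (S g x + T g x)"
      if "g \<in> Lp_space p" for g
      using bounded_Lp_operator_add[OF bS f that] bounded_Lp_operator_add[OF bT f that]
      by eventually_elim simp
  qed (use K L in simp)
  have [measurable]: "m \<in> borel_measurable borel" "k \<in> borel_measurable borel" by (rule T' S')+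
  show "(\<lambda>\<xi>. k \<xi> + m \<xi>) \<in> borel_measurable borel" by measurable
  obtain B C where "\<And>\<xi>. norm (m \<xi>) \<le> B" "\<And>\<xi>. norm (k \<xi>) \<le> C" using T'(3) S'(3) by blast
  then show "\<exists>B. \<forall>\<xi>. norm (k \<xi> + m \<xi>) \<le> B"
    by (intro exI[of _ "C + B"]) (auto intro: norm_triangle_le add_mono)
  fix h :: "'a \<Rightarrow> complex" assume h: "integrable lborel h" "inverse_fourier h \<in> Lp_space p"
  from S'(4)[OF this] T'(4)[OF this]
  show "AE x in lborel. S (inverse_fourier h) x + T (inverse_fourier h) x
      = inverse_fourier (\<lambda>\<xi>. (k \<xi> + m \<xi>) * h \<xi>) x"
    by eventually_elim
       (simp add: distrib_right inverse_fourier_add[OF Lp_multiplier_integrable[OF S h(1)] Lp_multiplier_integrable[OF T h(1)]])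
qed

text \<open>The function \<open>inverse_fourier\<close> of \<open>m\<close> times \<open>h\<close>
  agrees almost everywhere with an image under \<open>T\<close>. It therefore lies in L^p, and the
  identity for \<open>S\<close> may be applied to it.\<close>

lemma Lp_multiplier_compose:
  assumes p: "p \<ge> 1" and S: "Lp_multiplier p k S" and T: "Lp_multiplier p m T"
  shows "Lp_multiplier p (\<lambda>\<xi>. k \<xi> * m \<xi>) (\<lambda>f. S (T f))"
  unfolding Lp_multiplier_def
proof (intro conjI allI impI)
  note S' = Lp_multiplierD[OF S] and T' = Lp_multiplierD[OF T]
  note bS = S'(1) and bT = T'(1)
  obtain K where K: "K \<ge> 0" "\<And>f. f \<in> Lp_space p \<Longrightarrow> Lp_int p (T f) \<le> K * Lp_int p f"
    using bounded_Lp_operator_int_bound[OF p bT] by metis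
  obtain L where L: "L \<ge> 0" "\<And>f. f \<in> Lp_space p \<Longrightarrow> Lp_int p (S f) \<le> L * Lp_int p f"
    using bounded_Lp_operator_int_bound[OF p bS] by metis
  have p0: "p \<ge> 0" using p by simp
  note spS = bounded_Lp_operator_space[OF bS] and spT = bounded_Lp_operator_space[OF bT]
  show "bounded_Lp_operator p (\<lambda>f. S (T f))"
  proof (rule bounded_Lp_operatorI[OF p])
    fix f :: "'a \<Rightarrow> complex" assume f: "f \<in> Lp_space p"
    show "S (T f) \<in> Lp_space p" by (intro spS spT f)
    show "AE x in lborel. S (T (\<lambda>y. d * f y)) x = d * S (T f) x" for d
      using bounded_Lp_operator_cong_AE[OF bS p spT[OF Lp_space_cmult[OF f]] Lp_space_cmult[OF spT[OF f]]
          bounded_Lp_operator_cmult[OF bT f, of d]] bounded_Lp_operator_cmult[OF bS spT[OF f], of d]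
      by eventually_elim simp
    have "Lp_int p (S (T f)) \<le> L * (K * Lp_int p f)"
      using L(2)[OF spT[OF f]] mult_left_mono[OF K(2)[OF f] L(1)] by simp
    then show "Lp_int p (S (T f)) \<le> (L * K) * Lp_int p f" by simp
    show "AE x in lborel. S (T (\<lambda>y. f y + g y)) x = S (T f) x + S (T g) x"
      if g: "g \<in> Lp_space p" for g
      using bounded_Lp_operator_cong_AE[OF bS p spT[OF Lp_space_add[OF p0 f g]] Lp_space_add[OF p0 spT[OF f] spT[OF g]]
          bounded_Lp_operator_add[OF bT f g]] bounded_Lp_operator_add[OF bS spT[OF f] spT[OF g]]
      by eventually_elim simp
  qed (use K L in simp)
  have [measurable]: "m \<in> borel_measurable borel" "k \<in> borel_measurable borel" by (rule T' S')+
  show "(\<lambda>\<xi>. k \<xi> * m \<xi>) \<in> borel_measurable borel" by measurable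
  obtain B C where BC: "\<And>\<xi>. norm (m \<xi>) \<le> B" "\<And>\<xi>. norm (k \<xi>) \<le> C" using T'(3) S'(3) by blast
  moreover have "0 \<le> C" by (rule order_trans[OF norm_ge_zero BC(2)])
  ultimately show "\<exists>B. \<forall>\<xi>. norm (k \<xi> * m \<xi>) \<le> B"
    by (intro exI[of _ "C * B"]) (auto simp: norm_mult intro: mult_mono)
  fix h :: "'a \<Rightarrow> complex" assume h: "integrable lborel h" "inverse_fourier h \<in> Lp_space p"
  note eqT = T'(4)[OF h]
  have mh: "integrable lborel (\<lambda>\<xi>. m \<xi> * h \<xi>)" by (rule Lp_multiplier_integrable[OF T h(1)])
  have "AE x in lborel. inverse_fourier (\<lambda>\<xi>. m \<xi> * h \<xi>) x = T (inverse_fourier h) x"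
    using eqT by eventually_elim simp
  then have sp: "inverse_fourier (\<lambda>\<xi>. m \<xi> * h \<xi>) \<in> Lp_space p"
    by (rule Lp_space_cong_AE[OF spT[OF h(2)] measurable_inverse_fourier[OF mh]])
  show "AE x in lborel. S (T (inverse_fourier h)) x = inverse_fourier (\<lambda>\<xi>. k \<xi> * m \<xi> * h \<xi>) x"
    using bounded_Lp_operator_cong_AE[OF bS p spT[OF h(2)] sp eqT] S'(4)[OF mh sp]
    by eventually_elim (simp add: mult.assoc)
qed

lemma Lp_multiplier_power:
  assumes p: "p \<ge> 1" and T: "Lp_multiplier p m T"
  shows "\<exists>S. Lp_multiplier p (\<lambda>\<xi>. m \<xi> ^ k) S"
proof (induction k)
  case 0
  then show ?case using Lp_multiplier_ident[OF p] by auto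
next
  case (Suc k)
  then show ?case using Lp_multiplier_compose[OF p T] by auto
qed

lemma Lp_multiplier_sum:
  assumes p: "p \<ge> 1" and "\<And>k. k \<in> I \<Longrightarrow> \<exists>S. Lp_multiplier p (m k) S"
  shows "\<exists>S. Lp_multiplier p (\<lambda>\<xi>. \<Sum>k\<in>I. m k \<xi>) S"
  using assms(2)
proof (induction I rule: infinite_finite_induct)
  case (insert i I)
  then show ?case using Lp_multiplier_add[OF p] by fastforce
qed (use Lp_multiplier_cmult[OF p Lp_multiplier_ident[OF p], of 0] in auto)

section \<open>From Gaussian test functions to general inputs\<close>

lemma Lp_AE_eqI:
  fixes f :: "nat \<Rightarrow> 'a::euclidean_space \<Rightarrow> complex"
  assumes p: "p \<ge> 1" and f: "\<And>n. f n \<in> Lp_space p" and g: "g \<in> Lp_space p"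
    and [measurable]: "k \<in> borel_measurable borel"
    and conv: "(\<lambda>n. Lp_int p (\<lambda>x. f n x - g x)) \<longlonglongrightarrow> 0"
    and lim: "AE x in lborel. (\<lambda>n. f n x) \<longlonglongrightarrow> k x"
  shows "AE x in lborel. g x = k x"
proof -
  note [measurable] = Lp_spaceD(1)[OF g] Lp_spaceD(1)[OF f]
  have d: "(\<lambda>x. f n x - g x) \<in> Lp_space p" for n
    using p by (intro Lp_space_diff f g) auto
  have lim': "AE x in lborel. (\<lambda>n. f n x - g x) \<longlonglongrightarrow> k x - g x"
    using lim by eventually_elim (intro tendsto_intros)
  have *: "(\<lambda>x. k x - g x) \<in> Lp_space p \<and> Lp_int p (\<lambda>x. k x - g x) \<le> e" if "e > 0" for e
  proof -
    have "eventually (\<lambda>n. Lp_int p (\<lambda>x. f n x - g x) \<le> e) sequentially"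
      using order_tendstoD(2)[OF conv that] by eventually_elim simp
    then show ?thesis
      using Lp_int_fatou[OF _ d _ lim'] p by simp
  qed
  \<comment> \<open>Fatou's lemma bounds this quantity by every positive number, because
    \<open>f n\<close> tends to \<open>g\<close> in L^p.\<close>
  have "Lp_int p (\<lambda>x. k x - g x) \<le> 0"
    by (rule field_le_epsilon) (use * in simp)
  then have "AE x in lborel. k x - g x = 0"
    using *[of 1] p by (intro Lp_int_eq_0_imp_AE[of _ p]) (auto intro: antisym)
  then show ?thesis by eventually_elim simp
qed

lemma integrable_iff_Lp_1: "integrable lborel f \<longleftrightarrow> f \<in> Lp_space 1"
proof
  assume "f \<in> Lp_space 1"
  then have "integrable lborel (\<lambda>x. norm (f x))" "f \<in> borel_measurable lborel"
    by (auto simp: Lp_space_def)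
  then show "integrable lborel f" by (simp add: integrable_norm_iff)
qed (auto simp: Lp_space_def)

lemma Lp_int_1_eq: "Lp_int 1 f = (LINT x|lborel. norm (f x))"
  by (simp add: Lp_int_def)

lemma bounded_Lp_operator_tendsto:
  assumes p: "p \<ge> 1" and T: "bounded_Lp_operator p T" and f: "\<And>n. f n \<in> Lp_space p" and g: "g \<in> Lp_space p"
    and conv: "(\<lambda>n::nat. Lp_int p (\<lambda>x. f n x - g x)) \<longlonglongrightarrow> 0"
  shows "(\<lambda>n. Lp_int p (\<lambda>x. T (f n) x - T g x)) \<longlonglongrightarrow> 0"
proof -
  obtain K where K: "K \<ge> 0" "\<And>f. f \<in> Lp_space p \<Longrightarrow> Lp_int p (T f) \<le> K * Lp_int p f"
    using bounded_Lp_operator_int_bound[OF p T] by metis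
  have d: "(\<lambda>x. f n x - g x) \<in> Lp_space p" for n
    using p by (intro Lp_space_diff f g) auto
  have "Lp_int p (\<lambda>x. T (f n) x - T g x) \<le> K * Lp_int p (\<lambda>x. f n x - g x)" for n
  proof -
    have Td: "(\<lambda>x. T (f n) x - T g x) \<in> Lp_space p"
      using p by (intro Lp_space_diff bounded_Lp_operator_space[OF T] f g) auto
    have "Lp_int p (\<lambda>x. T (f n) x - T g x) = Lp_int p (T (\<lambda>x. f n x - g x))"
    proof (rule Lp_int_cong_AE[OF bounded_Lp_operator_space[OF T d] Lp_spaceD(1)[OF Td]])
      show "AE x in lborel. T (f n) x - T g x = T (\<lambda>x. f n x - g x) x"
        using bounded_Lp_operator_diff[OF T p f[of n] g] by eventually_elim simp
    qed
    then show ?thesis using K(2)[OF d] by simp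
  qed
  then have le: "eventually (\<lambda>n. Lp_int p (\<lambda>x. T (f n) x - T g x) \<le> K * Lp_int p (\<lambda>x. f n x - g x)) sequentially"
    by simp
  have "(\<lambda>n. K * Lp_int p (\<lambda>x. f n x - g x)) \<longlonglongrightarrow> K * 0"
    by (intro tendsto_intros conv)
  then have lim: "(\<lambda>n. K * Lp_int p (\<lambda>x. f n x - g x)) \<longlonglongrightarrow> 0" by simp
  show ?thesis
    by (rule tendsto_sandwich[OF _ le tendsto_const lim]) simp
qed

lemma gauss_poly_dense_seq:
  fixes u :: "'a::euclidean_space \<Rightarrow> complex"
  assumes pq: "p \<ge> 1" "q \<ge> 1" and u: "u \<in> Lp_space p" "u \<in> Lp_space q"
  obtains g where "\<And>n::nat. gauss_poly 0 (g n)"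
    "(\<lambda>n. Lp_int p (\<lambda>x. of_real (gauss x) * g n x - u x)) \<longlonglongrightarrow> 0"
    "(\<lambda>n. Lp_int q (\<lambda>x. of_real (gauss x) * g n x - u x)) \<longlonglongrightarrow> 0"
proof -
  have "\<exists>g. gauss_poly 0 g \<and> Lp_near p q (1 / real (Suc n)) u (\<lambda>x. of_real (gauss x) * g x)" for n
    by (rule gauss_poly_dense[OF pq u]) simp
  then obtain g where g: "\<And>n. gauss_poly 0 (g n)"
    "\<And>n. Lp_near p q (1 / real (Suc n)) u (\<lambda>x. of_real (gauss x) * g n x)" by metis
  have lim: "(\<lambda>n. 1 / real (Suc n)) \<longlonglongrightarrow> 0" by (rule LIMSEQ_Suc[OF lim_const_over_n[of 1]])
  have "(\<lambda>n. Lp_int r (\<lambda>x. of_real (gauss x) * g n x - u x)) \<longlonglongrightarrow> 0" if "r = p \<or> r = q" for r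
  proof (rule tendsto_sandwich[OF _ _ tendsto_const lim])
    have "Lp_int r (\<lambda>x. u x - of_real (gauss x) * g n x) \<le> 1 / real (Suc n)" for n
      using g(2)[of n] that by (elim disjE) (simp_all add: Lp_near_def)
    then show "eventually (\<lambda>n. Lp_int r (\<lambda>x. of_real (gauss x) * g n x - u x) \<le> 1 / real (Suc n)) sequentially"
      by (intro always_eventually allI) (subst Lp_int_minus_commute)
  qed (intro always_eventually allI Lp_int_nonneg)
  then show ?thesis by (intro that[of g] g(1)) simp_all
qed

text \<open>A transform is bounded by the L^1 norm, and the integrable symbol makes that bound
  integrable. So closeness in L^1 implies uniform closeness of the images.\<close>

lemma inverse_fourier_multiplier_diff_le:
  fixes m u v :: "'a::euclidean_space \<Rightarrow> complex"
  assumes m: "integrable lborel m" and u: "integrable lborel u" and v: "integrable lborel v"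
  shows "norm (inverse_fourier (\<lambda>\<xi>. m \<xi> * fourier u \<xi>) x - inverse_fourier (\<lambda>\<xi>. m \<xi> * fourier v \<xi>) x)
    \<le> inverse ((2 * pi) ^ DIM('a)) * (LINT \<xi>|lborel. norm (m \<xi>)) * Lp_int 1 (\<lambda>x. u x - v x)"
proof -
  let ?c = "inverse ((2 * pi) ^ DIM('a))" and ?E = "Lp_int 1 (\<lambda>x. u x - v x)"
  have i: "integrable lborel (\<lambda>\<xi>. m \<xi> * fourier w \<xi>)" if "integrable lborel w" for w
    by (rule integrable_mult_bounded[OF m _ norm_fourier_le]) (use measurable_fourier[OF that] in simp)
  have "inverse_fourier (\<lambda>\<xi>. m \<xi> * fourier u \<xi>) x - inverse_fourier (\<lambda>\<xi>. m \<xi> * fourier v \<xi>) x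
      = inverse_fourier (\<lambda>\<xi>. m \<xi> * fourier (\<lambda>x. u x - v x) \<xi>) x"
    by (simp add: fourier_diff[OF u v] right_diff_distrib inverse_fourier_diff[OF i[OF u] i[OF v]])
  also have "norm \<dots> \<le> ?c * (LINT \<xi>|lborel. norm (m \<xi> * fourier (\<lambda>x. u x - v x) \<xi>))"
    by (rule norm_inverse_fourier_le)
  also have "\<dots> \<le> ?c * (LINT \<xi>|lborel. norm (m \<xi>) * ?E)"
  proof (intro mult_left_mono integral_mono)
    show "norm (m \<xi> * fourier (\<lambda>x. u x - v x) \<xi>) \<le> norm (m \<xi>) * ?E" for \<xi>
      unfolding norm_mult Lp_int_1_eq by (intro mult_left_mono norm_fourier_le) auto
    show "integrable lborel (\<lambda>\<xi>. norm (m \<xi> * fourier (\<lambda>x. u x - v x) \<xi>))"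
      using i[of "\<lambda>x. u x - v x"] u v by simp
  qed (use m in auto)
  finally show ?thesis by (simp add: mult.assoc)
qed

text \<open>Approximating \<open>u\<close> simultaneously in L^p and in L^1 gives two limits of the
  same images: \<open>T u\<close> in L^p by boundedness, and the integral formula pointwise.\<close>

lemma operator_on_integrable:
  fixes m u :: "'a::euclidean_space \<Rightarrow> complex"
  assumes p: "p \<ge> 1" and T: "bounded_Lp_operator p T" and m: "integrable lborel m"
    and agree: "\<And>g. gauss_poly 0 g \<Longrightarrow> AE x in lborel. T (\<lambda>x. of_real (gauss x) * g x) x
      = inverse_fourier (\<lambda>\<xi>. m \<xi> * fourier (\<lambda>x. of_real (gauss x) * g x) \<xi>) x"
    and u: "u \<in> Lp_space p" and iu: "integrable lborel u"
  shows "AE x in lborel. T u x = inverse_fourier (\<lambda>\<xi>. m \<xi> * fourier u \<xi>) x"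
proof -
  obtain g where g: "\<And>n::nat. gauss_poly 0 (g n)"
    and lim: "(\<lambda>n. Lp_int p (\<lambda>x. of_real (gauss x) * g n x - u x)) \<longlonglongrightarrow> 0"
      "(\<lambda>n. Lp_int 1 (\<lambda>x. of_real (gauss x) * g n x - u x)) \<longlonglongrightarrow> 0"
    by (rule gauss_poly_dense_seq[OF p _ u, of 1]) (use iu in \<open>auto simp: integrable_iff_Lp_1\<close>)
  let ?s = "\<lambda>n x. of_real (gauss x) * g n x"
  have s: "?s n \<in> Lp_space p" "integrable lborel (?s n)" for n
    using gauss_mult_poly_in_Lp[OF _ g] p by (auto simp: integrable_iff_Lp_1)
  have im: "integrable lborel (\<lambda>\<xi>. m \<xi> * fourier u \<xi>)"
    by (rule integrable_mult_bounded[OF m _ norm_fourier_le]) (use measurable_fourier[OF iu] in simp)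
  show ?thesis
  proof (rule Lp_AE_eqI[OF p bounded_Lp_operator_space[OF T s(1)] bounded_Lp_operator_space[OF T u]
        measurable_inverse_fourier[OF im] bounded_Lp_operator_tendsto[OF p T s(1) u lim(1)]])
    have "AE x in lborel. \<forall>n. T (?s n) x = inverse_fourier (\<lambda>\<xi>. m \<xi> * fourier (?s n) \<xi>) x"
      unfolding AE_all_countable by (intro allI agree g)
    then show "AE x in lborel. (\<lambda>n. T (?s n) x) \<longlonglongrightarrow> inverse_fourier (\<lambda>\<xi>. m \<xi> * fourier u \<xi>) x"
    proof eventually_elim
      fix x assume eq: "\<forall>n. T (?s n) x = inverse_fourier (\<lambda>\<xi>. m \<xi> * fourier (?s n) \<xi>) x"
      let ?C = "inverse ((2 * pi) ^ DIM('a)) * (LINT \<xi>|lborel. norm (m \<xi>))"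
      have "(\<lambda>n. ?C * Lp_int 1 (\<lambda>x. ?s n x - u x)) \<longlonglongrightarrow> ?C * 0" by (intro tendsto_intros lim)
      then have l0: "(\<lambda>n. ?C * Lp_int 1 (\<lambda>x. ?s n x - u x)) \<longlonglongrightarrow> 0" by simp
      have "(\<lambda>n. T (?s n) x - inverse_fourier (\<lambda>\<xi>. m \<xi> * fourier u \<xi>) x) \<longlonglongrightarrow> 0"
        by (rule Lim_null_comparison[OF _ l0])
           (use inverse_fourier_multiplier_diff_le[OF m s(2) iu] eq in \<open>auto intro!: always_eventually\<close>)
      then show "(\<lambda>n. T (?s n) x) \<longlonglongrightarrow> inverse_fourier (\<lambda>\<xi>. m \<xi> * fourier u \<xi>) x"
        by (rule LIM_zero_cancel)
    qed
  qed
qed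

text \<open>By symmetry the mollification moves from \<open>h\<close>, which is merely integrable,
  to the symbol times a character, which is bounded and continuous.\<close>

lemma inverse_fourier_mollify_tendsto:
  fixes m h :: "'a::euclidean_space \<Rightarrow> complex"
  assumes h: "integrable lborel h" and m: "continuous_on UNIV m" and B: "\<And>\<xi>. norm (m \<xi>) \<le> B"
    and e: "\<epsilon> \<longlonglongrightarrow> 0"
  shows "(\<lambda>n. inverse_fourier (\<lambda>\<xi>. m \<xi> * mollify (\<epsilon> n) h \<xi>) x) \<longlonglongrightarrow> inverse_fourier (\<lambda>\<xi>. m \<xi> * h \<xi>) x"
proof -
  let ?M = "\<lambda>\<xi>. m \<xi> * cis (\<xi> \<bullet> x)"
  have Mc: "continuous_on UNIV ?M" by (intro continuous_intros m)
  then have [measurable]: "?M \<in> borel_measurable borel" by (rule borel_measurable_continuous_onI)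
  have [measurable]: "m \<in> borel_measurable borel" using m by (rule borel_measurable_continuous_onI)
  have [measurable]: "h \<in> borel_measurable borel" using h by auto
  have [measurable]: "mollify \<epsilon> ?M \<in> borel_measurable borel" for \<epsilon>
    unfolding mollify_def[abs_def] by measurable
  have MB: "norm (?M \<xi>) \<le> B" for \<xi> using B by (simp add: norm_mult)
  have "(\<lambda>n. LINT \<xi>|lborel. h \<xi> * mollify (\<epsilon> n) ?M \<xi>) \<longlonglongrightarrow> (LINT \<xi>|lborel. h \<xi> * ?M \<xi>)"
  proof (rule integral_dominated_convergence[where w="\<lambda>\<xi>. norm (h \<xi>) * B"])
    have "(\<lambda>n. mollify (\<epsilon> n) ?M \<xi>) \<longlonglongrightarrow> ?M \<xi>" for \<xi>
      using Mc by (intro mollify_tendsto[OF _ MB _ e]) (auto simp: continuous_on_eq_continuous_at)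
    then show "AE \<xi> in lborel. (\<lambda>n. h \<xi> * mollify (\<epsilon> n) ?M \<xi>) \<longlonglongrightarrow> h \<xi> * ?M \<xi>"
      by (intro AE_I2 tendsto_intros)
    show "AE \<xi> in lborel. norm (h \<xi> * mollify (\<epsilon> n) ?M \<xi>) \<le> norm (h \<xi>) * B" for n
      unfolding norm_mult by (intro AE_I2 mult_left_mono norm_mollify_le MB) auto
  qed (use h in auto)
  moreover have "(LINT \<xi>|lborel. h \<xi> * mollify (\<epsilon> n) ?M \<xi>) = (LINT \<xi>|lborel. ?M \<xi> * mollify (\<epsilon> n) h \<xi>)" for n
    by (rule integral_mult_mollify[OF h _ MB, symmetric]) measurable
  ultimately show ?thesis
    unfolding inverse_fourier_def by (intro tendsto_scaleR tendsto_const) (simp add: ac_simps)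
qed

text \<open>An element of \<open>L\<^sup>p\<close> with integrable Fourier transform \<open>h\<close> is approximated by its products with
  wide Gaussians. These are integrable, and their Fourier transforms are mollifications of \<open>h\<close>.\<close>

theorem Lp_multiplierI:
  fixes m :: "'a::euclidean_space \<Rightarrow> complex"
  assumes p: "p \<ge> 1" and T: "bounded_Lp_operator p T"
    and m: "continuous_on UNIV m" "\<And>\<xi>. norm (m \<xi>) \<le> B" "integrable lborel m"
    and agree: "\<And>g. gauss_poly 0 g \<Longrightarrow> AE x in lborel. T (\<lambda>x. of_real (gauss x) * g x) x
      = inverse_fourier (\<lambda>\<xi>. m \<xi> * fourier (\<lambda>x. of_real (gauss x) * g x) \<xi>) x"
  shows "Lp_multiplier p m T"
  unfolding Lp_multiplier_def
proof (intro conjI allI impI T)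
  show mm[measurable]: "m \<in> borel_measurable borel" using m(1) by (rule borel_measurable_continuous_onI)
  show "\<exists>B. \<forall>\<xi>. norm (m \<xi>) \<le> B" using m(2) by blast
  fix h :: "'a \<Rightarrow> complex" assume h: "integrable lborel h" and gL: "inverse_fourier h \<in> Lp_space p"
  let ?g = "inverse_fourier h"
  let ?e = "\<lambda>n. 1 / real (Suc n)"
  let ?u = "\<lambda>n x. ?g x * of_real (gauss (?e n *\<^sub>R x))"
  have e: "?e \<longlonglongrightarrow> 0" by (rule LIMSEQ_Suc[OF lim_const_over_n[of 1]])
  have [measurable]: "h \<in> borel_measurable borel" "?g \<in> borel_measurable borel"
    using h measurable_inverse_fourier[OF h] by auto
  have le_g: "norm (?u n x) \<le> norm (?g x)" for n x
    by (simp add: norm_mult mult_left_le)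
  have uL: "?u n \<in> Lp_space p" for n
    by (rule Lp_space_bound(1)[OF _ Lp_spaceD(2)[OF gL]])
       (use p le_g in \<open>auto intro!: AE_I2 powr_mono2\<close>)
  have iu: "integrable lborel (?u n)" for n
  proof -
    have ig: "integrable lborel (\<lambda>x::'a. complex_of_real (gauss (?e n *\<^sub>R x)))"
      using integrable_scale_shift[OF integrable_gauss_complex, of "?e n" 0] by simp
    have "integrable lborel (\<lambda>x. complex_of_real (gauss (?e n *\<^sub>R x)) * ?g x)"
      by (rule integrable_mult_bounded[OF ig _ norm_inverse_fourier_le]) measurable
    then show ?thesis by (simp add: mult.commute)
  qed
  have lim: "(\<lambda>n. ?u n x - ?g x) \<longlonglongrightarrow> 0" for x
  proof -
    have "(\<lambda>n. gauss (?e n *\<^sub>R x)) \<longlonglongrightarrow> gauss (0 *\<^sub>R x)"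
      using continuous_on_gauss[OF continuous_on_id, of UNIV]
      by (intro isCont_tendsto_compose[where g=gauss] tendsto_intros e)
         (auto simp: continuous_on_eq_continuous_at)
    then have "(\<lambda>n. ?u n x - ?g x) \<longlonglongrightarrow> ?g x * of_real (gauss (0 *\<^sub>R x)) - ?g x"
      by (intro tendsto_intros)
    then show ?thesis by simp
  qed
  have conv: "(\<lambda>n. Lp_int p (\<lambda>x. ?u n x - ?g x)) \<longlonglongrightarrow> 0"
  proof (rule Lp_int_dominated_tendsto_0)
    show "integrable lborel (\<lambda>x. 2 powr p * norm (?g x) powr p)"
      using Lp_spaceD(2)[OF gL] by simp
    show "norm (?u n x - ?g x) powr p \<le> 2 powr p * norm (?g x) powr p" for n x
    proof -
      have "norm (?u n x - ?g x) \<le> 2 * norm (?g x)"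
        using norm_triangle_ineq4[of "?u n x" "?g x"] le_g[of x n] by simp
      then have "norm (?u n x - ?g x) powr p \<le> (2 * norm (?g x)) powr p"
        using p by (intro powr_mono2) auto
      then show ?thesis by (simp add: powr_mult)
    qed
    show "p > 0" using p by simp
    show "(\<lambda>x. ?u n x - ?g x) \<in> borel_measurable borel" for n by measurable
    show "AE x in lborel. (\<lambda>n. ?u n x - ?g x) \<longlonglongrightarrow> 0" by (intro AE_I2 lim)
  qed
  have mh: "integrable lborel (\<lambda>\<xi>. m \<xi> * h \<xi>)"
    using integrable_mult_bounded[OF h _ m(2)] by (simp add: mult.commute)
  show "AE x in lborel. T ?g x = inverse_fourier (\<lambda>\<xi>. m \<xi> * h \<xi>) x"
  proof (rule Lp_AE_eqI[OF p bounded_Lp_operator_space[OF T uL] bounded_Lp_operator_space[OF T gL]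
        measurable_inverse_fourier[OF mh] bounded_Lp_operator_tendsto[OF p T uL gL conv]])
    have "AE x in lborel. \<forall>n. T (?u n) x = inverse_fourier (\<lambda>\<xi>. m \<xi> * fourier (?u n) \<xi>) x"
      unfolding AE_all_countable by (intro allI operator_on_integrable[OF p T m(3) agree uL iu])
    then show "AE x in lborel. (\<lambda>n. T (?u n) x) \<longlonglongrightarrow> inverse_fourier (\<lambda>\<xi>. m \<xi> * h \<xi>) x"
    proof eventually_elim
      fix x assume eq: "\<forall>n. T (?u n) x = inverse_fourier (\<lambda>\<xi>. m \<xi> * fourier (?u n) \<xi>) x"
      have "fourier (?u n) \<xi> = mollify (?e n) h \<xi>" for n \<xi>
        by (rule fourier_gauss_inverse_fourier[OF h]) simp
      then show "(\<lambda>n. T (?u n) x) \<longlonglongrightarrow> inverse_fourier (\<lambda>\<xi>. m \<xi> * h \<xi>) x"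
        using inverse_fourier_mollify_tendsto[OF h m(1,2) e, of x] eq by simp
    qed
  qed
qed

lemma gauss_mult_poly_schwartz: "gauss_poly 0 g \<Longrightarrow> schwartz (\<lambda>x. of_real (gauss x) * g x)"
  using schwartz_gauss_poly[of 0 g] by simp

text \<open>Gaussians times \<open>gauss_poly\<close> functions form a dense linear space
  \<open>D\<close> of Schwartz functions. The operator is extended from \<open>D\<close>, and
  \<open>Lp_multiplierI\<close> then recovers the formula on the larger class.\<close>

theorem Lp_multiplier_exists:
  fixes m :: "'a::euclidean_space \<Rightarrow> complex"
  assumes p: "p \<ge> 1" and m: "continuous_on UNIV m" "\<And>\<xi>. norm (m \<xi>) \<le> B" "integrable lborel m"
    and bd: "\<And>s. schwartz s \<Longrightarrow> inverse_fourier (\<lambda>\<xi>. m \<xi> * fourier s \<xi>) \<in> Lp_space p \<and>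
      Lp_int p (inverse_fourier (\<lambda>\<xi>. m \<xi> * fourier s \<xi>)) \<le> K * Lp_int p s" and K: "K \<ge> 0"
  shows "\<exists>T. Lp_multiplier p m T"
proof -
  define D :: "('a \<Rightarrow> complex) set" where "D = {\<lambda>x. of_real (gauss x) * g x |g. gauss_poly 0 g}"
  define T0 where "T0 s = inverse_fourier (\<lambda>\<xi>. m \<xi> * fourier s \<xi>)" for s
  have D_schwartz: "schwartz s" if "s \<in> D" for s
    using that by (auto simp: D_def gauss_mult_poly_schwartz)
  have D_int: "integrable lborel s" if "s \<in> D" for s
    by (intro decay_bounded_integrable schwartz_decay_bounded D_schwartz that)
  have i: "integrable lborel (\<lambda>\<xi>. m \<xi> * fourier s \<xi>)" if "s \<in> D" for s
    by (rule integrable_mult_bounded[OF m(3) _ norm_fourier_le]) (use measurable_fourier[OF D_int[OF that]] in simp)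
  have "\<exists>T. bounded_Lp_operator p T \<and> (\<forall>f\<in>D. AE x in lborel. T f x = T0 f x)"
  proof (rule Lp_operator_extension[OF p, where K=K])
    show "D \<subseteq> Lp_space p" using gauss_mult_poly_in_Lp[OF p] by (auto simp: D_def)
    fix f assume f: "f \<in> D"
    then obtain a where a: "f = (\<lambda>x. of_real (gauss x) * a x)" "gauss_poly 0 a" by (auto simp: D_def)
    show "(\<lambda>x. c * f x) \<in> D" for c
      unfolding D_def a(1)
      by (intro CollectI exI[of _ "\<lambda>x. c * a x"] conjI gauss_poly_mult gauss_poly_const a(2))
         (simp add: mult.left_commute)
    show "T0 f \<in> Lp_space p" "Lp_int p (T0 f) \<le> K * Lp_int p f"
      using bd[OF D_schwartz[OF f]] by (auto simp: T0_def)
    show "T0 (\<lambda>x. c * f x) x = c * T0 f x" for c x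
      by (simp add: T0_def fourier_cmult inverse_fourier_cmult mult.left_commute)
    fix g assume g: "g \<in> D"
    then obtain b where b: "g = (\<lambda>x. of_real (gauss x) * b x)" "gauss_poly 0 b" by (auto simp: D_def)
    show "(\<lambda>x. f x + g x) \<in> D"
      unfolding D_def a(1) b(1)
      by (intro CollectI exI[of _ "\<lambda>x. a x + b x"] conjI gauss_poly_add a(2) b(2))
         (simp add: distrib_left)
    show "T0 (\<lambda>x. f x + g x) x = T0 f x + T0 g x" for x
      by (simp add: T0_def fourier_add[OF D_int[OF f] D_int[OF g]] distrib_left
          inverse_fourier_add[OF i[OF f] i[OF g]])
  next
    fix u :: "'a \<Rightarrow> complex" and e :: real assume u: "u \<in> Lp_space p" and e: "e > 0"
    show "\<exists>s\<in>D. Lp_int p (\<lambda>x. u x - s x) < e"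
      using gauss_poly_dense[OF p p u u e] by (auto simp: D_def Lp_near_def)
  qed (rule K)
  then obtain T where T: "bounded_Lp_operator p T" "\<And>f. f \<in> D \<Longrightarrow> AE x in lborel. T f x = T0 f x" by blast
  have "Lp_multiplier p m T"
    by (rule Lp_multiplierI[OF p T(1) m]) (use T(2) in \<open>auto simp: D_def T0_def\<close>)
  then show ?thesis by blast
qed

text \<open>Uniqueness of distributional transforms identifies the image with an inverse Fourier
  integral. The symbol \<open>n\<close> may be changed on a null set, which allows passage to an
  everywhere bounded representative \<open>m\<close>.\<close>

lemma multiplier_bounded_imp_bound:
  fixes n m :: "'a::euclidean_space \<Rightarrow> complex"
  assumes p: "p \<ge> 1" and n: "multiplier_bounded p n" and [measurable]: "n \<in> borel_measurable borel"
    and [measurable]: "m \<in> borel_measurable borel" and eq: "AE \<xi> in lborel. n \<xi> = m \<xi>" and B: "\<And>\<xi>. norm (m \<xi>) \<le> B"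
  obtains K where "K \<ge> 0" "\<And>s. schwartz s \<Longrightarrow> inverse_fourier (\<lambda>\<xi>. m \<xi> * fourier s \<xi>) \<in> Lp_space p \<and>
      Lp_int p (inverse_fourier (\<lambda>\<xi>. m \<xi> * fourier s \<xi>)) \<le> K * Lp_int p s"
proof -
  obtain C where C: "\<And>f. schwartz f \<Longrightarrow>
      \<exists>g\<in>Lp_space p. multiplier_image n f g \<and> Lp_norm p g \<le> C * Lp_norm p f"
    using n unfolding multiplier_bounded_def by blast
  show ?thesis
  proof (rule that[of "(max C 0) powr p"])
    fix s :: "'a \<Rightarrow> complex" assume s: "schwartz s"
    obtain g where g: "g \<in> Lp_space p" "has_fourier_transform g (\<lambda>\<xi>. n \<xi> * fourier s \<xi>)"
      "Lp_norm p g \<le> C * Lp_norm p s"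
      using C[OF s] by (auto simp: multiplier_image_def)
    have ifs: "integrable lborel (fourier s)"
      by (intro decay_bounded_integrable fourier_decay_bounded schwartz_decaying s)
    then have [measurable]: "fourier s \<in> borel_measurable borel" using ifs by auto
    have im: "integrable lborel (\<lambda>\<xi>. m \<xi> * fourier s \<xi>)"
    proof -
      have "integrable lborel (\<lambda>\<xi>. fourier s \<xi> * m \<xi>)"
        by (rule integrable_mult_bounded[OF ifs _ B]) measurable
      then show ?thesis by (simp add: mult.commute)
    qed
    have eq': "AE \<xi> in lborel. m \<xi> * fourier s \<xi> = n \<xi> * fourier s \<xi>"
      using eq by eventually_elim simp
    have "integrable lborel (\<lambda>\<xi>. n \<xi> * fourier s \<xi>)"
      by (rule integrable_cong_AE_imp[OF im]) (use eq in \<open>auto elim!: eventually_mono\<close>)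
    from has_fourier_transform_unique[OF p g(1) this g(2)]
    have "AE x in lborel. g x = inverse_fourier (\<lambda>\<xi>. n \<xi> * fourier s \<xi>) x" .
    moreover have "inverse_fourier (\<lambda>\<xi>. n \<xi> * fourier s \<xi>) x = inverse_fourier (\<lambda>\<xi>. m \<xi> * fourier s \<xi>) x" for x
      unfolding inverse_fourier_def
      by (intro arg_cong2[where f=scaleR] refl integral_cong_AE) (use eq in \<open>auto elim!: eventually_mono\<close>)
    ultimately have ge: "AE x in lborel. inverse_fourier (\<lambda>\<xi>. m \<xi> * fourier s \<xi>) x = g x"
      by (auto elim!: eventually_mono)
    show "inverse_fourier (\<lambda>\<xi>. m \<xi> * fourier s \<xi>) \<in> Lp_space p \<and>
        Lp_int p (inverse_fourier (\<lambda>\<xi>. m \<xi> * fourier s \<xi>)) \<le> (max C 0) powr p * Lp_int p s"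
      using Lp_space_cong_AE[OF g(1) measurable_inverse_fourier[OF im] ge]
        Lp_int_cong_AE[OF g(1) measurable_inverse_fourier[OF im] ge] Lp_int_le_of_norm_le[OF p g(3)] by simp
  qed simp
qed

lemma Lp_multiplier_schwartz:
  assumes p: "p \<ge> 1" and T: "Lp_multiplier p m T" and f: "schwartz f"
  shows "AE x in lborel. T f x = inverse_fourier (\<lambda>\<xi>. m \<xi> * fourier f \<xi>) x"
    and "multiplier_image m f (T f)"
proof -
  note dec = schwartz_decaying[OF f]
  have ff: "integrable lborel (fourier f)"
    by (intro decay_bounded_integrable fourier_decay_bounded dec)
  have inv: "inverse_fourier (fourier f) = f"
    using decaying_inversion(1)[OF dec] by (intro ext)
  have fL: "f \<in> Lp_space p" by (intro decay_bounded_in_Lp[OF p] schwartz_decay_bounded f)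
  show eq: "AE x in lborel. T f x = inverse_fourier (\<lambda>\<xi>. m \<xi> * fourier f \<xi>) x"
    using Lp_multiplierD(4)[OF T ff] by (simp add: inv fL)
  have i: "integrable lborel (\<lambda>\<xi>. m \<xi> * fourier f \<xi>)"
    by (rule Lp_multiplier_integrable[OF T ff])
  show "multiplier_image m f (T f)"
    unfolding multiplier_image_def
    by (rule has_fourier_transform_cong_AE[OF has_fourier_transform_inverse_fourier[OF i] eq])
       (use Lp_spaceD(1)[OF bounded_Lp_operator_space[OF Lp_multiplierD(1)[OF T] fL]] measurable_inverse_fourier[OF i] in auto)
qed

lemma Lp_multiplier_imp_extension:
  "p \<ge> 1 \<Longrightarrow> Lp_multiplier p m T \<Longrightarrow> multiplier_extension p m T"
  by (simp add: multiplier_extension_def Lp_multiplierD(1) Lp_multiplier_schwartz(2))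

lemma Lp_multiplier_imp_bounded:
  assumes p: "p \<ge> 1" and T: "Lp_multiplier p m T"
  shows "multiplier_bounded p m"
proof -
  note b = Lp_multiplierD(1)[OF T]
  obtain C where C: "\<And>f. f \<in> Lp_space p \<Longrightarrow> Lp_norm p (T f) \<le> C * Lp_norm p f"
    using b unfolding bounded_Lp_operator_def by blast
  show ?thesis
    unfolding multiplier_bounded_def
  proof (intro exI[of _ C] allI impI)
    fix f :: "'a \<Rightarrow> complex" assume f: "schwartz f"
    have fL: "f \<in> Lp_space p" by (intro decay_bounded_in_Lp[OF p] schwartz_decay_bounded f)
    show "\<exists>g\<in>Lp_space p. multiplier_image m f g \<and> Lp_norm p g \<le> C * Lp_norm p f"
      using C[OF fL] Lp_multiplier_schwartz(2)[OF p T f] bounded_Lp_operator_space[OF b fL] by blast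
  qed
qed

text \<open>The defining identity settles Schwartz functions, and density with continuity settles
  the rest. Through this, identities between symbols become identities between operators on all of
  L^p.\<close>

lemma Lp_multiplier_1_AE:
  fixes T :: "('a::euclidean_space \<Rightarrow> complex) \<Rightarrow> 'a \<Rightarrow> complex"
  assumes p: "p \<ge> 1" and T: "Lp_multiplier p (\<lambda>\<xi>. 1) T" and f: "f \<in> Lp_space p"
  shows "AE x in lborel. T f x = f x"
proof -
  note b = Lp_multiplierD(1)[OF T]
  obtain g where g: "\<And>n::nat. gauss_poly 0 (g n)"
    and lim: "(\<lambda>n. Lp_int p (\<lambda>x. of_real (gauss x) * g n x - f x)) \<longlonglongrightarrow> 0"
  proof (rule gauss_poly_dense_seq[OF p p f f])
    fix g :: "nat \<Rightarrow> 'a \<Rightarrow> complex"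
    assume "\<And>n. gauss_poly 0 (g n)" "(\<lambda>n. Lp_int p (\<lambda>x. of_real (gauss x) * g n x - f x)) \<longlonglongrightarrow> 0"
    then show thesis by (rule that)
  qed
  let ?s = "\<lambda>n x. of_real (gauss x) * g n x"
  have s: "?s n \<in> Lp_space p" for n by (rule gauss_mult_poly_in_Lp[OF p g])
  have Ts: "AE x in lborel. ?s n x = T (?s n) x" for n
    using Lp_multiplier_schwartz(1)[OF p T gauss_mult_poly_schwartz[OF g[of n]]]
    by eventually_elim
      (simp add: decaying_inversion(1)[OF schwartz_decaying[OF gauss_mult_poly_schwartz[OF g[of n]]]])
  have "Lp_int p (\<lambda>x. ?s n x - T f x) = Lp_int p (\<lambda>x. T (?s n) x - T f x)" for n
  proof (rule Lp_int_cong_AE)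
    show "(\<lambda>x. T (?s n) x - T f x) \<in> Lp_space p" "(\<lambda>x. ?s n x - T f x) \<in> borel_measurable borel"
      using p by (intro Lp_space_diff Lp_spaceD(1)[of _ p] bounded_Lp_operator_space[OF b] s f; simp)+
    show "AE x in lborel. ?s n x - T f x = T (?s n) x - T f x"
      using Ts[of n] by eventually_elim simp
  qed
  then have lim': "(\<lambda>n. Lp_int p (\<lambda>x. ?s n x - T f x)) \<longlonglongrightarrow> 0"
    using bounded_Lp_operator_tendsto[OF p b s f lim] by simp
  have "Lp_int p (\<lambda>x. T f x - f x) \<le> 0"
  proof (rule LIMSEQ_le_const)
    show "(\<lambda>n. 2 powr p * (Lp_int p (\<lambda>x. ?s n x - T f x) + Lp_int p (\<lambda>x. ?s n x - f x))) \<longlonglongrightarrow> 0"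
      using tendsto_mult[OF tendsto_const tendsto_add[OF lim' lim], of "2 powr p"] by simp
    have "Lp_int p (\<lambda>x. T f x - f x) \<le> 2 powr p * (Lp_int p (\<lambda>x. ?s n x - T f x) + Lp_int p (\<lambda>x. ?s n x - f x))" for n
      using Lp_int_triangle3[OF _ bounded_Lp_operator_space[OF b f] s[of n] f] p
      by (simp add: Lp_int_minus_commute[of p "T f"])
    then show "\<exists>N. \<forall>n\<ge>N. Lp_int p (\<lambda>x. T f x - f x)
        \<le> 2 powr p * (Lp_int p (\<lambda>x. ?s n x - T f x) + Lp_int p (\<lambda>x. ?s n x - f x))" by blast
  qed
  then have "AE x in lborel. T f x - f x = 0"
    using p by (intro Lp_int_eq_0_imp_AE[of _ p] Lp_space_diff bounded_Lp_operator_space[OF b] f)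
      (auto intro: antisym)
  then show ?thesis by eventually_elim simp
qed

section \<open>Operator bounds dominate continuous symbols\<close>

lemma
  fixes k :: "'a::euclidean_space \<Rightarrow> complex"
  assumes [measurable]: "k \<in> borel_measurable borel" and r: "r > 0"
  shows Lp_int_modulate: "Lp_int p (\<lambda>x. a * cis (y \<bullet> x) * k (r *\<^sub>R x)) = norm a powr p / r ^ DIM('a) * Lp_int p k"
    and Lp_space_modulate: "k \<in> Lp_space p \<Longrightarrow> (\<lambda>x. a * cis (y \<bullet> x) * k (r *\<^sub>R x)) \<in> Lp_space p"
proof -
  have eq: "norm (a * cis (y \<bullet> x) * k (r *\<^sub>R x)) powr p = norm a powr p * norm (k (r *\<^sub>R x)) powr p" for x
    by (simp add: norm_mult powr_mult)
  have "Lp_int p k = r ^ DIM('a) * (LINT x|lborel. norm (k (r *\<^sub>R x)) powr p)"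
    using integral_scale_shift[of "\<lambda>x. norm (k x) powr p" r 0] r by (simp add: Lp_int_def)
  then show "Lp_int p (\<lambda>x. a * cis (y \<bullet> x) * k (r *\<^sub>R x)) = norm a powr p / r ^ DIM('a) * Lp_int p k"
    using r by (simp add: Lp_int_def eq)
  assume k: "k \<in> Lp_space p"
  have "integrable lborel (\<lambda>x. norm (k (r *\<^sub>R x)) powr p)"
    using integrable_scale_shift[OF Lp_spaceD(2)[OF k], of r 0] r by simp
  then show "(\<lambda>x. a * cis (y \<bullet> x) * k (r *\<^sub>R x)) \<in> Lp_space p"
    by (simp add: Lp_space_def eq)
qed

lemma inverse_fourier_modulate:
  fixes h :: "'a::euclidean_space \<Rightarrow> complex"
  assumes [measurable]: "h \<in> borel_measurable borel" and r: "r > 0"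
  shows "inverse_fourier (\<lambda>\<xi>. h ((1 / r) *\<^sub>R (\<xi> - y))) x
    = of_real (r ^ DIM('a)) * cis (y \<bullet> x) * inverse_fourier h (r *\<^sub>R x)"
proof -
  have "(LINT \<xi>|lborel. h ((1 / r) *\<^sub>R (\<xi> - y)) * cis (\<xi> \<bullet> x))
      = r ^ DIM('a) *\<^sub>R (LINT \<eta>|lborel. h ((1 / r) *\<^sub>R ((y + r *\<^sub>R \<eta>) - y)) * cis ((y + r *\<^sub>R \<eta>) \<bullet> x))"
    using r by (subst integral_scale_shift[of _ r y]) auto
  also have "\<dots> = r ^ DIM('a) *\<^sub>R (LINT \<eta>|lborel. (h \<eta> * cis (\<eta> \<bullet> (r *\<^sub>R x))) * cis (y \<bullet> x))"
  proof -
    have "cis ((y + r *\<^sub>R \<eta>) \<bullet> x) = cis (\<eta> \<bullet> (r *\<^sub>R x)) * cis (y \<bullet> x)" for \<eta>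
      by (simp add: cis_mult inner_left_distrib add.commute)
    then show ?thesis using r by (simp add: mult.assoc)
  qed
  also have "\<dots> = r ^ DIM('a) *\<^sub>R ((LINT \<eta>|lborel. h \<eta> * cis (\<eta> \<bullet> (r *\<^sub>R x))) * cis (y \<bullet> x))"
    by (simp only: Bochner_Integration.integral_mult_left_zero)
  finally show ?thesis
    unfolding inverse_fourier_def by (simp add: scaleR_conv_of_real)
qed

text \<open>Testing with modulated Gaussians whose Fourier transforms concentrate at \<open>y\<close>.\<close>

theorem Lp_multiplier_symbol_le:
  fixes n :: "'a::euclidean_space \<Rightarrow> complex"
  assumes p: "p \<ge> 1" and S: "Lp_multiplier p n S" and n: "continuous_on UNIV n"
    and C: "\<And>f. f \<in> Lp_space p \<Longrightarrow> Lp_int p (S f) \<le> C * Lp_int p f"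
  shows "norm (n y) powr p \<le> C"
proof -
  let ?e = "\<lambda>k. 1 / real (Suc k)"
  let ?a = "\<lambda>\<xi>::'a. complex_of_real (gauss \<xi>)"
  let ?\<phi> = "inverse_fourier ?a"
  have e: "?e \<longlonglongrightarrow> 0" by (rule LIMSEQ_Suc[OF lim_const_over_n[of 1]])
  obtain B where B: "\<And>\<xi>. norm (n \<xi>) \<le> B" using Lp_multiplierD(3)[OF S] by blast
  have [measurable]: "n \<in> borel_measurable borel" by (rule Lp_multiplierD(2)[OF S])
  have sg: "schwartz ?a" using gauss_mult_poly_schwartz[OF gauss_poly_const, of 1] by simp
  have \<phi>: "?\<phi> \<in> Lp_space p"
    by (intro decay_bounded_in_Lp[OF p] decay_bounded_inverse_fourier schwartz_decaying sg)
  note [measurable] = Lp_spaceD(1)[OF \<phi>]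
  \<comment> \<open>The symbol seen through a window of width \<open>?e k\<close> around
    \<open>y\<close>, with the Gaussian as profile; as k grows it tends to the constant n y times
    the Gaussian.\<close>
  define h where "h k \<eta> = n (y + ?e k *\<^sub>R \<eta>) * ?a \<eta>" for k \<eta>
  have hm[measurable]: "h k \<in> borel_measurable borel" for k unfolding h_def by measurable
  have "integrable lborel (\<lambda>\<eta>. ?a \<eta> * n (y + ?e k *\<^sub>R \<eta>))" for k
    by (rule integrable_mult_bounded[OF integrable_gauss_complex _ B]) measurable
  then have hi: "integrable lborel (h k)" for k
    by (simp add: h_def[abs_def] mult.commute)
  note [measurable] = measurable_inverse_fourier[OF hi]
  have hk: "inverse_fourier (h k) \<in> Lp_space p \<and> Lp_int p (inverse_fourier (h k)) \<le> C * Lp_int p ?\<phi>" for k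
  proof -
    let ?r = "?e k"
    have r: "?r > 0" by simp
    \<comment> \<open>Modulation and dilation multiply the \<open>Lp_int\<close> of input and output
      by this same factor, which therefore cancels from the operator bound.\<close>
    define b where "b = norm (complex_of_real (?r ^ DIM('a))) powr p / ?r ^ DIM('a)"
    have "norm (complex_of_real t) powr p / t > 0" if "t > 0" for t using that by simp
    from this[OF zero_less_power[OF r]] have b: "b > 0" unfolding b_def .
    let ?D = "\<lambda>h \<xi>. h ((1 / ?r) *\<^sub>R (\<xi> - y))"
    have iD: "integrable lborel (?D ?a)"
    proof -
      have "integrable lborel (\<lambda>\<xi>. ?a (- ((1 / ?r) *\<^sub>R y) + (1 / ?r) *\<^sub>R \<xi>))"
        by (rule integrable_scale_shift[OF integrable_gauss_complex]) simp
      then show ?thesis by (simp add: scaleR_diff_right)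
    qed
    have eqa: "inverse_fourier (?D ?a) = (\<lambda>x. of_real (?r ^ DIM('a)) * cis (y \<bullet> x) * ?\<phi> (?r *\<^sub>R x))"
      by (intro ext inverse_fourier_modulate r) measurable
    have "(\<lambda>\<xi>. n \<xi> * ?D ?a \<xi>) = ?D (h k)"
      using r by (auto simp: h_def fun_eq_iff)
    then have eqh: "inverse_fourier (\<lambda>\<xi>. n \<xi> * ?D ?a \<xi>)
        = (\<lambda>x. of_real (?r ^ DIM('a)) * cis (y \<bullet> x) * inverse_fourier (h k) (?r *\<^sub>R x))"
      by (simp only:) (intro ext inverse_fourier_modulate r hm)
    have aL: "inverse_fourier (?D ?a) \<in> Lp_space p"
      unfolding eqa by (rule Lp_space_modulate[OF _ r \<phi>]) measurable
    note SL = bounded_Lp_operator_space[OF Lp_multiplierD(1)[OF S] aL]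
    have "AE x in lborel. inverse_fourier (\<lambda>\<xi>. n \<xi> * ?D ?a \<xi>) x = S (inverse_fourier (?D ?a)) x"
      using Lp_multiplierD(4)[OF S iD aL] by eventually_elim simp
    note cong = SL measurable_inverse_fourier[OF Lp_multiplier_integrable[OF S iD]] this
    have vL: "inverse_fourier (\<lambda>\<xi>. n \<xi> * ?D ?a \<xi>) \<in> Lp_space p"
      by (rule Lp_space_cong_AE[OF cong])
    have "Lp_int p (inverse_fourier (\<lambda>\<xi>. n \<xi> * ?D ?a \<xi>)) \<le> C * Lp_int p (inverse_fourier (?D ?a))"
      using C[OF aL] by (simp only: Lp_int_cong_AE[OF cong])
    then have "b * Lp_int p (inverse_fourier (h k)) \<le> C * (b * Lp_int p ?\<phi>)"
      unfolding eqa eqh b_def Lp_int_modulate[OF Lp_spaceD(1)[OF \<phi>] r]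
        Lp_int_modulate[OF measurable_inverse_fourier[OF hi] r] .
    then have "b * Lp_int p (inverse_fourier (h k)) \<le> b * (C * Lp_int p ?\<phi>)"
      by (simp only: mult.left_commute)
    then have le: "Lp_int p (inverse_fourier (h k)) \<le> C * Lp_int p ?\<phi>"
      by (simp only: mult_le_cancel_left_pos[OF b])
    \<comment> \<open>Undoing the dilation and the modulation places
      \<open>inverse_fourier (h k)\<close> itself in L^p.\<close>
    have "(\<lambda>x. of_real ((1 / ?r) ^ DIM('a)) * cis ((- (1 / ?r) *\<^sub>R y) \<bullet> x) *
        inverse_fourier (\<lambda>\<xi>. n \<xi> * ?D ?a \<xi>) ((1 / ?r) *\<^sub>R x)) \<in> Lp_space p"
      by (rule Lp_space_modulate[OF _ _ vL]) (use Lp_spaceD(1)[OF vL] in simp_all)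
    also have "(\<lambda>x. of_real ((1 / ?r) ^ DIM('a)) * cis ((- (1 / ?r) *\<^sub>R y) \<bullet> x) *
        inverse_fourier (\<lambda>\<xi>. n \<xi> * ?D ?a \<xi>) ((1 / ?r) *\<^sub>R x)) = inverse_fourier (h k)"
    proof
      fix x
      have 1: "cis ((- (1 / ?r) *\<^sub>R y) \<bullet> x) * cis (y \<bullet> ((1 / ?r) *\<^sub>R x)) = 1"
        by (simp add: cis_mult algebra_simps)
      have "complex_of_real ((1 / ?r) ^ DIM('a)) * of_real (?r ^ DIM('a)) = of_real ((1 / ?r * ?r) ^ DIM('a))"
        by (simp only: of_real_mult power_mult_distrib)
      also have "1 / ?r * ?r = 1" by simp
      finally have 2: "complex_of_real ((1 / ?r) ^ DIM('a)) * of_real (?r ^ DIM('a)) = 1"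
        by (simp only: power_one of_real_1)
      have "of_real ((1 / ?r) ^ DIM('a)) * cis ((- (1 / ?r) *\<^sub>R y) \<bullet> x) *
          inverse_fourier (\<lambda>\<xi>. n \<xi> * ?D ?a \<xi>) ((1 / ?r) *\<^sub>R x)
        = (complex_of_real ((1 / ?r) ^ DIM('a)) * of_real (?r ^ DIM('a))) *
          (cis ((- (1 / ?r) *\<^sub>R y) \<bullet> x) * cis (y \<bullet> ((1 / ?r) *\<^sub>R x))) *
          inverse_fourier (h k) (?r *\<^sub>R ((1 / ?r) *\<^sub>R x))"
        unfolding eqh by (simp only: mult_ac)
      also have "\<dots> = inverse_fourier (h k) x"
        unfolding 1 2 by simp
      finally show "of_real ((1 / ?r) ^ DIM('a)) * cis ((- (1 / ?r) *\<^sub>R y) \<bullet> x) *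
          inverse_fourier (\<lambda>\<xi>. n \<xi> * ?D ?a \<xi>) ((1 / ?r) *\<^sub>R x) = inverse_fourier (h k) x" .
    qed
    finally show ?thesis using le by simp
  qed
  have lim: "(\<lambda>k. inverse_fourier (h k) x) \<longlonglongrightarrow> n y * ?\<phi> x" for x
  proof -
    have "(\<lambda>k. LINT \<eta>|lborel. h k \<eta> * cis (\<eta> \<bullet> x)) \<longlonglongrightarrow> (LINT \<eta>|lborel. n y * ?a \<eta> * cis (\<eta> \<bullet> x))"
    proof (rule integral_dominated_convergence[where w="\<lambda>\<eta>::'a. B * gauss \<eta>"])
      have "(\<lambda>k. n (y + ?e k *\<^sub>R \<eta>)) \<longlonglongrightarrow> n (y + 0 *\<^sub>R \<eta>)" for \<eta>
        using n by (intro isCont_tendsto_compose[where g=n] tendsto_intros e)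
          (auto simp: continuous_on_eq_continuous_at)
      then have "(\<lambda>k. h k \<eta> * cis (\<eta> \<bullet> x)) \<longlonglongrightarrow> n (y + 0 *\<^sub>R \<eta>) * ?a \<eta> * cis (\<eta> \<bullet> x)" for \<eta>
        unfolding h_def by (intro tendsto_intros)
      then show "AE \<eta> in lborel. (\<lambda>k. h k \<eta> * cis (\<eta> \<bullet> x)) \<longlonglongrightarrow> n y * ?a \<eta> * cis (\<eta> \<bullet> x)" by simp
      show "AE \<eta> in lborel. norm (h k \<eta> * cis (\<eta> \<bullet> x)) \<le> B * gauss \<eta>" for k
        by (intro AE_I2) (simp add: h_def norm_mult mult_right_mono[OF B])
      show "integrable lborel (\<lambda>\<eta>::'a. B * gauss \<eta>)"
      by (intro integrable_mult_right integrable_gauss)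
  qed measurable
    then have "(\<lambda>k. inverse_fourier (h k) x) \<longlonglongrightarrow> inverse_fourier (\<lambda>\<eta>. n y * ?a \<eta>) x"
      unfolding inverse_fourier_def by (intro tendsto_intros)
    then show ?thesis by (simp add: inverse_fourier_cmult)
  qed
  have "Lp_int p (\<lambda>x. n y * ?\<phi> x) \<le> C * Lp_int p ?\<phi>"
    by (rule Lp_int_fatou(2)[of p "\<lambda>k. inverse_fourier (h k)"]) (use hk lim p in auto)
  then have *: "norm (n y) powr p * Lp_int p ?\<phi> \<le> C * Lp_int p ?\<phi>"
    by (simp add: Lp_int_cmult[OF \<phi>])
  \<comment> \<open>The profile is a positive multiple of a Gaussian and vanishes nowhere.\<close>
  have "Lp_int p ?\<phi> \<noteq> 0"
  proof
    assume "Lp_int p ?\<phi> = 0"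
    then have "AE x in lborel. ?\<phi> x = 0" using p by (intro Lp_int_eq_0_imp_AE[OF \<phi>]) auto
    moreover have "?\<phi> x \<noteq> 0" for x
      using less_imp_neq[OF gauss_pos[of x]] by (simp add: inverse_fourier_eq_fourier fourier_gauss)
    ultimately have "AE x in (lborel :: 'a measure). False" by simp
    then show False by (simp add: AE_iff_measurable[OF _ refl])
  qed
  then have "Lp_int p ?\<phi> > 0" using Lp_int_nonneg[of p ?\<phi>] by linarith
  then show ?thesis using * by simp
qed

section \<open>The spectrum of the Bochner-Riesz means\<close>

lemma DERIV_one_divide_power:
  fixes w :: "'a::real_normed_field"
  assumes w: "w \<noteq> 0"
  shows "((\<lambda>w. 1 / w ^ j) has_field_derivative - of_nat j / w ^ Suc j) (at w)"
proof (induction j)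
  case (Suc j)
  have "((\<lambda>w. 1 / w) has_field_derivative - (1 / w\<^sup>2)) (at w)"
    using w by (auto intro!: derivative_eq_intros simp: power2_eq_square)
  from DERIV_mult[OF Suc this]
  have "((\<lambda>w. 1 / w ^ Suc j) has_field_derivative
      - of_nat j / w ^ Suc j * (1 / w) + - (1 / w\<^sup>2) * (1 / w ^ j)) (at w)"
    by (simp add: mult.commute)
  also have "- of_nat j / w ^ Suc j * (1 / w) + - (1 / w\<^sup>2) * (1 / w ^ j) = - of_nat (Suc j) / w ^ Suc (Suc j)"
    using w by (simp add: field_simps power2_eq_square)
  finally show ?case .
qed simp

text \<open>Restricting to s \<le> 1 keeps the subtracted power in [0, 1], away from
  \<open>z\<close>. The exponent condition a > 1 is what makes the derivative vanish at the junction
  s = 0.\<close>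

lemma of_real_powr_quotient_derivative:
  fixes z :: complex and s :: real
  assumes z: "z \<notin> complex_of_real ` {0..1}" and \<delta>: "\<delta> > 0" and a: "a > 1" and s: "s \<le> 1"
  shows "((\<lambda>s. of_real (max s 0 powr a) / (z - of_real (max s 0 powr \<delta>)) ^ j) has_vector_derivative
    of_real a * (of_real (max s 0 powr (a - 1)) / (z - of_real (max s 0 powr \<delta>)) ^ j) +
    of_real (real j * \<delta>) * (of_real (max s 0 powr (a + \<delta> - 1)) / (z - of_real (max s 0 powr \<delta>)) ^ Suc j)) (at s)"
    (is "(?F has_vector_derivative ?D) _")
proof -
  have z0: "z \<noteq> 0" using z by force
  consider "s > 0" | "s < 0" | "s = 0" by linarith
  then show ?thesis
  proof cases
    case 1
    have nz: "z - of_real (s powr \<delta>) \<noteq> 0"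
    proof
      assume "z - of_real (s powr \<delta>) = 0"
      moreover have "s powr \<delta> \<in> {0..1}" using 1 s \<delta> by (auto intro: powr_le1)
      ultimately show False using z by auto
    qed
    have d1: "((\<lambda>s. complex_of_real (s powr a)) has_vector_derivative of_real (a * s powr (a - 1))) (at s)"
      by (rule has_vector_derivative_of_real[OF has_real_derivative_powr[OF 1]])
    have "((\<lambda>s. z - complex_of_real (s powr \<delta>)) has_vector_derivative 0 - of_real (\<delta> * s powr (\<delta> - 1))) (at s)"
      by (intro has_vector_derivative_diff has_vector_derivative_const
          has_vector_derivative_of_real[OF has_real_derivative_powr[OF 1]])
    moreover have "((\<lambda>w. 1 / w ^ j) has_field_derivative - of_nat j / (z - of_real (s powr \<delta>)) ^ Suc j)
        (at (z - of_real (s powr \<delta>)))"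
      by (rule DERIV_one_divide_power[OF nz])
    ultimately have "((\<lambda>w. 1 / w ^ j) \<circ> (\<lambda>s. z - complex_of_real (s powr \<delta>)) has_vector_derivative
        (0 - of_real (\<delta> * s powr (\<delta> - 1))) * (- of_nat j / (z - of_real (s powr \<delta>)) ^ Suc j)) (at s)"
      by (rule field_vector_diff_chain_at)
    note d = has_vector_derivative_mult[OF d1 this]
    have "s powr a * s powr (\<delta> - 1) = s powr (a + \<delta> - 1)"
      by (simp add: powr_add[symmetric] algebra_simps)
    then have e: "complex_of_real (s powr a) * of_real (s powr (\<delta> - 1)) = of_real (s powr (a + \<delta> - 1))"
      by (simp flip: of_real_mult)
    have alg: "A * ((0 - D * E) * (- J / W ^ Suc j)) + (a' * C) * (1 / W ^ j)
        = a' * (C / W ^ j) + (J * D) * ((A * E) / W ^ Suc j)" for A C D E J W a' :: complex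
      by (simp add: algebra_simps)
    let ?W = "z - of_real (s powr \<delta>)"
    have "((\<lambda>s. of_real (s powr a) / (z - of_real (s powr \<delta>)) ^ j) has_vector_derivative
        of_real (s powr a) * ((0 - of_real \<delta> * of_real (s powr (\<delta> - 1))) * (- of_nat j / ?W ^ Suc j)) +
        (of_real a * of_real (s powr (a - 1))) * (1 / ?W ^ j)) (at s)"
      using d by (simp only: o_def of_real_mult times_divide_eq_right mult_1_right)
    then have "((\<lambda>s. of_real (s powr a) / (z - of_real (s powr \<delta>)) ^ j) has_vector_derivative
        of_real a * (of_real (s powr (a - 1)) / ?W ^ j) +
        (of_nat j * of_real \<delta>) * (of_real (s powr (a + \<delta> - 1)) / ?W ^ Suc j)) (at s)"
      unfolding alg e .
    then have "((\<lambda>s. of_real (s powr a) / (z - of_real (s powr \<delta>)) ^ j) has_vector_derivative ?D) (at s)"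
      using 1 by simp
    then show ?thesis
      by (rule has_vector_derivative_transform_within_open[of _ _ _ "{0<..}"]) (use 1 in auto)
  next
    case 2
    have "((\<lambda>s. 0) has_vector_derivative ?D) (at s)" using 2 a \<delta> by simp
    then show ?thesis
      by (rule has_vector_derivative_transform_within_open[of _ _ _ "{..<0}"]) (use 2 a in auto)
  next
    \<comment> \<open>For h > 0 the difference quotient at 0 has the size of h^(a - 1) over a
      denominator tending to z^j; for h < 0 it is 0.\<close>
    case 3
    have D0: "?D = 0" using 3 a \<delta> by simp
    have pw: "((\<lambda>h. max h 0 powr b) \<longlongrightarrow> 0) (at 0)" if "b > 0" for b :: real
    proof (rule tendsto_zero_powrI[OF _ tendsto_const])
      have "((\<lambda>h. max h 0) \<longlongrightarrow> max 0 (0::real)) (at 0)" by (intro tendsto_intros)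
      then show "((\<lambda>h. max h 0) \<longlongrightarrow> (0::real)) (at 0)" by simp
    qed (use that in auto)
    have "((\<lambda>h. of_real (max h 0 powr (a - 1)) / (z - of_real (max h 0 powr \<delta>)) ^ j) \<longlongrightarrow>
        of_real 0 / (z - of_real 0) ^ j) (at 0)"
      using z0 a \<delta> by (intro tendsto_intros pw) auto
    then have lim: "((\<lambda>h. norm (of_real (max h 0 powr (a - 1)) / (z - of_real (max h 0 powr \<delta>)) ^ j)) \<longlongrightarrow> 0) (at 0)"
      by (intro tendsto_norm_zero) simp
    have "(?F has_derivative (\<lambda>h. h *\<^sub>R 0)) (at 0)"
      unfolding has_derivative_at
    proof
      show "bounded_linear (\<lambda>h::real. h *\<^sub>R (0::complex))" by simp
      have "norm (?F (0 + h) - ?F 0 - h *\<^sub>R 0) / norm h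
          = norm (of_real (max h 0 powr (a - 1)) / (z - of_real (max h 0 powr \<delta>)) ^ j)" if "h \<noteq> 0" for h
      proof (cases "h > 0")
        case True
        then have "h powr a = h * h powr (a - 1)" using powr_mult_base[of h "a - 1"] by simp
        then show ?thesis using True a by (simp add: norm_divide norm_mult)
      qed (use a that in auto)
      then show "((\<lambda>h. norm (?F (0 + h) - ?F 0 - h *\<^sub>R 0) / norm h) \<longlongrightarrow> 0) (at 0)"
        by (intro Lim_transform_eventually[OF lim]) (auto simp: eventually_at_filter)
    qed
    then show ?thesis using 3 D0 by (simp add: has_vector_derivative_def)
  qed
qed

text \<open>The denominator is carried along so that the family is closed under differentiation up
  to polynomial factors: (a, j) leads to (a - 1, j) and (a + \<delta> - 1, j + 1).\<close>

definition symbol_power :: "complex \<Rightarrow> real \<Rightarrow> real \<Rightarrow> nat \<Rightarrow> 'a::euclidean_space \<Rightarrow> complex" where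
  "symbol_power z \<delta> a j \<xi> =
     of_real (max (1 - (norm \<xi>)\<^sup>2) 0 powr a) / (z - of_real (max (1 - (norm \<xi>)\<^sup>2) 0 powr \<delta>)) ^ j"

lemma symbol_value_in_unit: "\<delta> > 0 \<Longrightarrow> max (1 - (norm \<xi>)\<^sup>2) 0 powr \<delta> \<in> {0..1::real}"
  by (auto intro!: powr_le1)

lemma symbol_denominator_nonzero:
  assumes "z \<notin> complex_of_real ` {0..1}" "\<delta> > 0"
  shows "z - of_real (max (1 - (norm \<xi>)\<^sup>2) 0 powr \<delta>) \<noteq> 0"
  using assms symbol_value_in_unit[OF assms(2), of \<xi>] by (metis eq_iff_diff_eq_0 imageI)

lemma continuous_symbol_powr:
  "b > 0 \<Longrightarrow> continuous_on S (\<lambda>\<xi>. complex_of_real (max (1 - (norm \<xi>)\<^sup>2) 0 powr b))"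
  by (intro continuous_on_of_real continuous_on_powr' continuous_intros) auto

lemma continuous_symbol_power:
  assumes z: "z \<notin> complex_of_real ` {0..1}" and \<delta>: "\<delta> > 0" and a: "a > 0"
  shows "continuous_on S (symbol_power z \<delta> a j)"
  unfolding symbol_power_def
  using symbol_denominator_nonzero[OF z \<delta>]
  by (intro continuous_on_divide continuous_on_power continuous_on_diff continuous_on_const
      continuous_symbol_powr a \<delta>) auto

text \<open>On the unit ball the weight is at least 2^(-d), so a bound for \<open>f\<close> there is
  a bound by a multiple of the weight.\<close>

lemma decay_bounded_compact_support:
  fixes f :: "'a::euclidean_space \<Rightarrow> complex"
  assumes f: "continuous_on UNIV f" and supp: "\<And>x. norm x > 1 \<Longrightarrow> f x = 0"
  shows "decay_bounded f"
proof -
  have "bounded (f ` cball 0 1)"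
    by (intro compact_imp_bounded compact_continuous_image continuous_on_subset[OF f]) auto
  then obtain M where "\<forall>y\<in>f ` cball 0 1. norm y \<le> M" unfolding bounded_iff by blast
  then have M: "\<And>x. norm x \<le> 1 \<Longrightarrow> norm (f x) \<le> M" by simp
  have "0 \<le> norm (f 0)" "norm (f 0) \<le> M" using M[of 0] by simp_all
  then have M0: "0 \<le> M" by linarith
  have "norm (f x) \<le> (M * 2 ^ DIM('a)) * decay_weight x" for x
  proof (cases "norm x \<le> 1")
    case True
    then have "(norm x)\<^sup>2 \<le> 1" by (simp add: power_le_one)
    then have "(1 + (norm x)\<^sup>2) ^ DIM('a) \<le> 2 ^ DIM('a)" by (intro power_mono) auto
    then have "1 / 2 ^ DIM('a) \<le> 1 / (1 + (norm x)\<^sup>2) ^ DIM('a)"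
      by (intro divide_left_mono mult_pos_pos zero_less_power add_pos_nonneg) auto
    also have "\<dots> \<le> decay_weight x" by (rule decay_weight_ge)
    finally have "1 \<le> 2 ^ DIM('a) * decay_weight x" by (simp add: field_simps)
    then have "M * 1 \<le> M * (2 ^ DIM('a) * decay_weight x)" using M0 by (rule mult_left_mono)
    then show ?thesis using M[OF True] by (simp add: mult.assoc)
  next
    case False
    then show ?thesis using supp[of x] M0 decay_weight_pos[of x] by simp
  qed
  then show ?thesis using f by (auto simp: decay_bounded_def)
qed

lemma symbol_power_has_derivative:
  fixes \<xi> :: "'a::euclidean_space"
  assumes z: "z \<notin> complex_of_real ` {0..1}" and \<delta>: "\<delta> > 0" and a: "a > 1"
  shows "(symbol_power z \<delta> a j has_derivative
    (\<lambda>h. (- 2 * (\<xi> \<bullet> h)) *\<^sub>R (of_real a * symbol_power z \<delta> (a - 1) j \<xi> +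
        of_real (real j * \<delta>) * symbol_power z \<delta> (a + \<delta> - 1) (Suc j) \<xi>))) (at \<xi>)"
proof -
  have u: "((\<lambda>\<xi>::'a. 1 - (norm \<xi>)\<^sup>2) has_derivative (\<lambda>h. - 2 * (\<xi> \<bullet> h))) (at \<xi>)"
    unfolding power2_norm_eq_inner by (auto intro!: derivative_eq_intros simp: inner_commute)
  have "1 - (norm \<xi>)\<^sup>2 \<le> 1" by simp
  from of_real_powr_quotient_derivative[OF z \<delta> a this, of j, unfolded has_vector_derivative_def]
  have "((\<lambda>\<xi>. of_real (max (1 - (norm \<xi>)\<^sup>2) 0 powr a) / (z - of_real (max (1 - (norm \<xi>)\<^sup>2) 0 powr \<delta>)) ^ j)
      has_derivative (\<lambda>h. (- 2 * (\<xi> \<bullet> h)) *\<^sub>R (of_real a * symbol_power z \<delta> (a - 1) j \<xi> +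
        of_real (real j * \<delta>) * symbol_power z \<delta> (a + \<delta> - 1) (Suc j) \<xi>))) (at \<xi>)"
    unfolding symbol_power_def by (rule has_derivative_compose[OF u])
  then show ?thesis by (simp add: symbol_power_def[abs_def])
qed

lemma gauss_poly_continuous:
  assumes "gauss_poly y f"
  shows "continuous_on S f"
proof -
  obtain D where "\<And>x. (f has_derivative D x) (at x)" using gauss_poly_derivative[OF assms] by blast
  then show ?thesis
    by (intro continuous_at_imp_continuous_on) (blast intro: has_derivative_continuous)
qed

text \<open>Each differentiation lowers the exponent \<open>a\<close> by at most one, so \<open>k\<close> derivatives are available
  when \<open>a > k\<close>.\<close>

lemma decaying_symbol_power:
  fixes P :: "'a::euclidean_space \<Rightarrow> complex"
  assumes z: "z \<notin> complex_of_real ` {0..1}" and \<delta>: "\<delta> > 0"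
  shows "gauss_poly 0 P \<Longrightarrow> a > real k \<Longrightarrow> decaying k (\<lambda>\<xi>. P \<xi> * symbol_power z \<delta> a j \<xi>)"
proof (induction k arbitrary: P a j)
  case (0 P a j)
  then have a: "a > 0" by simp
  have "decay_bounded (\<lambda>\<xi>. P \<xi> * symbol_power z \<delta> a j \<xi>)"
  proof (rule decay_bounded_compact_support)
    show "continuous_on UNIV (\<lambda>\<xi>. P \<xi> * symbol_power z \<delta> a j \<xi>)"
      by (intro continuous_on_mult gauss_poly_continuous[OF 0(1)] continuous_symbol_power z \<delta> a)
    show "P x * symbol_power z \<delta> a j x = 0" if "norm x > 1" for x
    proof -
      have "(norm x)\<^sup>2 > 1" using that by (simp add: one_less_power)
      then show ?thesis using a by (simp add: symbol_power_def)
    qed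
  qed
  then show ?case by simp
next
  case (Suc k P a j)
  obtain D where D: "\<And>x. (P has_derivative D x) (at x)" "\<And>b. gauss_poly 0 (\<lambda>x. D x b)"
    using gauss_poly_derivative[OF Suc.prems(1)] by blast
  have a: "a > 1" "a > real k" "a - 1 > real k" "a + \<delta> - 1 > real k" using Suc.prems(2) \<delta> by auto
  let ?G = "symbol_power z \<delta> :: real \<Rightarrow> nat \<Rightarrow> 'a \<Rightarrow> complex"
  let ?E = "\<lambda>\<xi>::'a. of_real a * ?G (a - 1) j \<xi> + of_real (real j * \<delta>) * ?G (a + \<delta> - 1) (Suc j) \<xi>"
  show ?case
  proof (rule decaying_SucI)
    show "decay_bounded (\<lambda>\<xi>. P \<xi> * ?G a j \<xi>)"
      using Suc.IH[OF Suc.prems(1) a(2)] by (rule decaying_imp_decay_bounded)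
    show "((\<lambda>\<xi>. P \<xi> * ?G a j \<xi>) has_derivative
        (\<lambda>h. P x * ((- 2 * (x \<bullet> h)) *\<^sub>R ?E x) + D x h * ?G a j x)) (at x)" for x
      by (rule has_derivative_mult[OF D(1) symbol_power_has_derivative[OF z \<delta> a(1)]])
    fix b :: 'a
    have Q: "gauss_poly 0 (\<lambda>x. c * of_real (x \<bullet> b) * P x)" for c
      by (intro gauss_poly.intros Suc.prems)
    have "decaying k (\<lambda>x. (D x b * ?G a j x - (of_real (2 * a) * of_real (x \<bullet> b) * P x) * ?G (a - 1) j x)
        - (of_real (2 * (real j * \<delta>)) * of_real (x \<bullet> b) * P x) * ?G (a + \<delta> - 1) (Suc j) x)"
      by (intro decaying_diff Suc.IH D(2) Q a)
    also have "(\<lambda>x. (D x b * ?G a j x - (of_real (2 * a) * of_real (x \<bullet> b) * P x) * ?G (a - 1) j x)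
        - (of_real (2 * (real j * \<delta>)) * of_real (x \<bullet> b) * P x) * ?G (a + \<delta> - 1) (Suc j) x)
        = (\<lambda>x. P x * ((- 2 * (x \<bullet> b)) *\<^sub>R ?E x) + D x b * ?G a j x)"
      by (simp add: fun_eq_iff scaleR_conv_of_real algebra_simps)
    finally show "decaying k (\<lambda>x. P x * ((- 2 * (x \<bullet> b)) *\<^sub>R ?E x) + D x b * ?G a j x)" .
  qed
qed

text \<open>The condition \<open>N > 0\<close> matters outside the unit ball: there a zeroth power
  would be 1, whereas \<open>0 powr 0\<close> is 0.\<close>

lemma bochner_riesz_symbol_power:
  fixes \<xi> :: "'a::euclidean_space"
  assumes "N > 0" "\<delta> > 0"
  shows "bochner_riesz_symbol \<delta> \<xi> ^ N / (z - bochner_riesz_symbol \<delta> \<xi>) ^ j = symbol_power z \<delta> (\<delta> * real N) j \<xi>"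
proof -
  let ?t = "max (1 - (norm \<xi>)\<^sup>2) 0"
  have "(?t powr \<delta>) ^ N = ?t powr (\<delta> * real N)"
    using assms by (cases "?t = 0") (simp_all add: powr_power mult.commute)
  then have "complex_of_real (?t powr \<delta>) ^ N = of_real (?t powr (\<delta> * real N))"
    by (simp flip: of_real_power)
  then show ?thesis by (simp add: bochner_riesz_symbol_def symbol_power_def)
qed

text \<open>The exponent \<open>j\<close> is free because the two expansions leave different
  remainders: \<open>j = 1\<close> for the resolvent in terms of m, and a higher \<open>j\<close>
  for m in terms of q.\<close>

lemma bochner_riesz_remainder:
  assumes p: "p \<ge> 1" and z: "z \<notin> complex_of_real ` {0..1}" and \<delta>: "\<delta> > 0"
    and N: "\<delta> * real N > real (2 * DIM('a))"
  shows "\<exists>S. Lp_multiplier p (\<lambda>\<xi>::'a::euclidean_space.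
    bochner_riesz_symbol \<delta> \<xi> ^ N / (z - bochner_riesz_symbol \<delta> \<xi>) ^ j) S"
proof -
  have "N > 0" using N by (cases N) auto
  then have "(\<lambda>\<xi>::'a. bochner_riesz_symbol \<delta> \<xi> ^ N / (z - bochner_riesz_symbol \<delta> \<xi>) ^ j)
      = (\<lambda>\<xi>. 1 * symbol_power z \<delta> (\<delta> * real N) j \<xi>)"
    using \<delta> by (simp add: bochner_riesz_symbol_power)
  then show ?thesis
    using Lp_multiplier_convolve[OF p decaying_symbol_power[OF z \<delta> gauss_poly_const[of 0 1] N, of j]]
    by auto
qed

lemma bochner_riesz_symbol_facts:
  fixes \<delta> :: real
  assumes \<delta>: "\<delta> > 0"
  shows "continuous_on UNIV (bochner_riesz_symbol \<delta> :: 'a::euclidean_space \<Rightarrow> complex)"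
    and "norm (bochner_riesz_symbol \<delta> (\<xi>::'a)) \<le> 1"
    and "bochner_riesz_symbol \<delta> (\<xi>::'a) \<in> complex_of_real ` {0..1}"
    and "integrable lborel (bochner_riesz_symbol \<delta> :: 'a \<Rightarrow> complex)"
proof -
  show c: "continuous_on UNIV (bochner_riesz_symbol \<delta> :: 'a \<Rightarrow> complex)"
    unfolding bochner_riesz_symbol_def by (rule continuous_symbol_powr[OF \<delta>])
  show "bochner_riesz_symbol \<delta> \<xi> \<in> complex_of_real ` {0..1}"
    unfolding bochner_riesz_symbol_def by (rule imageI[OF symbol_value_in_unit[OF \<delta>]])
  then show "norm (bochner_riesz_symbol \<delta> \<xi>) \<le> 1" by auto
  show "integrable lborel (bochner_riesz_symbol \<delta> :: 'a \<Rightarrow> complex)"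
  proof (rule decay_bounded_integrable, rule decay_bounded_compact_support[OF c])
    fix x :: 'a assume "norm x > 1"
    then have "(norm x)\<^sup>2 > 1" by (simp add: one_less_power)
    then show "bochner_riesz_symbol \<delta> x = 0" using \<delta> by (simp add: bochner_riesz_symbol_def)
  qed
qed

text \<open>If \<open>z\<close> is the real number c, then (1 - |\<xi>|^2)^\<delta> = c is solved on
  a coordinate axis by |\<xi>|^2 = 1 - c^(1/\<delta>).\<close>

lemma bochner_riesz_symbol_attains:
  assumes \<delta>: "\<delta> > 0" and z: "z \<in> complex_of_real ` {0..1}"
  shows "\<exists>\<xi>::'a::euclidean_space. bochner_riesz_symbol \<delta> \<xi> = z"
proof -
  obtain c where c: "0 \<le> c" "c \<le> 1" "z = of_real c" using z by auto
  obtain b :: 'a where b: "b \<in> Basis" using nonempty_Basis by blast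
  define s where "s = c powr (1 / \<delta>)"
  have s: "0 \<le> s" "s \<le> 1" using c \<delta> by (auto simp: s_def intro: powr_le1)
  have "(norm (sqrt (1 - s) *\<^sub>R b))\<^sup>2 = 1 - s" using s b by simp
  moreover have "s powr \<delta> = c" using c \<delta> by (simp add: s_def powr_powr)
  ultimately have "bochner_riesz_symbol \<delta> (sqrt (1 - s) *\<^sub>R b) = z"
    using s c(3) by (simp add: bochner_riesz_symbol_def del: norm_scaleR)
  then show ?thesis by blast
qed

lemma Lp_multiplier_polynomial:
  assumes p: "p \<ge> 1" and T: "Lp_multiplier p m T"
  shows "\<exists>S. Lp_multiplier p (\<lambda>\<xi>. \<Sum>k\<in>I. c k * m \<xi> ^ e k) S"
proof (rule Lp_multiplier_sum[OF p])
  fix k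
  obtain S where "Lp_multiplier p (\<lambda>\<xi>. m \<xi> ^ e k) S" using Lp_multiplier_power[OF p T] by blast
  from Lp_multiplier_cmult[OF p this] show "\<exists>S. Lp_multiplier p (\<lambda>\<xi>. c k * m \<xi> ^ e k) S" by blast
qed

section \<open>Finite geometric expansions between m and its resolvent\<close>

lemma resolvent_expansion:
  fixes w z :: "'a::field"
  assumes "z \<noteq> 0" "z - w \<noteq> 0"
  shows "1 / (z - w) = (\<Sum>k<N. (1 / z ^ Suc k) * w ^ k) + (1 / z ^ N) * (w ^ N / (z - w))"
proof (induction N)
  case (Suc N)
  have "(1 / z ^ N) * (w ^ N / (z - w)) = (1 / z ^ Suc N) * w ^ N + (1 / z ^ Suc N) * (w ^ Suc N / (z - w))"
    using assms by (simp add: field_simps)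
  then show ?case using Suc by simp
qed simp

text \<open>Put q = w / (z (z - w)), which is 1 / (z - w) - 1 / z. Then z q = w / (z - w) and w =
  z^2 q / (1 + z q). The sum is the geometric series in -z q cut off at \<open>N\<close>, and the
  remainder is (-z q)^N w.\<close>

lemma symbol_from_resolvent_expansion:
  fixes w z :: "'a::field"
  assumes "z \<noteq> 0" "z - w \<noteq> 0"
  shows "w = (\<Sum>k<N. (z\<^sup>2 * (- z) ^ k) * (w / (z * (z - w))) ^ Suc k) + (- 1) ^ N * (w ^ Suc N / (z - w) ^ N)"
proof (induction N)
  case (Suc N)
  have "(z\<^sup>2 * (- z) ^ N) * (w / (z * (z - w))) ^ Suc N = (- 1) ^ N * (z * w ^ Suc N / (z - w) ^ Suc N)"
    using assms by (simp add: power_mult_distrib power_divide power_minus[of z] power2_eq_square)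
  also have "z * w ^ Suc N / (z - w) ^ Suc N = w ^ Suc N / (z - w) ^ N + w ^ Suc (Suc N) / (z - w) ^ Suc N"
    using assms by (simp add: field_simps)
  finally have "(- 1) ^ N * (w ^ Suc N / (z - w) ^ N) = (z\<^sup>2 * (- z) ^ N) * (w / (z * (z - w))) ^ Suc N
      + (- 1) ^ Suc N * (w ^ Suc (Suc N) / (z - w) ^ Suc N)"
    by (simp add: distrib_left)
  then show ?case using Suc by (simp only: sum.lessThan_Suc add.assoc)
qed simp

lemma large_exponent:
  assumes "\<delta> > (0::real)"
  obtains N :: nat where "\<delta> * real N > K"
proof -
  obtain N where "K / \<delta> < real N" using reals_Archimedean2 by blast
  then show ?thesis using assms that by (simp add: field_simps)
qed

lemma bochner_riesz_resolvent:
  assumes p: "p \<ge> 1" and z: "z \<notin> complex_of_real ` {0..1}" and \<delta>: "\<delta> > 0"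
    and T: "Lp_multiplier p (bochner_riesz_symbol \<delta> :: 'a::euclidean_space \<Rightarrow> complex) T"
  shows "\<exists>S. Lp_multiplier p (\<lambda>\<xi>::'a. 1 / (z - bochner_riesz_symbol \<delta> \<xi>)) S"
proof -
  let ?m = "bochner_riesz_symbol \<delta> :: 'a \<Rightarrow> complex"
  obtain N where N: "\<delta> * real N > real (2 * DIM('a))" by (rule large_exponent[OF \<delta>])
  obtain R where R: "Lp_multiplier p (\<lambda>\<xi>. ?m \<xi> ^ N / (z - ?m \<xi>) ^ 1) R"
    using bochner_riesz_remainder[OF p z \<delta> N] by blast
  obtain S where S: "Lp_multiplier p (\<lambda>\<xi>. \<Sum>k<N. (1 / z ^ Suc k) * ?m \<xi> ^ k) S"
    using Lp_multiplier_polynomial[OF p T, where I="{..<N}" and c="\<lambda>k. 1 / z ^ Suc k" and e="\<lambda>k. k"] by blast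
  have z0: "z \<noteq> 0" using z by force
  have nz: "z - ?m \<xi> \<noteq> 0" for \<xi>
    using symbol_denominator_nonzero[OF z \<delta>] by (simp add: bochner_riesz_symbol_def)
  have "(\<lambda>\<xi>. 1 / (z - ?m \<xi>))
      = (\<lambda>\<xi>. (\<Sum>k<N. (1 / z ^ Suc k) * ?m \<xi> ^ k) + (1 / z ^ N) * (?m \<xi> ^ N / (z - ?m \<xi>) ^ 1))"
    unfolding power_one_right by (intro ext resolvent_expansion z0 nz)
  then show ?thesis
    using Lp_multiplier_add[OF p S Lp_multiplier_cmult[OF p R, of "1 / z ^ N"]] by auto
qed

lemma bochner_riesz_from_resolvent:
  assumes p: "p \<ge> 1" and z: "z \<notin> complex_of_real ` {0..1}" and \<delta>: "\<delta> > 0"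
    and Q: "Lp_multiplier p (\<lambda>\<xi>::'a::euclidean_space. bochner_riesz_symbol \<delta> \<xi> / (z * (z - bochner_riesz_symbol \<delta> \<xi>))) Q"
  shows "\<exists>T. Lp_multiplier p (bochner_riesz_symbol \<delta> :: 'a \<Rightarrow> complex) T"
proof -
  let ?m = "bochner_riesz_symbol \<delta> :: 'a \<Rightarrow> complex"
  obtain N where "\<delta> * real N > real (2 * DIM('a))" by (rule large_exponent[OF \<delta>])
  then have N: "\<delta> * real (Suc N) > real (2 * DIM('a))" using \<delta> by (simp add: distrib_left)
  obtain R where R: "Lp_multiplier p (\<lambda>\<xi>. ?m \<xi> ^ Suc N / (z - ?m \<xi>) ^ N) R"
    using bochner_riesz_remainder[OF p z \<delta> N] by blast
  obtain S where S: "Lp_multiplier p (\<lambda>\<xi>. \<Sum>k<N. (z\<^sup>2 * (- z) ^ k) * (?m \<xi> / (z * (z - ?m \<xi>))) ^ Suc k) S"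
    using Lp_multiplier_polynomial[OF p Q, where I="{..<N}" and c="\<lambda>k. z\<^sup>2 * (- z) ^ k" and e=Suc] by blast
  have z0: "z \<noteq> 0" using z by force
  have nz: "z - ?m \<xi> \<noteq> 0" for \<xi>
    using symbol_denominator_nonzero[OF z \<delta>] by (simp add: bochner_riesz_symbol_def)
  have "?m = (\<lambda>\<xi>. (\<Sum>k<N. (z\<^sup>2 * (- z) ^ k) * (?m \<xi> / (z * (z - ?m \<xi>))) ^ Suc k)
      + (- 1) ^ N * (?m \<xi> ^ Suc N / (z - ?m \<xi>) ^ N))"
    by (intro ext symbol_from_resolvent_expansion z0 nz)
  moreover note Lp_multiplier_add[OF p S Lp_multiplier_cmult[OF p R, of "(- 1) ^ N"]]
  ultimately show ?thesis by (metis (no_types, lifting))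
qed

section \<open>Invertibility on and off the interval\<close>

lemma bochner_riesz_multiplier:
  assumes p: "p \<ge> 1" and \<delta>: "\<delta> > 0"
    and bd: "multiplier_bounded p (bochner_riesz_symbol \<delta> :: 'a::euclidean_space \<Rightarrow> complex)"
  obtains T where "Lp_multiplier p (bochner_riesz_symbol \<delta> :: 'a \<Rightarrow> complex) T"
proof -
  note m = bochner_riesz_symbol_facts[OF \<delta>, where 'a='a]
  have mm: "(bochner_riesz_symbol \<delta> :: 'a \<Rightarrow> complex) \<in> borel_measurable borel"
    using m(1) by (rule borel_measurable_continuous_onI)
  obtain K where "K \<ge> 0" "\<And>s. schwartz s \<Longrightarrow>
      inverse_fourier (\<lambda>\<xi>::'a. bochner_riesz_symbol \<delta> \<xi> * fourier s \<xi>) \<in> Lp_space p \<and>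
      Lp_int p (inverse_fourier (\<lambda>\<xi>. bochner_riesz_symbol \<delta> \<xi> * fourier s \<xi>)) \<le> K * Lp_int p s"
    by (rule multiplier_bounded_imp_bound[OF p bd mm mm _ m(2)]) auto
  then show ?thesis
    using Lp_multiplier_exists[OF p m(1,2,4)] that by blast
qed

lemma shifted_inverse_off_interval:
  assumes p: "p \<ge> 1" and \<delta>: "\<delta> > 0" and z: "z \<notin> complex_of_real ` {0..1}"
    and bd: "multiplier_bounded p (bochner_riesz_symbol \<delta> :: 'a::euclidean_space \<Rightarrow> complex)"
  shows "shifted_has_bounded_inverse p (bochner_riesz_symbol \<delta> :: 'a \<Rightarrow> complex) z"
proof -
  let ?m = "bochner_riesz_symbol \<delta> :: 'a \<Rightarrow> complex"
  obtain T where T: "Lp_multiplier p ?m T" by (rule bochner_riesz_multiplier[OF p \<delta> bd])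
  obtain S where S: "Lp_multiplier p (\<lambda>\<xi>. 1 / (z - ?m \<xi>)) S"
    using bochner_riesz_resolvent[OF p z \<delta> T] by blast
  have nz: "z - ?m \<xi> \<noteq> 0" for \<xi>
    using symbol_denominator_nonzero[OF z \<delta>] by (simp add: bochner_riesz_symbol_def)
  \<comment> \<open>The operator \<open>A\<close> has symbol z - m. Composed with \<open>S\<close>
    in either order it has symbol 1 and is the identity.\<close>
  note A = Lp_multiplier_add[OF p Lp_multiplier_cmult[OF p Lp_multiplier_ident[OF p], of z]
      Lp_multiplier_cmult[OF p T, of "- 1"]]
  have "Lp_multiplier p (\<lambda>\<xi>. 1) (\<lambda>f. S (\<lambda>x. z * f x + - 1 * T f x))"
    using Lp_multiplier_compose[OF p S A] nz by simp
  from Lp_multiplier_1_AE[OF p this]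
  have "AE x in lborel. S (\<lambda>y. z * f y - T f y) x = f x" if "f \<in> Lp_space p" for f
    using that by simp
  moreover have "Lp_multiplier p (\<lambda>\<xi>. 1) (\<lambda>f x. z * S f x + - 1 * T (S f) x)"
    using Lp_multiplier_compose[OF p A S] nz by simp
  from Lp_multiplier_1_AE[OF p this]
  have "AE x in lborel. z * S f x - T (S f) x = f x" if "f \<in> Lp_space p" for f
    using that by simp
  ultimately show ?thesis
    unfolding shifted_has_bounded_inverse_def
    using bd Lp_multiplier_imp_extension[OF p T] Lp_multiplierD(1)[OF S] by auto
qed

text \<open>For f = R g, with \<open>R\<close> the resolvent at w = z + i \<eta>, one has (z - T) f
  = g - i \<eta> f. Applying \<open>S\<close> bounds f by g plus a small multiple of f, which is
  absorbed. The resulting bound \<open>2 * M\<close> for \<open>R\<close> is too small for the value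
  1 / (i \<eta>) of its symbol.\<close>

lemma no_shifted_inverse_on_interval:
  assumes p: "p \<ge> 1" and \<delta>: "\<delta> > 0" and z: "z \<in> complex_of_real ` {0..1}"
    and bd: "multiplier_bounded p (bochner_riesz_symbol \<delta> :: 'a::euclidean_space \<Rightarrow> complex)"
  shows "\<not> shifted_has_bounded_inverse p (bochner_riesz_symbol \<delta> :: 'a \<Rightarrow> complex) z"
proof
  let ?m = "bochner_riesz_symbol \<delta> :: 'a \<Rightarrow> complex"
  note m = bochner_riesz_symbol_facts[OF \<delta>, where 'a='a]
  assume "shifted_has_bounded_inverse p ?m z"
  then obtain T S where T: "multiplier_extension p ?m T" and S: "bounded_Lp_operator p S"
    and inv: "\<And>f. f \<in> Lp_space p \<Longrightarrow> AE x in lborel. S (\<lambda>y. z * f y - T f y) x = f x"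
    unfolding shifted_has_bounded_inverse_def using bd by auto
  have bT: "bounded_Lp_operator p T" using T by (simp add: multiplier_extension_def)
  \<comment> \<open>The definition supplies some extension of the multiplier operator; uniqueness of
    distributional transforms identifies its values on the Gaussian test functions.\<close>
  have "Lp_multiplier p ?m T"
  proof (rule Lp_multiplierI[OF p bT m(1,2,4)])
    fix g :: "'a \<Rightarrow> complex" assume g: "gauss_poly 0 g"
    let ?s = "\<lambda>x. of_real (gauss x) * g x"
    have s: "schwartz ?s" by (rule gauss_mult_poly_schwartz[OF g])
    have "integrable lborel (fourier ?s)"
      by (intro decay_bounded_integrable fourier_decay_bounded schwartz_decaying s)
    then have "integrable lborel (\<lambda>\<xi>. fourier ?s \<xi> * ?m \<xi>)"
      by (rule integrable_mult_bounded[OF _ _ m(2)]) (simp add: borel_measurable_continuous_onI[OF m(1)])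
    then have "integrable lborel (\<lambda>\<xi>. ?m \<xi> * fourier ?s \<xi>)"
      by (simp add: mult.commute)
    then show "AE x in lborel. T ?s x = inverse_fourier (\<lambda>\<xi>. ?m \<xi> * fourier ?s \<xi>) x"
      using T s bounded_Lp_operator_space[OF bT gauss_mult_poly_in_Lp[OF p g]]
      by (intro has_fourier_transform_unique[OF p]) (auto simp: multiplier_extension_def multiplier_image_def)
  qed
  note T = this
  have p0: "p \<ge> 0" using p by simp
  obtain K where K: "K \<ge> 0" "\<And>f. f \<in> Lp_space p \<Longrightarrow> Lp_int p (S f) \<le> K * Lp_int p f"
    using bounded_Lp_operator_int_bound[OF p S] by metis
  define M where "M = K * 2 powr p"
  have M: "M \<ge> 0" using K by (simp add: M_def)
  \<comment> \<open>Chosen so that \<eta>^p is 1 / (4 (M + 1)). Then M \<eta>^p is below 1/2, as the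
    absorption requires, and 2 M \<eta>^p is below 1, which contradicts the final symbol
    estimate.\<close>
  define \<eta> where "\<eta> = (1 / (4 * (M + 1))) powr (1 / p)"
  have \<eta>: "\<eta> > 0" using M by (simp add: \<eta>_def)
  have \<eta>p: "\<eta> powr p = 1 / (4 * (M + 1))" using p M by (simp add: \<eta>_def powr_powr)
  define w where "w = z + \<i> * of_real \<eta>"
  have "Im w = \<eta>" using z by (auto simp: w_def)
  then have w: "w \<notin> complex_of_real ` {0..1}" using \<eta> by auto
  obtain R where R: "Lp_multiplier p (\<lambda>\<xi>. 1 / (w - ?m \<xi>)) R"
    using bochner_riesz_resolvent[OF p w \<delta> T] by blast
  have nz: "w - ?m \<xi> \<noteq> 0" for \<xi>
    using symbol_denominator_nonzero[OF w \<delta>] by (simp add: bochner_riesz_symbol_def)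
  note A = Lp_multiplier_add[OF p Lp_multiplier_cmult[OF p Lp_multiplier_ident[OF p], of w]
      Lp_multiplier_cmult[OF p T, of "- 1"]]
  have AR: "Lp_multiplier p (\<lambda>\<xi>. 1) (\<lambda>f x. w * R f x + - 1 * T (R f) x)"
    using Lp_multiplier_compose[OF p A R] nz by simp
  have Rb: "Lp_int p (R g) \<le> (2 * M) * Lp_int p g" if g: "g \<in> Lp_space p" for g
  proof -
    let ?f = "R g"
    have f: "?f \<in> Lp_space p" by (rule bounded_Lp_operator_space[OF Lp_multiplierD(1)[OF R] g])
    have Tf: "T ?f \<in> Lp_space p" by (rule bounded_Lp_operator_space[OF bT f])
    have zf: "(\<lambda>y. z * ?f y - T ?f y) \<in> Lp_space p" by (intro Lp_space_diff Lp_space_cmult f Tf p0)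
    have Sf: "S (\<lambda>y. z * ?f y - T ?f y) \<in> Lp_space p" by (rule bounded_Lp_operator_space[OF S zf])
    have "AE x in lborel. ?f x = S (\<lambda>y. z * ?f y - T ?f y) x"
      using inv[OF f] by eventually_elim simp
    then have "Lp_int p ?f = Lp_int p (S (\<lambda>y. z * ?f y - T ?f y))"
      by (rule Lp_int_cong_AE[OF Sf Lp_spaceD(1)[OF f]])
    also have "\<dots> \<le> K * Lp_int p (\<lambda>y. z * ?f y - T ?f y)" by (rule K(2)[OF zf])
    \<comment> \<open>This is (w - T) R g = g with w split as z + i \<eta>.\<close>
    also have "Lp_int p (\<lambda>y. z * ?f y - T ?f y) = Lp_int p (\<lambda>y. g y - \<i> * of_real \<eta> * ?f y)"
    proof (rule Lp_int_cong_AE[OF _ Lp_spaceD(1)[OF zf]])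
      show "(\<lambda>y. g y - \<i> * of_real \<eta> * ?f y) \<in> Lp_space p" by (intro Lp_space_diff Lp_space_cmult f g p0)
      show "AE x in lborel. z * ?f x - T ?f x = g x - \<i> * of_real \<eta> * ?f x"
        using Lp_multiplier_1_AE[OF p AR g] by eventually_elim (simp add: w_def algebra_simps)
    qed
    also have "K * \<dots> \<le> K * (2 powr p * (Lp_int p g + Lp_int p (\<lambda>y. \<i> * of_real \<eta> * ?f y)))"
      by (intro mult_left_mono[OF _ K(1)] Lp_int_diff Lp_space_cmult f g p0)
    also have "Lp_int p (\<lambda>y. \<i> * of_real \<eta> * ?f y) = \<eta> powr p * Lp_int p ?f"
      using \<eta> by (simp add: Lp_int_cmult[OF f] norm_mult)
    also have "K * (2 powr p * (Lp_int p g + \<eta> powr p * Lp_int p ?f))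
        = M * Lp_int p g + (M * \<eta> powr p) * Lp_int p ?f"
      by (simp add: M_def algebra_simps)
    finally have le: "Lp_int p ?f \<le> M * Lp_int p g + (M * \<eta> powr p) * Lp_int p ?f" .
    have "M * \<eta> powr p \<le> 1 / 2" using M by (simp add: \<eta>p field_simps)
    then have "(M * \<eta> powr p) * Lp_int p ?f \<le> 1 / 2 * Lp_int p ?f" by (rule mult_right_mono) simp
    with le have "Lp_int p ?f \<le> M * Lp_int p g + 1 / 2 * Lp_int p ?f" by linarith
    then show ?thesis by simp
  qed
  obtain \<xi> :: 'a where \<xi>: "?m \<xi> = z" using bochner_riesz_symbol_attains[OF \<delta> z] by blast
  have "continuous_on UNIV (\<lambda>\<xi>. 1 / (w - ?m \<xi>))"
    by (intro continuous_intros m(1)) (use nz in auto)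
  from Lp_multiplier_symbol_le[OF p R this Rb, of \<xi>]
  have "(1 / \<eta>) powr p \<le> 2 * M" using \<eta> by (simp add: \<xi> w_def norm_divide norm_mult)
  then have "1 \<le> 2 * M * \<eta> powr p" using \<eta> by (simp add: powr_divide field_simps)
  then show False using M by (simp add: \<eta>p field_simps)
qed

lemma no_shifted_inverse_unbounded:
  assumes p: "p \<ge> 1" and \<delta>: "\<delta> > 0"
    and unbd: "\<not> multiplier_bounded p (bochner_riesz_symbol \<delta> :: 'a::euclidean_space \<Rightarrow> complex)"
  shows "\<not> shifted_has_bounded_inverse p (bochner_riesz_symbol \<delta> :: 'a \<Rightarrow> complex) z"
proof
  let ?m = "bochner_riesz_symbol \<delta> :: 'a \<Rightarrow> complex"
  note m = bochner_riesz_symbol_facts[OF \<delta>, where 'a='a]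
  have mm[measurable]: "?m \<in> borel_measurable borel"
    using m(1) by (rule borel_measurable_continuous_onI)
  assume "shifted_has_bounded_inverse p ?m z"
  then obtain n K where n[measurable]: "n \<in> borel_measurable borel" and nK: "AE \<xi> in lborel. norm (n \<xi>) \<le> K"
    and inv: "AE \<xi> in lborel. n \<xi> * (z - ?m \<xi>) = 1" and nb: "multiplier_bounded p n"
    unfolding shifted_has_bounded_inverse_def Linf_space_def using unbd by auto
  show False
  proof (cases "z \<in> complex_of_real ` {0..1}")
    case True
    obtain \<xi>\<^sub>0 :: 'a where \<xi>\<^sub>0: "?m \<xi>\<^sub>0 = z" using bochner_riesz_symbol_attains[OF \<delta> True] by blast
    \<comment> \<open>On \<open>U\<close> the relation n (z - m) = 1 would force |n| above
      \<open>K\<close>. The set is open and nonempty, hence not negligible.\<close>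
    define U where "U = {\<xi>::'a. norm (z - ?m \<xi>) < 1 / (\<bar>K\<bar> + 1)}"
    have "open U"
      unfolding U_def by (intro open_Collect_less continuous_intros m(1))
    moreover have "\<xi>\<^sub>0 \<in> U" by (simp add: U_def \<xi>\<^sub>0 add_nonneg_pos)
    ultimately have U: "\<not> negligible U" using open_not_negligible by blast
    have "AE \<xi> in lborel. \<xi> \<notin> U"
      using nK inv
    proof eventually_elim
      fix \<xi> assume 1: "norm (n \<xi>) \<le> K" and 2: "n \<xi> * (z - ?m \<xi>) = 1"
      show "\<xi> \<notin> U"
      proof
        assume "\<xi> \<in> U"
        then have "norm (z - ?m \<xi>) < 1 / (\<bar>K\<bar> + 1)" by (simp add: U_def)
        then have "norm (n \<xi>) * norm (z - ?m \<xi>) \<le> \<bar>K\<bar> * (1 / (\<bar>K\<bar> + 1))"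
          using 1 by (intro mult_mono) auto
        also have "\<dots> < 1" by (simp add: field_simps add_nonneg_pos)
        finally show False using 2 by (simp flip: norm_mult)
      qed
    qed
    then have "AE \<xi> in lebesgue. \<xi> \<notin> U" by (rule AE_completion)
    then have "U \<in> null_sets lebesgue"
      using \<open>open U\<close> by (simp add: AE_iff_null_sets borel_open)
    then show False using U negligible_iff_null_sets by blast
  next
    case False
    have z0: "z \<noteq> 0" using False by force
    have nz: "z - ?m \<xi> \<noteq> 0" for \<xi>
      using symbol_denominator_nonzero[OF False \<delta>] by (simp add: bochner_riesz_symbol_def)
    \<comment> \<open>Far out \<open>?r\<close> equals the nonzero constant 1 / z and is not
      integrable. Subtracting that constant gives \<open>?q\<close>, which vanishes outside the unit
      ball.\<close>
    let ?r = "\<lambda>\<xi>. 1 / (z - ?m \<xi>)" and ?q = "\<lambda>\<xi>. ?m \<xi> / (z * (z - ?m \<xi>))"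
    have rc: "continuous_on UNIV ?r" by (intro continuous_intros m(1)) (use nz in auto)
    have nr: "AE \<xi> in lborel. n \<xi> = ?r \<xi>"
      using inv by eventually_elim (use nz in \<open>simp add: field_simps\<close>)
    \<comment> \<open>All values of m lie in the compact interval, which avoids \<open>z\<close>, so
      the reciprocals are uniformly bounded.\<close>
    have "compact ((\<lambda>w. 1 / (z - w)) ` complex_of_real ` {0..1})"
      by (intro compact_continuous_image continuous_intros compact_Icc) (use False in auto)
    then have "bounded ((\<lambda>w. 1 / (z - w)) ` complex_of_real ` {0..1})" by (rule compact_imp_bounded)
    then obtain B where "\<forall>y\<in>(\<lambda>w. 1 / (z - w)) ` complex_of_real ` {0..1}. norm y \<le> B"
      unfolding bounded_iff by blast
    then have B: "norm (?r \<xi>) \<le> B" for \<xi> using imageI[OF m(3)] by (rule bspec)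
    have rm[measurable]: "?r \<in> borel_measurable borel" by measurable
    obtain C where C: "C \<ge> 0" "\<And>s. schwartz s \<Longrightarrow> inverse_fourier (\<lambda>\<xi>. ?r \<xi> * fourier s \<xi>) \<in> Lp_space p \<and>
        Lp_int p (inverse_fourier (\<lambda>\<xi>. ?r \<xi> * fourier s \<xi>)) \<le> C * Lp_int p s"
      by (rule multiplier_bounded_imp_bound[OF p nb n rm nr B]) auto
    have q: "continuous_on UNIV ?q" by (intro continuous_intros m(1)) (use nz z0 in auto)
    have qeq: "?q \<xi> = (1 / z) * (?m \<xi> * ?r \<xi>)" for \<xi> by simp
    have qB: "norm (?q \<xi>) \<le> norm (1 / z) * (1 * B)" for \<xi>
      unfolding qeq norm_mult by (intro mult_left_mono mult_mono m(2) B) auto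
    have qi: "integrable lborel ?q"
      unfolding qeq by (intro integrable_mult_right integrable_mult_bounded[OF m(4) _ B]) measurable
    have "\<exists>Q. Lp_multiplier p ?q Q"
    proof (rule Lp_multiplier_exists[OF p q qB qi])
      let ?C = "2 powr p * (C + norm (1 / z) powr p)"
      fix s :: "'a \<Rightarrow> complex" assume s: "schwartz s"
      have sL: "s \<in> Lp_space p" by (intro decay_bounded_in_Lp[OF p] schwartz_decay_bounded s)
      have ifs: "integrable lborel (fourier s)"
        by (intro decay_bounded_integrable fourier_decay_bounded schwartz_decaying s)
      have "integrable lborel (\<lambda>\<xi>. fourier s \<xi> * ?r \<xi>)"
        by (rule integrable_mult_bounded[OF ifs _ B]) measurable
      then have ir: "integrable lborel (\<lambda>\<xi>. ?r \<xi> * fourier s \<xi>)" by (simp add: mult.commute)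
      \<comment> \<open>The symbol 1 / z merely rescales the input, so the bound for
        \<open>?r\<close> on Schwartz functions passes to \<open>?q\<close>.\<close>
      have "?q \<xi> = ?r \<xi> - 1 / z" for \<xi> using nz[of \<xi>] z0 by (simp add: field_simps)
      then have "(\<lambda>\<xi>. ?q \<xi> * fourier s \<xi>) = (\<lambda>\<xi>. ?r \<xi> * fourier s \<xi> - 1 / z * fourier s \<xi>)"
        by (simp add: left_diff_distrib)
      then have eq: "inverse_fourier (\<lambda>\<xi>. ?q \<xi> * fourier s \<xi>)
          = (\<lambda>x. inverse_fourier (\<lambda>\<xi>. ?r \<xi> * fourier s \<xi>) x - 1 / z * s x)"
        by (simp only: inverse_fourier_diff[OF ir integrable_mult_right[OF ifs]] inverse_fourier_cmult
            decaying_inversion(1)[OF schwartz_decaying[OF s]] fun_eq_iff) simp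
      have p0: "p \<ge> 0" using p by simp
      note C2 = C(2)[OF s, THEN conjunct1] C(2)[OF s, THEN conjunct2]
      have "Lp_int p (\<lambda>x. inverse_fourier (\<lambda>\<xi>. ?r \<xi> * fourier s \<xi>) x - 1 / z * s x)
          \<le> 2 powr p * (Lp_int p (inverse_fourier (\<lambda>\<xi>. ?r \<xi> * fourier s \<xi>)) + Lp_int p (\<lambda>x. 1 / z * s x))"
        by (rule Lp_int_diff[OF p0 C2(1) Lp_space_cmult[OF sL]])
      also have "\<dots> \<le> 2 powr p * (C * Lp_int p s + norm (1 / z) powr p * Lp_int p s)"
        unfolding Lp_int_cmult[OF sL] by (intro mult_left_mono add_mono C2(2)) auto
      also have "\<dots> = ?C * Lp_int p s" by (simp only: distrib_right mult.assoc)
      finally show "inverse_fourier (\<lambda>\<xi>. ?q \<xi> * fourier s \<xi>) \<in> Lp_space p \<and>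
          Lp_int p (inverse_fourier (\<lambda>\<xi>. ?q \<xi> * fourier s \<xi>)) \<le> ?C * Lp_int p s"
        unfolding eq using Lp_space_diff[OF p0 C2(1) Lp_space_cmult[OF sL]] by blast
    qed (use C(1) in simp)
    then obtain T where "Lp_multiplier p ?m T"
      using bochner_riesz_from_resolvent[OF p False \<delta>] by blast
    then show False using unbd Lp_multiplier_imp_bounded[OF p] by blast
  qed
qed

theorem theorem1p3:
  fixes \<delta> p :: real
  assumes "\<delta> > 0" and "p \<ge> 1"
  shows "(multiplier_bounded p (bochner_riesz_symbol \<delta> :: real ^ 'd \<Rightarrow> complex) \<longrightarrow>
            multiplier_spectrum p (bochner_riesz_symbol \<delta> :: real ^ 'd \<Rightarrow> complex)
              = complex_of_real ` {0..1}) \<and>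
         (\<not> multiplier_bounded p (bochner_riesz_symbol \<delta> :: real ^ 'd \<Rightarrow> complex) \<longrightarrow>
            multiplier_spectrum p (bochner_riesz_symbol \<delta> :: real ^ 'd \<Rightarrow> complex) = UNIV)"
  using shifted_inverse_off_interval[OF assms(2,1), where 'a="real ^ 'd"]
    no_shifted_inverse_on_interval[OF assms(2,1), where 'a="real ^ 'd"]
    no_shifted_inverse_unbounded[OF assms(2,1), where 'a="real ^ 'd"]
  unfolding multiplier_spectrum_def by blast

end
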